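(* Let $A$ be a commutative ring, and let $X\in D(A)$ with $$H^{-1}(X)=U,\qquad H^0(X)=V,\qquad H^i(X)=0\ \text{ for } i\notin\{-1,0\},$$ where $U$ and $V$ are finitely generated $A$-modules. Let $\alpha\colon F\twoheadrightarrow V$ be a surjection with $F$ a projective $A$-module. Suppose that $x\in A$ is a nonzerodivisor on both $A$ and $U$, and that $xV=0$. Set $$B:=A/xA,\qquad W:=H^0\bigl(\mathbf{R}\operatorname{Hom}_A(B,X)\bigr).$$ Since $F$ is projective, there is a natural isomorphism $\operatorname{Hom}_{D(A)}(F,X)\cong \operatorname{Hom}_A(F,V)$. Let $f\colon F\to X$ be the morphism in $D(A)$ corresponding to $\alpha$, and set $M_f:=H^{-1}(\operatorname{Cone}(f))$. Then the following hold. (1) There is a canonical short exact sequence $$0\longrightarrow U/xU\xrightarrow{\ \overline{\tau}\ } W\xrightarrow{\ \pi\ } V\longrightarrow 0.$$ (2) There is a lift $\widetilde{\alpha}\colon F\to W$ of $\alpha$, i.e. $\pi\circ\widetilde{\alpha}=\alpha$, such that the following holds. Define $$\Phi\colon U\oplus F\longrightarrow W,\qquad \Phi(u,z)=\overline{\tau}(\overline{u})+\widetilde{\alpha}(z),$$ where $\overline{u}$ denotes the image of $u$ in $U/xU$. Then $\Phi$ is surjective, and $M_f\cong\ker(\Phi)$. Moreover, $M_f$ fits into a short exact sequence $$0\longrightarrow U\longrightarrow M_f\longrightarrow \ker(\alpha)\longrightarrow 0.$$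
   Context: $D(A)$ denotes the derived category of $A$-modules; complexes are cohomologically indexed. The translate $C[p]$ of a complex $C$ is defined by $C[p]^n=C^{n-p}$ with differential $d^n_{C[p]}=(-1)^p d_C^{n-p}$. A morphism $f\colon F\to X$ has an exact triangle $F\xrightarrow{f}X\to\operatorname{Cone}(f)\to F[-1]$; here $F$ is viewed as a complex concentrated in degree $0$. The isomorphism $\operatorname{Hom}_{D(A)}(F,X)\cong\operatorname{Hom}_A(F,V)$ sends $g$ to $H^0(g)$. The canonical sequence in (1) is the one obtained from the long exact cohomology sequence of the exact triangle that results from applying $\mathbf{R}\operatorname{Hom}_A(-,X)$ to the triangle $A\xrightarrow{x}A\to B\to A[-1]$, namely from the exact sequence $H^{-1}(X)\xrightarrow{x}H^{-1}(X)\xrightarrow{\tau}H^0(\mathbf{R}\operatorname{Hom}_A(B,X))\xrightarrow{\pi}H^0(X)\xrightarrow{x}H^0(X)$, with $\overline{\tau}$ the map induced by $\tau$ on $U/xU$. *)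

theory Defs
  imports "HOL-Algebra.Module" "HOL-Algebra.AbelCoset"
begin

section \<open>Modules\<close>

text \<open>
  Modules are records of HOL-Algebra; the ring fields \<open>mult\<close> and \<open>one\<close> that such a record inherits
  carry no meaning for a module and are left undefined.
\<close>

definition mod_hom ::
  "('a, 'r) ring_scheme \<Rightarrow> ('a, 'm) module \<Rightarrow> ('a, 'n) module \<Rightarrow> ('m \<Rightarrow> 'n) set" where
  "mod_hom A M N = {h \<in> carrier M \<rightarrow> carrier N.
     (\<forall>v\<in>carrier M. \<forall>w\<in>carrier M. h (v \<oplus>\<^bsub>M\<^esub> w) = h v \<oplus>\<^bsub>N\<^esub> h w) \<and>
     (\<forall>a\<in>carrier A. \<forall>v\<in>carrier M. h (a \<odot>\<^bsub>M\<^esub> v) = a \<odot>\<^bsub>N\<^esub> h v)}"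

definition mod_iso ::
  "('a, 'r) ring_scheme \<Rightarrow> ('a, 'm) module \<Rightarrow> ('a, 'n) module \<Rightarrow> ('m \<Rightarrow> 'n) set" where
  "mod_iso A M N = {h \<in> mod_hom A M N. bij_betw h (carrier M) (carrier N)}"

definition mod_isomorphic ::
  "('a, 'r) ring_scheme \<Rightarrow> ('a, 'm) module \<Rightarrow> ('a, 'n) module \<Rightarrow> bool" where
  "mod_isomorphic A M N \<longleftrightarrow> mod_iso A M N \<noteq> {}"

text \<open>\<open>Hom\<^sub>A(M, N)\<close>; its elements are extensional, so that equal homomorphisms are equal functions.\<close>

definition hom_module ::
  "('a, 'r) ring_scheme \<Rightarrow> ('a, 'm) module \<Rightarrow> ('a, 'n) module \<Rightarrow> ('a, 'm \<Rightarrow> 'n) module" where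
  "hom_module A M N =
     \<lparr>carrier = mod_hom A M N \<inter> extensional (carrier M), mult = undefined, one = undefined,
      zero = (\<lambda>v\<in>carrier M. \<zero>\<^bsub>N\<^esub>),
      add = (\<lambda>h k. \<lambda>v\<in>carrier M. h v \<oplus>\<^bsub>N\<^esub> k v),
      smult = (\<lambda>a h. \<lambda>v\<in>carrier M. a \<odot>\<^bsub>N\<^esub> h v)\<rparr>"

definition regular_module :: "('a, 'r) ring_scheme \<Rightarrow> ('a, 'a) module" where
  "regular_module A =
     \<lparr>carrier = carrier A, mult = undefined, one = undefined, zero = \<zero>\<^bsub>A\<^esub>,
      add = (\<lambda>a b. a \<oplus>\<^bsub>A\<^esub> b), smult = (\<lambda>a b. a \<otimes>\<^bsub>A\<^esub> b)\<rparr>"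

definition zero_submodule :: "('a, 'm) module \<Rightarrow> ('a, 'm) module" where
  "zero_submodule M = M\<lparr>carrier := {\<zero>\<^bsub>M\<^esub>}\<rparr>"

definition direct_sum :: "('a, 'm) module \<Rightarrow> ('a, 'n) module \<Rightarrow> ('a, 'm \<times> 'n) module" where
  "direct_sum M N =
     \<lparr>carrier = carrier M \<times> carrier N, mult = undefined, one = undefined,
      zero = (\<zero>\<^bsub>M\<^esub>, \<zero>\<^bsub>N\<^esub>),
      add = (\<lambda>p q. (fst p \<oplus>\<^bsub>M\<^esub> fst q, snd p \<oplus>\<^bsub>N\<^esub> snd q)),
      smult = (\<lambda>a p. (a \<odot>\<^bsub>M\<^esub> fst p, a \<odot>\<^bsub>N\<^esub> snd p))\<rparr>"

definition quotient_module :: "('a, 'm) module \<Rightarrow> 'm set \<Rightarrow> ('a, 'm set) module" where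
  "quotient_module M N =
     \<lparr>carrier = a_rcosets\<^bsub>M\<^esub> N, mult = undefined, one = undefined, zero = N,
      add = (\<lambda>S T. S <+>\<^bsub>M\<^esub> T),
      smult = (\<lambda>a S. \<Union>v\<in>S. N +>\<^bsub>M\<^esub> (a \<odot>\<^bsub>M\<^esub> v))\<rparr>"

definition kernel_module :: "('a, 'm) module \<Rightarrow> ('a, 'n) module \<Rightarrow> ('m \<Rightarrow> 'n) \<Rightarrow> ('a, 'm) module" where
  "kernel_module M N h = M\<lparr>carrier := {v \<in> carrier M. h v = \<zero>\<^bsub>N\<^esub>}\<rparr>"

text \<open>The submodule \<open>xM\<close>.\<close>

definition multiples :: "('a, 'm) module \<Rightarrow> 'a \<Rightarrow> 'm set" where
  "multiples M x = (\<lambda>v. x \<odot>\<^bsub>M\<^esub> v) ` carrier M"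

definition nonzerodivisor_on :: "('a, 'm) module \<Rightarrow> 'a \<Rightarrow> bool" where
  "nonzerodivisor_on M x \<longleftrightarrow> (\<forall>v\<in>carrier M. x \<odot>\<^bsub>M\<^esub> v = \<zero>\<^bsub>M\<^esub> \<longrightarrow> v = \<zero>\<^bsub>M\<^esub>)"

definition finitely_generated :: "('a, 'r) ring_scheme \<Rightarrow> ('a, 'm) module \<Rightarrow> bool" where
  "finitely_generated A M \<longleftrightarrow>
     (\<exists>S. finite S \<and> S \<subseteq> carrier M \<and> \<Inter>{N. submodule N A M \<and> S \<subseteq> N} = carrier M)"

text \<open>
  The lifting property. HOL cannot quantify over the types that carry the test modules, so these
  are fixed; nothing is lost. The free module on the set \<open>carrier M\<close> is carried by functions of
  type \<open>'m \<Rightarrow> 'a\<close>; lifting the identity of \<open>M\<close> along the surjection from it makes \<open>M\<close> a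
  direct summand of a free module, whence the lifting property for modules on all types.
\<close>

definition projective_module :: "('a, 'r) ring_scheme \<Rightarrow> ('a, 'm) module \<Rightarrow> bool" where
  "projective_module A M \<longleftrightarrow> module A M \<and>
     (\<forall>(N :: ('a, 'm \<Rightarrow> 'a) module) (N' :: ('a, 'm) module) p h.
        module A N \<and> module A N' \<and> p \<in> mod_hom A N N' \<and> p ` carrier N = carrier N' \<and>
        h \<in> mod_hom A M N' \<longrightarrow>
        (\<exists>k\<in>mod_hom A M N. \<forall>v\<in>carrier M. p (k v) = h v))"

definition short_exact ::
  "('a, 'r) ring_scheme \<Rightarrow> ('a, 'l) module \<Rightarrow> ('a, 'm) module \<Rightarrow> ('a, 'n) module \<Rightarrow>
     ('l \<Rightarrow> 'm) \<Rightarrow> ('m \<Rightarrow> 'n) \<Rightarrow> bool" where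
  "short_exact A L M N i p \<longleftrightarrow>
     i \<in> mod_hom A L M \<and> p \<in> mod_hom A M N \<and>
     inj_on i (carrier L) \<and> i ` carrier L = {v \<in> carrier M. p v = \<zero>\<^bsub>N\<^esub>} \<and>
     p ` carrier M = carrier N"


section \<open>Complexes\<close>

text \<open>A complex \<open>C\<close> has terms \<open>obj C n\<close> and differentials \<open>diff C n\<close> from degree \<open>n\<close> to \<open>n + 1\<close>.\<close>

record ('a, 'm) cplx =
  obj :: "int \<Rightarrow> ('a, 'm) module"
  diff :: "int \<Rightarrow> 'm \<Rightarrow> 'm"

definition is_complex :: "('a, 'r) ring_scheme \<Rightarrow> ('a, 'm) cplx \<Rightarrow> bool" where
  "is_complex A C \<longleftrightarrow>
     (\<forall>n. module A (obj C n) \<and> diff C n \<in> mod_hom A (obj C n) (obj C (n + 1)) \<and>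
          (\<forall>v\<in>carrier (obj C n). diff C (n + 1) (diff C n v) = \<zero>\<^bsub>obj C (n + 1 + 1)\<^esub>))"

definition chain_map ::
  "('a, 'r) ring_scheme \<Rightarrow> ('a, 'm) cplx \<Rightarrow> ('a, 'n) cplx \<Rightarrow> (int \<Rightarrow> 'm \<Rightarrow> 'n) \<Rightarrow> bool" where
  "chain_map A C D g \<longleftrightarrow>
     (\<forall>n. g n \<in> mod_hom A (obj C n) (obj D n) \<and>
          (\<forall>v\<in>carrier (obj C n). diff D n (g n v) = g (n + 1) (diff C n v)))"

definition homotopic ::
  "('a, 'r) ring_scheme \<Rightarrow> ('a, 'm) cplx \<Rightarrow> ('a, 'n) cplx \<Rightarrow>
     (int \<Rightarrow> 'm \<Rightarrow> 'n) \<Rightarrow> (int \<Rightarrow> 'm \<Rightarrow> 'n) \<Rightarrow> bool" where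
  "homotopic A C D g g' \<longleftrightarrow>
     (\<exists>h. \<forall>n. h n \<in> mod_hom A (obj C n) (obj D (n - 1)) \<and>
        (\<forall>v\<in>carrier (obj C n).
           g n v \<ominus>\<^bsub>obj D n\<^esub> g' n v = diff D (n - 1) (h n v) \<oplus>\<^bsub>obj D n\<^esub> h (n + 1) (diff C n v)))"

definition cycles :: "('a, 'm) cplx \<Rightarrow> int \<Rightarrow> ('a, 'm) module" where
  "cycles C n = kernel_module (obj C n) (obj C (n + 1)) (diff C n)"

definition boundaries :: "('a, 'm) cplx \<Rightarrow> int \<Rightarrow> 'm set" where
  "boundaries C n = diff C (n - 1) ` carrier (obj C (n - 1))"

definition cohomology :: "('a, 'm) cplx \<Rightarrow> int \<Rightarrow> ('a, 'm set) module" where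
  "cohomology C n = quotient_module (cycles C n) (boundaries C n)"

definition coh_class :: "('a, 'm) cplx \<Rightarrow> int \<Rightarrow> 'm \<Rightarrow> 'm set" where
  "coh_class C n v = boundaries C n +>\<^bsub>cycles C n\<^esub> v"

text \<open>The map \<open>H\<^sup>n(C) \<rightarrow> H\<^sup>n(D)\<close> induced by \<open>g\<close>; only the target \<open>D\<close> enters the formula.\<close>

definition coh_map :: "('a, 'n) cplx \<Rightarrow> int \<Rightarrow> (int \<Rightarrow> 'm \<Rightarrow> 'n) \<Rightarrow> 'm set \<Rightarrow> 'n set" where
  "coh_map D n g S = the_elem ((\<lambda>v. coh_class D n (g n v)) ` S)"

definition quasi_iso ::
  "('a, 'r) ring_scheme \<Rightarrow> ('a, 'm) cplx \<Rightarrow> ('a, 'n) cplx \<Rightarrow> (int \<Rightarrow> 'm \<Rightarrow> 'n) \<Rightarrow> bool" where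
  "quasi_iso A C D g \<longleftrightarrow> chain_map A C D g \<and>
     (\<forall>n. bij_betw (coh_map D n g) (carrier (cohomology C n)) (carrier (cohomology D n)))"

text \<open>
  A module as a complex concentrated in degree 0. The other terms are zero modules, so a
  homomorphism \<open>h\<close> of modules is the chain map \<open>\<lambda>n. h\<close>.
\<close>

definition concentrated :: "('a, 'm) module \<Rightarrow> ('a, 'm) cplx" where
  "concentrated M =
     \<lparr>obj = (\<lambda>n. if n = 0 then M else zero_submodule M), diff = (\<lambda>n v. \<zero>\<^bsub>M\<^esub>)\<rparr>"

text \<open>The translate \<open>C[p]\<close> with \<open>C[p]\<^sup>n = C\<^sup>n\<^sup>-\<^sup>p\<close>; thus \<open>C[-1]\<close> is the usual suspension.\<close>

definition translate :: "('a, 'm) cplx \<Rightarrow> int \<Rightarrow> ('a, 'm) cplx" where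
  "translate C p =
     \<lparr>obj = (\<lambda>n. obj C (n - p)),
      diff = (\<lambda>n v. if even p then diff C (n - p) v
                    else \<ominus>\<^bsub>obj C (n - p + 1)\<^esub> diff C (n - p) v)\<rparr>"

text \<open>
  The standard triangle of a chain map \<open>g : C \<rightarrow> D\<close> is
  \<open>C \<rightarrow> D \<rightarrow> mapping_cone C D g \<rightarrow> C[-1]\<close>, the last map being the first projection.
\<close>

definition mapping_cone ::
  "('a, 'm) cplx \<Rightarrow> ('a, 'n) cplx \<Rightarrow> (int \<Rightarrow> 'm \<Rightarrow> 'n) \<Rightarrow> ('a, 'm \<times> 'n) cplx" where
  "mapping_cone C D g =
     \<lparr>obj = (\<lambda>n. direct_sum (obj C (n + 1)) (obj D n)),
      diff = (\<lambda>n p. (\<ominus>\<^bsub>obj C (n + 1 + 1)\<^esub> diff C (n + 1) (fst p),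
                     g (n + 1) (fst p) \<oplus>\<^bsub>obj D (n + 1)\<^esub> diff D n (snd p)))\<rparr>"

text \<open>
  The complex \<open>Hom\<^sub>A(C, X)\<close>: in degree \<open>n\<close> the product of the \<open>Hom\<^sub>A(C\<^sup>p, X\<^sup>p\<^sup>+\<^sup>n)\<close> over all \<open>p\<close>, with
  differential \<open>\<phi> \<mapsto> d \<circ> \<phi> - (-1)\<^sup>n \<phi> \<circ> d\<close>.
\<close>

definition hom_complex ::
  "('a, 'r) ring_scheme \<Rightarrow> ('a, 'p) cplx \<Rightarrow> ('a, 'm) cplx \<Rightarrow> ('a, int \<Rightarrow> 'p \<Rightarrow> 'm) cplx" where
  "hom_complex A C X =
     \<lparr>obj = (\<lambda>n.
        \<lparr>carrier = {\<phi>. \<forall>p. \<phi> p \<in> carrier (hom_module A (obj C p) (obj X (p + n)))},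
         mult = undefined, one = undefined,
         zero = (\<lambda>p. \<zero>\<^bsub>hom_module A (obj C p) (obj X (p + n))\<^esub>),
         add = (\<lambda>\<phi> \<psi> p. \<phi> p \<oplus>\<^bsub>hom_module A (obj C p) (obj X (p + n))\<^esub> \<psi> p),
         smult = (\<lambda>a \<phi> p. a \<odot>\<^bsub>hom_module A (obj C p) (obj X (p + n))\<^esub> \<phi> p)\<rparr>),
      diff = (\<lambda>n \<phi> p. \<lambda>v\<in>carrier (obj C p).
        if even n
        then diff X (p + n) (\<phi> p v) \<ominus>\<^bsub>obj X (p + n + 1)\<^esub> \<phi> (p + 1) (diff C p v)
        else diff X (p + n) (\<phi> p v) \<oplus>\<^bsub>obj X (p + n + 1)\<^esub> \<phi> (p + 1) (diff C p v))\<rparr>"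

text \<open>Precomposition with \<open>g : C \<rightarrow> D\<close>, a chain map \<open>Hom\<^sub>A(D, X) \<rightarrow> Hom\<^sub>A(C, X)\<close>.\<close>

definition precompose ::
  "('a, 'p) cplx \<Rightarrow> (int \<Rightarrow> 'p \<Rightarrow> 'q) \<Rightarrow> int \<Rightarrow> (int \<Rightarrow> 'q \<Rightarrow> 'm) \<Rightarrow> (int \<Rightarrow> 'p \<Rightarrow> 'm)" where
  "precompose C g n \<phi> = (\<lambda>p. \<lambda>v\<in>carrier (obj C p). \<phi> p (g p v))"


section \<open>Morphisms in the derived category\<close>

text \<open>
  A morphism \<open>C \<rightarrow> X\<close> in \<open>D(A)\<close> is a class of roofs \<open>C \<leftarrow> Z \<rightarrow> X\<close>, given as triples \<open>(Z, s, g)\<close> with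
  \<open>s : Z \<rightarrow> C\<close> a quasi-isomorphism, for the usual relation of the calculus of fractions. All
  complexes in sight are carried by the type \<open>'m\<close>, which plays the role of a universe: for
  \<open>'m\<close> infinite and at least as large as \<open>A\<close>, the modules on subsets of \<open>'m\<close> form an abelian
  category with enough projectives, closed under submodules, quotients and countable direct sums,
  and every family of modules is carried, up to isomorphism, by some type.
\<close>

type_synonym ('a, 'm) roof = "('a, 'm) cplx \<times> (int \<Rightarrow> 'm \<Rightarrow> 'm) \<times> (int \<Rightarrow> 'm \<Rightarrow> 'm)"

definition roofs ::
  "('a, 'r) ring_scheme \<Rightarrow> ('a, 'm) cplx \<Rightarrow> ('a, 'm) cplx \<Rightarrow> ('a, 'm) roof set" where
  "roofs A C X = {(Z, s, g). is_complex A Z \<and> quasi_iso A Z C s \<and> chain_map A Z X g}"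

definition roof_rel ::
  "('a, 'r) ring_scheme \<Rightarrow> ('a, 'm) cplx \<Rightarrow> ('a, 'm) cplx \<Rightarrow>
     (('a, 'm) roof \<times> ('a, 'm) roof) set" where
  "roof_rel A C X = {((Z, s, g), (Z', s', g')).
     (Z, s, g) \<in> roofs A C X \<and> (Z', s', g') \<in> roofs A C X \<and>
     (\<exists>(Y :: ('a, 'm) cplx) u u'.
        is_complex A Y \<and> chain_map A Y Z u \<and> chain_map A Y Z' u' \<and>
        quasi_iso A Y C (\<lambda>n v. s n (u n v)) \<and>
        homotopic A Y C (\<lambda>n v. s n (u n v)) (\<lambda>n v. s' n (u' n v)) \<and>
        homotopic A Y X (\<lambda>n v. g n (u n v)) (\<lambda>n v. g' n (u' n v)))}"

text \<open>\<open>Hom\<close> in \<open>D(A)\<close>, as an \<open>A\<close>-module: fractions are added over a common denominator.\<close>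

definition derived_hom ::
  "('a, 'r) ring_scheme \<Rightarrow> ('a, 'm) cplx \<Rightarrow> ('a, 'm) cplx \<Rightarrow> ('a, ('a, 'm) roof set) module" where
  "derived_hom A C X =
     \<lparr>carrier = roofs A C X // roof_rel A C X, mult = undefined, one = undefined,
      zero = roof_rel A C X `` {(C, \<lambda>n v. v, \<lambda>n v. \<zero>\<^bsub>obj X n\<^esub>)},
      add = (\<lambda>f f'. roof_rel A C X ``
        {(Z, s, \<lambda>n v. g n v \<oplus>\<^bsub>obj X n\<^esub> g' n v) | Z s g g'. (Z, s, g) \<in> f \<and> (Z, s, g') \<in> f'}),
      smult = (\<lambda>a f. roof_rel A C X ``
        {(Z, s, \<lambda>n v. a \<odot>\<^bsub>obj X n\<^esub> g n v) | Z s g. (Z, s, g) \<in> f})\<rparr>"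

definition roof_coh ::
  "('a, 'm) cplx \<Rightarrow> ('a, 'm) cplx \<Rightarrow> int \<Rightarrow> ('a, 'm) roof \<Rightarrow> 'm set \<Rightarrow> 'm set" where
  "roof_coh C X n r = (case r of (Z, s, g) \<Rightarrow>
     coh_map X n g \<circ> inv_into (carrier (cohomology Z n)) (coh_map C n s))"

text \<open>\<open>H\<^sup>n(f)\<close> for a morphism \<open>f : C \<rightarrow> X\<close> of \<open>D(A)\<close>; it does not depend on the roof chosen.\<close>

definition derived_coh ::
  "('a, 'm) cplx \<Rightarrow> ('a, 'm) cplx \<Rightarrow> int \<Rightarrow> ('a, 'm) roof set \<Rightarrow> 'm set \<Rightarrow> 'm set" where
  "derived_coh C X n f = roof_coh C X n (SOME r. r \<in> f)"

text \<open>\<open>H\<^sup>0(f) : F \<rightarrow> H\<^sup>0(X)\<close> for \<open>f : F \<rightarrow> X\<close> in \<open>D(A)\<close>, under the identification \<open>H\<^sup>0(F) = F\<close>.\<close>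

definition derived_H0 ::
  "('a, 'm) module \<Rightarrow> ('a, 'm) cplx \<Rightarrow> ('a, 'm) roof set \<Rightarrow> 'm \<Rightarrow> 'm set" where
  "derived_H0 F X f =
     (\<lambda>z\<in>carrier F. derived_coh (concentrated F) X 0 f (coh_class (concentrated F) 0 z))"

text \<open>
  The cones of \<open>f : C \<rightarrow> X\<close> in \<open>D(A)\<close>: if \<open>(Z, s, g)\<close> represents \<open>f\<close>, the isomorphism \<open>s\<close> of \<open>D(A)\<close>
  turns the standard triangle of \<open>g\<close> into an exact triangle \<open>C \<rightarrow> X \<rightarrow> Cone(g) \<rightarrow> C[-1]\<close> on \<open>f\<close>.
\<close>

definition derived_cones ::
  "('a, 'm) cplx \<Rightarrow> ('a, 'm) roof set \<Rightarrow> ('a, 'm \<times> 'm) cplx set" where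
  "derived_cones X f = {mapping_cone Z X g | Z s g. (Z, s, g) \<in> f}"


section \<open>Derived Hom\<close>

text \<open>
  \<open>RHom\<^sub>A(B, X)\<close> is \<open>hom_complex A P X\<close> for any projective resolution \<open>P\<close> of the module \<open>B\<close>.
\<close>

definition projective_resolution ::
  "('a, 'r) ring_scheme \<Rightarrow> ('a, 'p) cplx \<Rightarrow> ('a, 'b) module \<Rightarrow> (int \<Rightarrow> 'p \<Rightarrow> 'b) \<Rightarrow> bool" where
  "projective_resolution A P B e \<longleftrightarrow>
     is_complex A P \<and> (\<forall>n. projective_module A (obj P n)) \<and>
     (\<forall>n>0. carrier (obj P n) = {\<zero>\<^bsub>obj P n\<^esub>}) \<and>
     quasi_iso A P (concentrated B) e"

text \<open>
  For a module \<open>B\<close> with projective resolution \<open>e : P \<rightarrow> B\<close> and a roof \<open>B \<leftarrow> K \<rightarrow> Y\<close> with legs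
  \<open>s\<close>, \<open>g\<close>, the chain map \<open>h : P \<rightarrow> Y\<close> equals \<open>(g \<circ> s\<^sup>-\<^sup>1) \<circ> e\<close> in \<open>D(A)\<close>. The comparison map \<open>c\<close> is
  unique up to homotopy, hence so is \<open>h\<close>, and precomposition with \<open>h\<close> computes
  \<open>RHom\<^sub>A(-, X)\<close> of the morphism \<open>B \<rightarrow> Y\<close> when the terms of \<open>Y\<close> are projective and \<open>Y\<close> is bounded
  above.
\<close>

definition represents_roof ::
  "('a, 'r) ring_scheme \<Rightarrow> ('a, 'p) cplx \<Rightarrow> ('a, 'b) module \<Rightarrow> (int \<Rightarrow> 'p \<Rightarrow> 'b) \<Rightarrow>
     ('a, 'k) cplx \<Rightarrow> (int \<Rightarrow> 'k \<Rightarrow> 'b) \<Rightarrow> ('a, 'y) cplx \<Rightarrow> (int \<Rightarrow> 'k \<Rightarrow> 'y) \<Rightarrow>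
     (int \<Rightarrow> 'p \<Rightarrow> 'y) \<Rightarrow> bool" where
  "represents_roof A P B e K s Y g h \<longleftrightarrow> chain_map A P Y h \<and>
     (\<exists>c. chain_map A P K c \<and>
        homotopic A P (concentrated B) (\<lambda>n v. s n (c n v)) e \<and>
        homotopic A P Y (\<lambda>n v. g n (c n v)) h)"

text \<open>
  The triangle \<open>A \<rightarrow> A \<rightarrow> B \<rightarrow> A[-1]\<close> with first map multiplication by \<open>x\<close> and \<open>B = A/xA\<close>: it is the
  standard triangle of \<open>x\<close>, in which the cone is replaced by \<open>B\<close> along the quasi-isomorphism
  \<open>(a, b) \<mapsto> b + xA\<close>. So \<open>A \<rightarrow> B\<close> is the projection, and \<open>B \<rightarrow> A[-1]\<close> is the roof
  \<open>B \<leftarrow> Cone(x) \<rightarrow> A[-1]\<close>.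
\<close>

definition ring_quotient :: "('a, 'r) ring_scheme \<Rightarrow> 'a \<Rightarrow> ('a, 'a set) module" where
  "ring_quotient A x = quotient_module (regular_module A) (multiples (regular_module A) x)"

definition ring_quotient_proj :: "('a, 'r) ring_scheme \<Rightarrow> 'a \<Rightarrow> 'a \<Rightarrow> 'a set" where
  "ring_quotient_proj A x b = multiples (regular_module A) x +>\<^bsub>regular_module A\<^esub> b"

definition ring_complex :: "('a, 'r) ring_scheme \<Rightarrow> ('a, 'a) cplx" where
  "ring_complex A = concentrated (regular_module A)"

definition cone_of_mult :: "('a, 'r) ring_scheme \<Rightarrow> 'a \<Rightarrow> ('a, 'a \<times> 'a) cplx" where
  "cone_of_mult A x = mapping_cone (ring_complex A) (ring_complex A) (\<lambda>n a. x \<otimes>\<^bsub>A\<^esub> a)"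

text \<open>Chain maps on a projective resolution \<open>P\<close> of \<open>B\<close> representing \<open>A \<rightarrow> B\<close> and \<open>B \<rightarrow> A[-1]\<close>.\<close>

definition represents_projection ::
  "('a, 'r) ring_scheme \<Rightarrow> 'a \<Rightarrow> ('a, 'p) cplx \<Rightarrow> (int \<Rightarrow> 'p \<Rightarrow> 'a set) \<Rightarrow>
     (int \<Rightarrow> 'a \<Rightarrow> 'p) \<Rightarrow> bool" where
  "represents_projection A x P e j \<longleftrightarrow>
     chain_map A (ring_complex A) P j \<and>
     homotopic A (ring_complex A) (concentrated (ring_quotient A x))
       (\<lambda>n a. e n (j n a)) (\<lambda>n. ring_quotient_proj A x)"

definition represents_connecting ::
  "('a, 'r) ring_scheme \<Rightarrow> 'a \<Rightarrow> ('a, 'p) cplx \<Rightarrow> (int \<Rightarrow> 'p \<Rightarrow> 'a set) \<Rightarrow>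
     (int \<Rightarrow> 'p \<Rightarrow> 'a) \<Rightarrow> bool" where
  "represents_connecting A x P e h \<longleftrightarrow>
     represents_roof A P (ring_quotient A x) e
       (cone_of_mult A x) (\<lambda>n p. ring_quotient_proj A x (snd p))
       (translate (ring_complex A) (-1)) (\<lambda>n. fst) h"

text \<open>
  The identification \<open>H\<^sup>0(RHom\<^sub>A(A[q], X)) = H\<^sup>q(X)\<close>: evaluation at the element 1 of \<open>A[q]\<^sup>q = A\<close>.
\<close>

definition eval_one ::
  "('a, 'r) ring_scheme \<Rightarrow> ('a, 'm) cplx \<Rightarrow> int \<Rightarrow> (int \<Rightarrow> 'a \<Rightarrow> 'm) set \<Rightarrow> 'm set" where
  "eval_one A X q S = the_elem ((\<lambda>\<phi>. coh_class X q (\<phi> q \<one>\<^bsub>A\<^esub>)) ` S)"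

text \<open>
  The maps \<open>\<tau> : H\<^sup>-\<^sup>1(X) = H\<^sup>0(RHom\<^sub>A(A[-1], X)) \<rightarrow> H\<^sup>0(RHom\<^sub>A(B, X))\<close> and
  \<open>\<pi> : H\<^sup>0(RHom\<^sub>A(B, X)) \<rightarrow> H\<^sup>0(RHom\<^sub>A(A, X)) = H\<^sup>0(X)\<close> of the long exact sequence, for chain maps
  \<open>h\<close> and \<open>j\<close> representing \<open>B \<rightarrow> A[-1]\<close> and \<open>A \<rightarrow> B\<close>.
\<close>

definition les_tau ::
  "('a, 'r) ring_scheme \<Rightarrow> ('a, 'm) cplx \<Rightarrow> ('a, 'p) cplx \<Rightarrow> (int \<Rightarrow> 'p \<Rightarrow> 'a) \<Rightarrow>
     'm set \<Rightarrow> (int \<Rightarrow> 'p \<Rightarrow> 'm) set" where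
  "les_tau A X P h =
     coh_map (hom_complex A P X) 0 (precompose P h) \<circ>
     inv_into (carrier (cohomology (hom_complex A (translate (ring_complex A) (-1)) X) 0))
       (eval_one A X (-1))"

definition les_pi ::
  "('a, 'r) ring_scheme \<Rightarrow> ('a, 'm) cplx \<Rightarrow> (int \<Rightarrow> 'a \<Rightarrow> 'p) \<Rightarrow>
     (int \<Rightarrow> 'p \<Rightarrow> 'm) set \<Rightarrow> 'm set" where
  "les_pi A X j =
     eval_one A X 0 \<circ> coh_map (hom_complex A (ring_complex A) X) 0 (precompose (ring_complex A) j)"

end

theory Submission
  imports Defs
begin

text \<open>
  The theorem holds because everything in sight can be computed with explicit representatives.

  Morphisms out of \<open>F\<close>. Since \<open>F\<close> is projective, the backward leg of a roof \<open>F \<leftarrow> Z \<rightarrow> X\<close> has a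
  section \<open>t\<close> (\<open>roof_section\<close>), so the fraction equals the chain map \<open>g \<circ> t : F \<rightarrow> X\<close>, and a lift of
  \<open>F \<rightarrow> H\<^sup>0(X)\<close> to cycles is unique up to homotopy. Two roofs are therefore equal in \<open>D(A)\<close> precisely
  when they agree on \<open>H\<^sup>0\<close> (\<open>roof_rel_iff\<close>), which gives the isomorphism \<open>derived_H0_iso\<close>.

  The module \<open>W\<close>. As \<open>x\<close> is a nonzerodivisor on \<open>A\<close>, the two-term complex \<open>A \<rightarrow> A\<close> with differential
  \<open>x\<close>, in degrees \<open>-1\<close> and \<open>0\<close>, is another projective resolution of \<open>A/xA\<close>, and \<open>P\<close> is a homotopy retract of it
  (\<open>resolution_retraction\<close>). Hence \<open>W\<close>, the group of homotopy classes of chain maps \<open>P \<rightarrow> X\<close>, consists of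
  the classes of pairs \<open>(a, b)\<close> with \<open>a \<in> X\<^sup>-\<^sup>1\<close>, \<open>b \<in> X\<^sup>0\<close>, \<open>d b = 0\<close> and \<open>d a = x b\<close>; such a class vanishes
  if and only if \<open>a = d y + x z\<close> and \<open>b = d z\<close> for some \<open>y\<close> and \<open>z\<close> (\<open>twisted_class_eq_zero_iff\<close>). In these
  terms \<open>\<tau>\<close> sends the class of \<open>a\<close> to that of \<open>(a, 0)\<close> and \<open>\<pi>\<close> sends the class of \<open>(a, b)\<close> to that of \<open>b\<close>, so
  the exactness of \<open>0 \<rightarrow> U/xU \<rightarrow> W \<rightarrow> V \<rightarrow> 0\<close> can be read off; that \<open>\<pi>\<close> is onto is the hypothesis
  \<open>x V = 0\<close>, which says that \<open>x b\<close> is a boundary for each cycle \<open>b\<close>.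

  The module \<open>M\<^sub>f\<close>. Let \<open>\<phi> : F \<rightarrow> X\<^sup>0\<close> be a linear choice of cycles that represent \<open>\<alpha>\<close>. Because \<open>x V = 0\<close>, there
  is a linear \<open>\<kappa> : F \<rightarrow> X\<^sup>-\<^sup>1\<close> with \<open>d (\<kappa> z) = x (\<phi> z)\<close>, and the class of \<open>(\<kappa> z, \<phi> z)\<close> is the desired lift of
  \<open>\<alpha> z\<close> to \<open>W\<close>. Let \<open>N\<close> be the module of pairs \<open>(z, w) \<in> F \<times> X\<^sup>-\<^sup>1\<close> with \<open>\<phi> z = d w\<close>. It maps onto \<open>M\<^sub>f\<close> by
  \<open>(z, w) \<mapsto> [(t z, -w)]\<close> (\<open>cone_cohomology_presentation\<close>) and onto the kernel of \<open>\<Phi>\<close> by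
  \<open>(z, w) \<mapsto> ([x w - \<kappa> z], z)\<close> (\<open>kernel_presentation\<close>). Both maps kill exactly the pairs \<open>(0, d y)\<close>; for the
  second one this is the hypothesis that \<open>x\<close> is a nonzerodivisor on \<open>U\<close>. So \<open>M\<^sub>f\<close> and the kernel of \<open>\<Phi>\<close> are the same
  quotient of \<open>N\<close>, and the projection of \<open>N\<close> to \<open>F\<close> induces the sequence
  \<open>0 \<rightarrow> U \<rightarrow> M\<^sub>f \<rightarrow> ker \<alpha> \<rightarrow> 0\<close> (\<open>cone_short_exact\<close>).
\<close>

section \<open>Modules and their homomorphisms\<close>

lemma mod_homI:
  assumes "\<And>v. v \<in> carrier M \<Longrightarrow> h v \<in> carrier N"
    and "\<And>v w. v \<in> carrier M \<Longrightarrow> w \<in> carrier M \<Longrightarrow> h (v \<oplus>\<^bsub>M\<^esub> w) = h v \<oplus>\<^bsub>N\<^esub> h w"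
    and "\<And>a v. a \<in> carrier A \<Longrightarrow> v \<in> carrier M \<Longrightarrow> h (a \<odot>\<^bsub>M\<^esub> v) = a \<odot>\<^bsub>N\<^esub> h v"
  shows "h \<in> mod_hom A M N"
  using assms by (auto simp: mod_hom_def)

lemma mod_hom_closed: "h \<in> mod_hom A M N \<Longrightarrow> v \<in> carrier M \<Longrightarrow> h v \<in> carrier N"
  by (auto simp: mod_hom_def)

lemma mod_hom_add:
  "h \<in> mod_hom A M N \<Longrightarrow> v \<in> carrier M \<Longrightarrow> w \<in> carrier M \<Longrightarrow> h (v \<oplus>\<^bsub>M\<^esub> w) = h v \<oplus>\<^bsub>N\<^esub> h w"
  by (auto simp: mod_hom_def)

lemma mod_hom_smult:
  "h \<in> mod_hom A M N \<Longrightarrow> a \<in> carrier A \<Longrightarrow> v \<in> carrier M \<Longrightarrow> h (a \<odot>\<^bsub>M\<^esub> v) = a \<odot>\<^bsub>N\<^esub> h v"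
  by (auto simp: mod_hom_def)

lemma mod_hom_zero:
  assumes "module A M" "module A N" "h \<in> mod_hom A M N"
  shows "h \<zero>\<^bsub>M\<^esub> = \<zero>\<^bsub>N\<^esub>"
proof -
  interpret M: module A M by fact
  interpret N: module A N by fact
  have "h \<zero>\<^bsub>M\<^esub> \<oplus>\<^bsub>N\<^esub> h \<zero>\<^bsub>M\<^esub> = h \<zero>\<^bsub>M\<^esub>"
    using mod_hom_add[OF assms(3), of "\<zero>\<^bsub>M\<^esub>" "\<zero>\<^bsub>M\<^esub>"] by simp
  then show ?thesis
    using mod_hom_closed[OF assms(3), of "\<zero>\<^bsub>M\<^esub>"] by (simp add: N.add.l_cancel_one')
qed

lemma mod_hom_neg:
  assumes "module A M" "module A N" "h \<in> mod_hom A M N" "v \<in> carrier M"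
  shows "h (\<ominus>\<^bsub>M\<^esub> v) = \<ominus>\<^bsub>N\<^esub> h v"
proof -
  interpret M: module A M by fact
  interpret N: module A N by fact
  have "h (\<ominus>\<^bsub>M\<^esub> v) \<oplus>\<^bsub>N\<^esub> h v = \<zero>\<^bsub>N\<^esub>"
    using mod_hom_add[OF assms(3), of "\<ominus>\<^bsub>M\<^esub> v" v] assms(4) mod_hom_zero[OF assms(1-3)]
    by (simp add: M.l_neg)
  then show ?thesis
    using mod_hom_closed[OF assms(3)] assms(4) by (simp add: N.minus_equality)
qed

lemma mod_hom_minus:
  assumes "module A M" "module A N" "h \<in> mod_hom A M N" "v \<in> carrier M" "w \<in> carrier M"
  shows "h (v \<ominus>\<^bsub>M\<^esub> w) = h v \<ominus>\<^bsub>N\<^esub> h w"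
proof -
  interpret M: module A M by fact
  show ?thesis
    using assms mod_hom_neg[OF assms(1-3)] by (simp add: a_minus_def mod_hom_add[OF assms(3)])
qed

lemma mod_hom_compose:
  "h \<in> mod_hom A L M \<Longrightarrow> g \<in> mod_hom A M N \<Longrightarrow> (\<lambda>v. g (h v)) \<in> mod_hom A L N"
  by (auto simp: mod_hom_def Pi_iff)

lemma mod_hom_cong:
  assumes "module A M" "h \<in> mod_hom A M N" "\<And>v. v \<in> carrier M \<Longrightarrow> k v = h v"
  shows "k \<in> mod_hom A M N"
proof -
  interpret M: module A M by fact
  show ?thesis using assms(2,3) by (auto simp: mod_hom_def Pi_iff)
qed

lemma mod_hom_restrict:
  "module A M \<Longrightarrow> h \<in> mod_hom A M N \<Longrightarrow> restrict h (carrier M) \<in> mod_hom A M N"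
  by (erule mod_hom_cong) auto

lemma mod_hom_id: "(\<lambda>v. v) \<in> mod_hom A M M"
  by (auto simp: mod_hom_def)

lemma mod_hom_const_zero:
  assumes "module A N" shows "(\<lambda>v. \<zero>\<^bsub>N\<^esub>) \<in> mod_hom A M N"
proof -
  interpret N: module A N by fact
  show ?thesis by (auto simp: mod_hom_def)
qed

lemma mod_hom_add_fun:
  assumes "module A N" "g \<in> mod_hom A M N" "h \<in> mod_hom A M N"
  shows "(\<lambda>v. g v \<oplus>\<^bsub>N\<^esub> h v) \<in> mod_hom A M N"
proof -
  interpret N: module A N by fact
  show ?thesis
    using assms(2,3) by (auto simp: mod_hom_def Pi_iff N.a_ac N.smult_r_distr)
qed

lemma mod_hom_neg_fun:
  assumes "module A N" "h \<in> mod_hom A M N"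
  shows "(\<lambda>v. \<ominus>\<^bsub>N\<^esub> h v) \<in> mod_hom A M N"
proof -
  interpret N: module A N by fact
  show ?thesis
    using assms(2) by (auto simp: mod_hom_def Pi_iff N.minus_add N.smult_r_minus N.a_comm)
qed

lemma mod_hom_minus_fun:
  assumes "module A N" "g \<in> mod_hom A M N" "h \<in> mod_hom A M N"
  shows "(\<lambda>v. g v \<ominus>\<^bsub>N\<^esub> h v) \<in> mod_hom A M N"
  unfolding a_minus_def using assms by (intro mod_hom_add_fun mod_hom_neg_fun)

lemma mod_hom_smult_fun:
  assumes "module A N" "a \<in> carrier A" "h \<in> mod_hom A M N"
  shows "(\<lambda>v. a \<odot>\<^bsub>N\<^esub> h v) \<in> mod_hom A M N"
proof -
  interpret N: module A N by fact
  show ?thesis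
    using assms(2,3)
    by (auto simp: mod_hom_def Pi_iff N.smult_r_distr N.smult_assoc1[symmetric] N.m_comm)
qed

text \<open>
  Inverses are awkward to normalise in a module given by a carrier; where possible the statements
  below are kept in the form \<open>u = w + v\<close>.
\<close>

lemma module_minus_eq_iff:
  assumes "module A M" "u \<in> carrier M" "v \<in> carrier M" "w \<in> carrier M"
  shows "u \<ominus>\<^bsub>M\<^esub> v = w \<longleftrightarrow> u = w \<oplus>\<^bsub>M\<^esub> v"
proof -
  interpret M: module A M by fact
  show ?thesis
    using assms(2-4) by (auto simp: a_minus_def M.a_assoc M.l_neg M.r_neg)
qed

lemma module_neg_zero:
  assumes "module A M" shows "\<ominus>\<^bsub>M\<^esub> \<zero>\<^bsub>M\<^esub> = \<zero>\<^bsub>M\<^esub>"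
proof -
  interpret M: module A M by fact
  show ?thesis by (rule M.minus_equality) simp_all
qed

lemma module_minus_self:
  assumes "module A M" "u \<in> carrier M" shows "u \<ominus>\<^bsub>M\<^esub> u = \<zero>\<^bsub>M\<^esub>"
proof -
  interpret M: module A M by fact
  show ?thesis using assms(2) by (simp add: a_minus_def M.r_neg)
qed

lemma regular_module_simps [simp]:
  "carrier (regular_module A) = carrier A" "zero (regular_module A) = zero A"
  "add (regular_module A) = add A" "smult (regular_module A) = mult A"
  by (auto simp: regular_module_def)

lemma zero_submodule_simps [simp]:
  "carrier (zero_submodule M) = {\<zero>\<^bsub>M\<^esub>}" "zero (zero_submodule M) = zero M"
  "add (zero_submodule M) = add M" "smult (zero_submodule M) = smult M"
  by (auto simp: zero_submodule_def)

lemma direct_sum_simps [simp]: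
  "carrier (direct_sum M N) = carrier M \<times> carrier N"
  "zero (direct_sum M N) = (\<zero>\<^bsub>M\<^esub>, \<zero>\<^bsub>N\<^esub>)"
  "p \<oplus>\<^bsub>direct_sum M N\<^esub> q = (fst p \<oplus>\<^bsub>M\<^esub> fst q, snd p \<oplus>\<^bsub>N\<^esub> snd q)"
  "a \<odot>\<^bsub>direct_sum M N\<^esub> p = (a \<odot>\<^bsub>M\<^esub> fst p, a \<odot>\<^bsub>N\<^esub> snd p)"
  by (auto simp: direct_sum_def)

lemma kernel_module_simps [simp]:
  "carrier (kernel_module M N h) = {v \<in> carrier M. h v = \<zero>\<^bsub>N\<^esub>}"
  "zero (kernel_module M N h) = zero M"
  "add (kernel_module M N h) = add M" "smult (kernel_module M N h) = smult M"
  by (auto simp: kernel_module_def)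

lemma mod_hom_fst: "fst \<in> mod_hom A (direct_sum M N) M"
  by (auto simp: mod_hom_def)

lemma mod_hom_snd: "snd \<in> mod_hom A (direct_sum M N) N"
  by (auto simp: mod_hom_def)

lemma mod_hom_pair:
  "g \<in> mod_hom A L M \<Longrightarrow> h \<in> mod_hom A L N \<Longrightarrow> (\<lambda>v. (g v, h v)) \<in> mod_hom A L (direct_sum M N)"
  by (auto simp: mod_hom_def Pi_iff)

lemma regular_module_module:
  assumes "cring A" shows "module A (regular_module A)"
proof -
  interpret A: cring A by fact
  show ?thesis
  proof (rule moduleI[OF assms])
    show "abelian_group (regular_module A)"
      by (rule abelian_groupI)
        (auto simp: A.a_ac intro: bexI[of _ "\<ominus>\<^bsub>A\<^esub> _"] A.l_neg)
  qed (auto simp: A.m_assoc A.l_distr A.r_distr)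
qed

lemma zero_submodule_module:
  assumes "module A M" shows "module A (zero_submodule M)"
proof -
  interpret M: module A M by fact
  show ?thesis
    by (rule moduleI[OF M.is_cring], rule abelian_groupI) auto
qed

lemma direct_sum_module:
  assumes "module A M" "module A N" shows "module A (direct_sum M N)"
proof -
  interpret M: module A M by fact
  interpret N: module A N by fact
  show ?thesis
  proof (rule moduleI[OF M.is_cring])
    show "abelian_group (direct_sum M N)"
    proof (rule abelian_groupI)
      fix p assume "p \<in> carrier (direct_sum M N)"
      then show "\<exists>q\<in>carrier (direct_sum M N). q \<oplus>\<^bsub>direct_sum M N\<^esub> p = \<zero>\<^bsub>direct_sum M N\<^esub>"
        by (intro bexI[of _ "(\<ominus>\<^bsub>M\<^esub> fst p, \<ominus>\<^bsub>N\<^esub> snd p)"]) (auto simp: M.l_neg N.l_neg)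
    qed (auto simp: M.a_ac N.a_ac)
  qed (auto simp: M.smult_l_distr N.smult_l_distr M.smult_r_distr N.smult_r_distr
      M.smult_assoc1 N.smult_assoc1)
qed

lemma kernel_submodule:
  assumes "module A M" "module A N" "h \<in> mod_hom A M N"
  shows "submodule {v \<in> carrier M. h v = \<zero>\<^bsub>N\<^esub>} A M"
proof -
  interpret M: module A M by fact
  interpret N: module A N by fact
  show ?thesis
    using mod_hom_zero[OF assms] mod_hom_neg[OF assms]
    by (intro M.submoduleI) (auto simp: mod_hom_add[OF assms(3)] mod_hom_smult[OF assms(3)])
qed

lemma kernel_module_module:
  assumes "module A M" "module A N" "h \<in> mod_hom A M N"
  shows "module A (kernel_module M N h)"
  unfolding kernel_module_def
  using submodule.submodule_is_module[OF kernel_submodule[OF assms] assms(1)] .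

lemma image_submodule:
  assumes "module A M" "module A N" "h \<in> mod_hom A M N"
  shows "submodule (h ` carrier M) A N"
proof -
  interpret M: module A M by fact
  interpret N: module A N by fact
  show ?thesis
  proof (rule N.submoduleI)
    show "h ` carrier M \<subseteq> carrier N" using mod_hom_closed[OF assms(3)] by auto
    show "\<zero>\<^bsub>N\<^esub> \<in> h ` carrier M" using mod_hom_zero[OF assms] by (metis M.zero_closed imageI)
    show "\<ominus>\<^bsub>N\<^esub> w \<in> h ` carrier M" if "w \<in> h ` carrier M" for w
      using that mod_hom_neg[OF assms, symmetric] by auto
    show "v \<oplus>\<^bsub>N\<^esub> w \<in> h ` carrier M" if "v \<in> h ` carrier M" "w \<in> h ` carrier M" for v w
      using that mod_hom_add[OF assms(3), symmetric] by auto
    show "a \<odot>\<^bsub>N\<^esub> w \<in> h ` carrier M" if "a \<in> carrier A" "w \<in> h ` carrier M" for a w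
      using that mod_hom_smult[OF assms(3), symmetric] by auto
  qed
qed

lemma mod_hom_inj_on:
  assumes M: "module A M" and N: "module A N" and h: "h \<in> mod_hom A M N"
    and ker: "\<And>v. v \<in> carrier M \<Longrightarrow> h v = \<zero>\<^bsub>N\<^esub> \<Longrightarrow> v = \<zero>\<^bsub>M\<^esub>"
  shows "inj_on h (carrier M)"
proof (rule inj_onI)
  interpret M: module A M by fact
  fix v w assume v: "v \<in> carrier M" and w: "w \<in> carrier M" and eq: "h v = h w"
  have "h (v \<ominus>\<^bsub>M\<^esub> w) = \<zero>\<^bsub>N\<^esub>"
    by (simp add: mod_hom_minus[OF M N h v w] eq module_minus_self[OF N mod_hom_closed[OF h w]])
  then have "v \<ominus>\<^bsub>M\<^esub> w = \<zero>\<^bsub>M\<^esub>" using ker v w by simp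
  then show "v = w" using v w by (simp add: module_minus_eq_iff[OF M])
qed

text \<open>
  The axioms of a module are equations, so they pass along a surjection that respects the
  operations. In this way quotients inherit the axioms.
\<close>

lemma module_along_surjection:
  assumes "module A M" "q \<in> mod_hom A M Q" "q ` carrier M = carrier Q" "q \<zero>\<^bsub>M\<^esub> = \<zero>\<^bsub>Q\<^esub>"
  shows "module A Q"
proof -
  interpret M: module A M by fact
  note [simp] = mod_hom_add[OF assms(2), symmetric] mod_hom_smult[OF assms(2), symmetric]
    assms(4)[symmetric]
  have surj: "\<exists>v\<in>carrier M. w = q v" if "w \<in> carrier Q" for w using that assms(3) by blast
  have im: "q v \<in> carrier Q" if "v \<in> carrier M" for v using that assms(3) by blast
  show ?thesis
  proof (rule moduleI[OF M.is_cring])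
    show "abelian_group Q"
    proof (rule abelian_groupI)
      fix w assume "w \<in> carrier Q"
      then obtain v where v: "v \<in> carrier M" "w = q v" using surj by blast
      then show "\<exists>y\<in>carrier Q. y \<oplus>\<^bsub>Q\<^esub> w = \<zero>\<^bsub>Q\<^esub>"
        by (intro bexI[of _ "q (\<ominus>\<^bsub>M\<^esub> v)"]) (auto simp: M.l_neg im)
    qed (auto simp: M.a_ac im dest!: surj)
  qed (auto simp: M.smult_l_distr M.smult_r_distr M.smult_assoc1 im dest!: surj)
qed

text \<open>
  Modules of classes are images of modules of representatives, and homomorphisms out of them are built
  by factoring a map on representatives. The factor takes the value at any preimage; two preimages differ
  by an element of the kernel.
\<close>

lemma mod_hom_factor:
  assumes "module A N" "module A M" "module A L"
    and p: "p \<in> mod_hom A N M" "p ` carrier N = carrier M"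
    and k: "k \<in> mod_hom A N L"
    and ker: "\<And>v. v \<in> carrier N \<Longrightarrow> p v = \<zero>\<^bsub>M\<^esub> \<Longrightarrow> k v = \<zero>\<^bsub>L\<^esub>"
  shows "\<exists>k'\<in>mod_hom A M L. \<forall>v\<in>carrier N. k' (p v) = k v"
proof -
  interpret N: module A N by fact
  interpret M: module A M by fact
  interpret L: module A L by fact
  define k' where "k' = (\<lambda>w. k (SOME v. v \<in> carrier N \<and> p v = w))"
  have k': "k' (p v) = k v" if v: "v \<in> carrier N" for v
  proof -
    define v' where "v' = (SOME v'. v' \<in> carrier N \<and> p v' = p v)"
    have v': "v' \<in> carrier N" "p v' = p v"
      unfolding v'_def using someI[of "\<lambda>v'. v' \<in> carrier N \<and> p v' = p v" v] v by auto
    have "p (v' \<ominus>\<^bsub>N\<^esub> v) = \<zero>\<^bsub>M\<^esub>"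
      using v v' mod_hom_closed[OF p(1)]
      by (simp add: mod_hom_minus[OF assms(1,2) p(1)] module_minus_self[OF assms(2)])
    then have "k v' \<ominus>\<^bsub>L\<^esub> k v = \<zero>\<^bsub>L\<^esub>"
      using ker[of "v' \<ominus>\<^bsub>N\<^esub> v"] v v' by (simp add: mod_hom_minus[OF assms(1,3) k])
    then have "k v' = k v"
      using v v' mod_hom_closed[OF k] by (simp add: module_minus_eq_iff[OF assms(3)])
    then show ?thesis by (simp add: k'_def v'_def)
  qed
  have surj: "\<exists>v\<in>carrier N. w = p v" if "w \<in> carrier M" for w using that p(2) by blast
  have "k' \<in> mod_hom A M L"
  proof (rule mod_homI)
    show "k' w \<in> carrier L" if "w \<in> carrier M" for w
      using surj[OF that] k' mod_hom_closed[OF k] by auto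
    show "k' (v \<oplus>\<^bsub>M\<^esub> w) = k' v \<oplus>\<^bsub>L\<^esub> k' w" if "v \<in> carrier M" "w \<in> carrier M" for v w
      using surj[OF that(1)] surj[OF that(2)] k' mod_hom_add[OF k] mod_hom_add[OF p(1)]
      by (metis N.a_closed)
    show "k' (a \<odot>\<^bsub>M\<^esub> w) = a \<odot>\<^bsub>L\<^esub> k' w" if "a \<in> carrier A" "w \<in> carrier M" for a w
      using that(1) surj[OF that(2)] k' mod_hom_smult[OF k] mod_hom_smult[OF p(1)]
      by (metis N.smult_closed)
  qed
  with k' show ?thesis by blast
qed

lemma mod_isomorphic_of_equal_kernels:
  assumes "module A N" "module A M" "module A L"
    and p: "p \<in> mod_hom A N M" "p ` carrier N = carrier M"
    and k: "k \<in> mod_hom A N L" "k ` carrier N = carrier L"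
    and ker: "\<And>v. v \<in> carrier N \<Longrightarrow> p v = \<zero>\<^bsub>M\<^esub> \<longleftrightarrow> k v = \<zero>\<^bsub>L\<^esub>"
  shows "mod_isomorphic A M L"
proof -
  obtain f where f: "f \<in> mod_hom A M L" "\<forall>v\<in>carrier N. f (p v) = k v"
    using mod_hom_factor[OF assms(1,2,3) p k(1)] ker by blast
  obtain g where g: "g \<in> mod_hom A L M" "\<forall>v\<in>carrier N. g (k v) = p v"
    using mod_hom_factor[OF assms(1,3,2) k p(1)] ker by blast
  have "bij_betw f (carrier M) (carrier L)"
  proof (rule bij_betw_byWitness[where f' = g])
    show "\<forall>a\<in>carrier M. g (f a) = a" "\<forall>a\<in>carrier L. f (g a) = a"
      using f(2) g(2) unfolding p(2)[symmetric] k(2)[symmetric] by auto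
    show "f ` carrier M \<subseteq> carrier L" "g ` carrier L \<subseteq> carrier M"
      using mod_hom_closed[OF f(1)] mod_hom_closed[OF g(1)] by auto
  qed
  with f(1) show ?thesis by (auto simp: mod_isomorphic_def mod_iso_def)
qed


section \<open>Quotient modules\<close>

lemma submodule_abelian_subgroup:
  assumes "module A M" "submodule N A M" shows "abelian_subgroup N M"
proof -
  interpret M: module A M by fact
  show ?thesis
    using assms(2) by (intro abelian_subgroupI3 additive_subgroupI) (auto simp: submodule_def M.abelian_group_axioms)
qed

lemma coset_eq_iff:
  assumes "module A M" "submodule N A M" "v \<in> carrier M" "w \<in> carrier M"
  shows "N +>\<^bsub>M\<^esub> v = N +>\<^bsub>M\<^esub> w \<longleftrightarrow> (\<exists>n\<in>N. v = n \<oplus>\<^bsub>M\<^esub> w)"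
proof -
  interpret N: abelian_subgroup N M by (rule submodule_abelian_subgroup[OF assms(1,2)])
  have "N +>\<^bsub>M\<^esub> v = N +>\<^bsub>M\<^esub> w \<longleftrightarrow> v \<in> N +>\<^bsub>M\<^esub> w"
    using N.a_repr_independence N.a_rcos_self assms(3,4)
    by (metis N.a_repr_independence')
  then show ?thesis by (auto simp: a_r_coset_def')
qed

lemma quotient_module_simps:
  assumes "module A M" "submodule N A M"
  shows "carrier (quotient_module M N) = (\<lambda>v. N +>\<^bsub>M\<^esub> v) ` carrier M"
    and "\<zero>\<^bsub>quotient_module M N\<^esub> = N +>\<^bsub>M\<^esub> \<zero>\<^bsub>M\<^esub>"
    and "\<And>v w. v \<in> carrier M \<Longrightarrow> w \<in> carrier M \<Longrightarrow>
      (N +>\<^bsub>M\<^esub> v) \<oplus>\<^bsub>quotient_module M N\<^esub> (N +>\<^bsub>M\<^esub> w) = N +>\<^bsub>M\<^esub> (v \<oplus>\<^bsub>M\<^esub> w)"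
    and "\<And>a v. a \<in> carrier A \<Longrightarrow> v \<in> carrier M \<Longrightarrow>
      a \<odot>\<^bsub>quotient_module M N\<^esub> (N +>\<^bsub>M\<^esub> v) = N +>\<^bsub>M\<^esub> (a \<odot>\<^bsub>M\<^esub> v)"
proof -
  interpret M: module A M by fact
  interpret N: abelian_subgroup N M by (rule submodule_abelian_subgroup[OF assms])
  show "carrier (quotient_module M N) = (\<lambda>v. N +>\<^bsub>M\<^esub> v) ` carrier M"
    by (auto simp: quotient_module_def A_RCOSETS_def')
  show "\<zero>\<^bsub>quotient_module M N\<^esub> = N +>\<^bsub>M\<^esub> \<zero>\<^bsub>M\<^esub>"
    using N.a_subset by (simp add: quotient_module_def M.a_coset_add_zero)
  show "(N +>\<^bsub>M\<^esub> v) \<oplus>\<^bsub>quotient_module M N\<^esub> (N +>\<^bsub>M\<^esub> w) = N +>\<^bsub>M\<^esub> (v \<oplus>\<^bsub>M\<^esub> w)"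
    if "v \<in> carrier M" "w \<in> carrier M" for v w
    using N.a_rcos_sum[OF that] by (simp add: quotient_module_def)
  fix a v assume a: "a \<in> carrier A" and v: "v \<in> carrier M"
  have const: "N +>\<^bsub>M\<^esub> (a \<odot>\<^bsub>M\<^esub> w) = N +>\<^bsub>M\<^esub> (a \<odot>\<^bsub>M\<^esub> v)" if w: "w \<in> N +>\<^bsub>M\<^esub> v" for w
  proof -
    obtain n where n: "n \<in> N" "w = n \<oplus>\<^bsub>M\<^esub> v" using w by (auto simp: a_r_coset_def')
    then have "n \<in> carrier M" using N.a_subset by auto
    with n a v assms show ?thesis
      by (auto simp: coset_eq_iff M.smult_r_distr intro!: bexI[of _ "a \<odot>\<^bsub>M\<^esub> n"]
          submodule.smult_closed[OF assms(2)])
  qed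
  have "(\<Union>w\<in>N +>\<^bsub>M\<^esub> v. N +>\<^bsub>M\<^esub> (a \<odot>\<^bsub>M\<^esub> w)) = N +>\<^bsub>M\<^esub> (a \<odot>\<^bsub>M\<^esub> v)"
    using N.a_rcos_self[OF v] by (intro SUP_eq_const const) blast
  then show "a \<odot>\<^bsub>quotient_module M N\<^esub> (N +>\<^bsub>M\<^esub> v) = N +>\<^bsub>M\<^esub> (a \<odot>\<^bsub>M\<^esub> v)"
    by (simp add: quotient_module_def)
qed

lemma quotient_map_mod_hom:
  assumes "module A M" "submodule N A M"
  shows "(\<lambda>v. N +>\<^bsub>M\<^esub> v) \<in> mod_hom A M (quotient_module M N)"
  by (rule mod_homI) (auto simp: quotient_module_simps[OF assms])

lemma quotient_module_module:
  assumes "module A M" "submodule N A M" shows "module A (quotient_module M N)"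
  by (rule module_along_surjection[OF assms(1) quotient_map_mod_hom[OF assms]])
    (simp_all add: quotient_module_simps[OF assms])

lemma coset_eq_zero_iff:
  assumes "module A M" "submodule N A M" "v \<in> carrier M"
  shows "N +>\<^bsub>M\<^esub> v = \<zero>\<^bsub>quotient_module M N\<^esub> \<longleftrightarrow> v \<in> N"
proof -
  interpret M: module A M by fact
  show ?thesis
    unfolding quotient_module_simps(2)[OF assms(1,2)] coset_eq_iff[OF assms M.zero_closed]
    using M.submoduleE(1)[OF assms(2)] by (auto simp: subset_iff)
qed

text \<open>
  Maps on cosets are given by \<open>the_elem\<close>; this evaluates them once they are known not to depend on the
  representative.
\<close>

lemma the_elem_image_coset:
  assumes "module A M" "submodule N A M" "v \<in> carrier M"
    and "\<And>n. n \<in> N \<Longrightarrow> k (n \<oplus>\<^bsub>M\<^esub> v) = k v"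
  shows "the_elem (k ` (N +>\<^bsub>M\<^esub> v)) = k v"
proof -
  interpret N: abelian_subgroup N M by (rule submodule_abelian_subgroup[OF assms(1,2)])
  have "k ` (N +>\<^bsub>M\<^esub> v) = {k v}"
    using N.a_rcos_self[OF assms(3)] assms(4) by (force simp: a_r_coset_def')
  then show ?thesis by simp
qed

lemma multiples_submodule:
  assumes "module A M" "x \<in> carrier A" shows "submodule (multiples M x) A M"
  unfolding multiples_def
  by (rule image_submodule[OF assms(1,1) mod_hom_smult_fun[OF assms mod_hom_id]])

lemma short_exact_of_exact:
  assumes U: "module A U" and W: "module A W" and \<tau>: "\<tau> \<in> mod_hom A U W" and \<pi>: "\<pi> \<in> mod_hom A W V"
    and N: "submodule N A U" "{u \<in> carrier U. \<tau> u = \<zero>\<^bsub>W\<^esub>} = N"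
    and ex: "\<tau> ` carrier U = {w \<in> carrier W. \<pi> w = \<zero>\<^bsub>V\<^esub>}" and surj: "\<pi> ` carrier W = carrier V"
  shows "short_exact A (quotient_module U N) W V (\<lambda>S. the_elem (\<tau> ` S)) \<pi>"
    and "\<And>u. u \<in> carrier U \<Longrightarrow> the_elem (\<tau> ` (N +>\<^bsub>U\<^esub> u)) = \<tau> u"
proof -
  interpret U: module A U by fact
  interpret W: module A W by fact
  note Q = quotient_module_simps[OF U N(1)]
  show eq: "the_elem (\<tau> ` (N +>\<^bsub>U\<^esub> u)) = \<tau> u" if u: "u \<in> carrier U" for u
  proof (rule the_elem_image_coset[OF U N(1) u])
    fix n assume "n \<in> N"
    then have "n \<in> carrier U" "\<tau> n = \<zero>\<^bsub>W\<^esub>" using N(2) by auto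
    then show "\<tau> (n \<oplus>\<^bsub>U\<^esub> u) = \<tau> u"
      using u mod_hom_closed[OF \<tau> u] by (simp add: mod_hom_add[OF \<tau>])
  qed
  have hom: "(\<lambda>S. the_elem (\<tau> ` S)) \<in> mod_hom A (quotient_module U N) W"
    by (rule mod_homI)
      (auto simp: Q eq mod_hom_closed[OF \<tau>] mod_hom_add[OF \<tau>] mod_hom_smult[OF \<tau>])
  have inj: "inj_on (\<lambda>S. the_elem (\<tau> ` S)) (carrier (quotient_module U N))"
  proof (rule inj_onI)
    fix S T assume S: "S \<in> carrier (quotient_module U N)" and T: "T \<in> carrier (quotient_module U N)"
      and ST: "the_elem (\<tau> ` S) = the_elem (\<tau> ` T)"
    obtain u v where uv: "u \<in> carrier U" "S = N +>\<^bsub>U\<^esub> u" "v \<in> carrier U" "T = N +>\<^bsub>U\<^esub> v"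
      using S T unfolding Q by (elim imageE) (rule that)
    then have "\<tau> (u \<ominus>\<^bsub>U\<^esub> v) = \<zero>\<^bsub>W\<^esub>"
      using ST by (simp add: eq mod_hom_minus[OF U W \<tau>] module_minus_self[OF W] mod_hom_closed[OF \<tau>])
    then have "u \<ominus>\<^bsub>U\<^esub> v \<in> N" using N(2) uv by auto
    moreover have "u = (u \<ominus>\<^bsub>U\<^esub> v) \<oplus>\<^bsub>U\<^esub> v" using uv by (simp add: module_minus_eq_iff[OF U, symmetric])
    ultimately show "S = T"
      using uv by (simp add: coset_eq_iff[OF U N(1)]) blast
  qed
  have "(\<lambda>S. the_elem (\<tau> ` S)) ` carrier (quotient_module U N) = \<tau> ` carrier U"
    unfolding Q image_image by (rule image_cong) (simp_all add: eq)
  then show "short_exact A (quotient_module U N) W V (\<lambda>S. the_elem (\<tau> ` S)) \<pi>"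
    using hom \<pi> inj ex surj by (simp add: short_exact_def)
qed

text \<open>
  An element of \<open>W\<close> and a lift of its image in \<open>V\<close> differ by an element of the image of \<open>U\<close>. In the
  application this is the surjectivity of \<open>\<Phi>\<close>.
\<close>

lemma extension_cover:
  assumes U: "module A U" and W: "module A W" and V: "module A V"
    and \<tau>: "\<tau> \<in> mod_hom A U W" and \<pi>: "\<pi> \<in> mod_hom A W V"
    and ex: "\<tau> ` carrier U = {w \<in> carrier W. \<pi> w = \<zero>\<^bsub>V\<^esub>}"
    and \<sigma>: "\<sigma> \<in> mod_hom A F W" and cover: "\<And>v. v \<in> carrier V \<Longrightarrow> \<exists>z\<in>carrier F. \<pi> (\<sigma> z) = v"
  shows "(\<lambda>(u, z). \<tau> u \<oplus>\<^bsub>W\<^esub> \<sigma> z) ` (carrier U \<times> carrier F) = carrier W"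
proof
  interpret W: module A W by fact
  show "(\<lambda>(u, z). \<tau> u \<oplus>\<^bsub>W\<^esub> \<sigma> z) ` (carrier U \<times> carrier F) \<subseteq> carrier W"
    using mod_hom_closed[OF \<tau>] mod_hom_closed[OF \<sigma>] by auto
  show "carrier W \<subseteq> (\<lambda>(u, z). \<tau> u \<oplus>\<^bsub>W\<^esub> \<sigma> z) ` (carrier U \<times> carrier F)"
  proof
    fix w assume w: "w \<in> carrier W"
    obtain z where z: "z \<in> carrier F" "\<pi> (\<sigma> z) = \<pi> w"
      by (rule bexE[OF cover[OF mod_hom_closed[OF \<pi> w]]]) (rule that)
    note \<sigma>z = mod_hom_closed[OF \<sigma> z(1)]
    have d: "w \<ominus>\<^bsub>W\<^esub> \<sigma> z \<in> carrier W" using w \<sigma>z by simp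
    have "\<pi> (w \<ominus>\<^bsub>W\<^esub> \<sigma> z) = \<zero>\<^bsub>V\<^esub>"
      by (simp add: mod_hom_minus[OF W V \<pi> w \<sigma>z] z(2) module_minus_self[OF V mod_hom_closed[OF \<pi> w]])
    then have "w \<ominus>\<^bsub>W\<^esub> \<sigma> z \<in> \<tau> ` carrier U" unfolding ex using d by simp
    then obtain u where u: "u \<in> carrier U" "w \<ominus>\<^bsub>W\<^esub> \<sigma> z = \<tau> u" by auto
    then have "w = \<tau> u \<oplus>\<^bsub>W\<^esub> \<sigma> z"
      using module_minus_eq_iff[OF W w \<sigma>z mod_hom_closed[OF \<tau> u(1)]] by simp
    then show "w \<in> (\<lambda>(u, z). \<tau> u \<oplus>\<^bsub>W\<^esub> \<sigma> z) ` (carrier U \<times> carrier F)"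
      using u(1) z(1) by (intro image_eqI[of _ _ "(u, z)"]) simp_all
  qed
qed

section \<open>Lifting along surjections\<close>

definition free_module :: "('a, 'r) ring_scheme \<Rightarrow> 'm set \<Rightarrow> ('a, 'm \<Rightarrow> 'a) module" where
  "free_module A S =
     \<lparr>carrier = {c. finite {v. c v \<noteq> \<zero>\<^bsub>A\<^esub>} \<and>
        (\<forall>v. c v \<in> carrier A \<and> (c v \<noteq> \<zero>\<^bsub>A\<^esub> \<longrightarrow> v \<in> S))},
      mult = undefined, one = undefined, zero = (\<lambda>v. \<zero>\<^bsub>A\<^esub>),
      add = (\<lambda>c d v. c v \<oplus>\<^bsub>A\<^esub> d v), smult = (\<lambda>a c v. a \<otimes>\<^bsub>A\<^esub> c v)\<rparr>"

definition linear_extension ::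
  "('a, 'r) ring_scheme \<Rightarrow> ('a, 'n) module \<Rightarrow> ('m \<Rightarrow> 'n) \<Rightarrow> ('m \<Rightarrow> 'a) \<Rightarrow> 'n" where
  "linear_extension A N \<sigma> c = (\<Oplus>\<^bsub>N\<^esub>v\<in>{v. c v \<noteq> \<zero>\<^bsub>A\<^esub>}. c v \<odot>\<^bsub>N\<^esub> \<sigma> v)"

lemma free_module_module:
  assumes "cring A" shows "module A (free_module A S)"
proof -
  interpret A: cring A by fact
  have supp_add: "{v. c v \<oplus>\<^bsub>A\<^esub> d v \<noteq> \<zero>\<^bsub>A\<^esub>} \<subseteq> {v. c v \<noteq> \<zero>\<^bsub>A\<^esub>} \<union> {v. d v \<noteq> \<zero>\<^bsub>A\<^esub>}" for c d
    by auto
  have supp_smult: "{v. a \<otimes>\<^bsub>A\<^esub> c v \<noteq> \<zero>\<^bsub>A\<^esub>} \<subseteq> {v. c v \<noteq> \<zero>\<^bsub>A\<^esub>}" if "a \<in> carrier A" for a c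
    using that by auto
  have supp_neg: "{v. \<ominus>\<^bsub>A\<^esub> c v \<noteq> \<zero>\<^bsub>A\<^esub>} \<subseteq> {v. c v \<noteq> \<zero>\<^bsub>A\<^esub>}" for c
    by auto
  have closed: "c v \<in> carrier A" if "c \<in> carrier (free_module A S)" for c v
    using that by (auto simp: free_module_def)
  show ?thesis
  proof (rule moduleI[OF assms])
    show "abelian_group (free_module A S)"
    proof (rule abelian_groupI)
      fix c d assume cd: "c \<in> carrier (free_module A S)" "d \<in> carrier (free_module A S)"
      then show "c \<oplus>\<^bsub>free_module A S\<^esub> d \<in> carrier (free_module A S)"
        using finite_subset[OF supp_add[of c d]] supp_add[of c d]
        by (auto simp: free_module_def)
    next
      fix c assume c: "c \<in> carrier (free_module A S)"
      then have "(\<lambda>v. \<ominus>\<^bsub>A\<^esub> c v) \<in> carrier (free_module A S)"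
        using finite_subset[OF supp_neg[of c]] by (auto simp: free_module_def)
      then show "\<exists>d\<in>carrier (free_module A S). d \<oplus>\<^bsub>free_module A S\<^esub> c = \<zero>\<^bsub>free_module A S\<^esub>"
        using closed[OF c] by (intro bexI[of _ "\<lambda>v. \<ominus>\<^bsub>A\<^esub> c v"]) (auto simp: free_module_def A.l_neg)
    qed (auto simp: free_module_def A.a_ac fun_eq_iff)
  next
    fix a c assume "a \<in> carrier A" "c \<in> carrier (free_module A S)"
    then show "a \<odot>\<^bsub>free_module A S\<^esub> c \<in> carrier (free_module A S)"
      using finite_subset[OF supp_smult[of a c]] supp_smult[of a c] by (auto simp: free_module_def)
  qed (auto simp: free_module_def A.m_assoc A.l_distr A.r_distr fun_eq_iff)
qed

lemma linear_extension_eq: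
  assumes "module A N" "c \<in> carrier (free_module A S)" "\<sigma> \<in> S \<rightarrow> carrier N"
    and "finite T" "T \<subseteq> S" "{v. c v \<noteq> \<zero>\<^bsub>A\<^esub>} \<subseteq> T"
  shows "linear_extension A N \<sigma> c = (\<Oplus>\<^bsub>N\<^esub>v\<in>T. c v \<odot>\<^bsub>N\<^esub> \<sigma> v)"
proof -
  interpret N: module A N by fact
  have "c v \<odot>\<^bsub>N\<^esub> \<sigma> v \<in> carrier N" if "v \<in> T" for v
    using assms(2,3,5) that by (auto simp: free_module_def)
  moreover have "c v \<odot>\<^bsub>N\<^esub> \<sigma> v = \<zero>\<^bsub>N\<^esub>" if "v \<in> T - {v. c v \<noteq> \<zero>\<^bsub>A\<^esub>}" for v
    using assms(3,5) that by (auto simp: Pi_iff subset_iff)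
  ultimately show ?thesis
    unfolding linear_extension_def using assms(4,6)
    by (intro N.add.finprod_mono_neutral_cong_left) auto
qed

lemma linear_extension_mod_hom:
  assumes "module A N" "\<sigma> \<in> S \<rightarrow> carrier N"
  shows "linear_extension A N \<sigma> \<in> mod_hom A (free_module A S) N"
proof -
  interpret N: module A N by fact
  interpret S: module A "free_module A S" by (rule free_module_module[OF N.is_cring])
  note eq = linear_extension_eq[OF assms(1) _ assms(2)]
  let ?supp = "\<lambda>c. {v. c v \<noteq> \<zero>\<^bsub>A\<^esub>}"
  have free: "finite (?supp c)" "?supp c \<subseteq> S" "c v \<in> carrier A" "?supp c \<subseteq> S"
    if "c \<in> carrier (free_module A S)" for c v
    using that by (auto simp: free_module_def)
  have term_closed: "c v \<odot>\<^bsub>N\<^esub> \<sigma> v \<in> carrier N"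
    if "c \<in> carrier (free_module A S)" "v \<in> S" for c v
    using that assms(2) free by auto
  show ?thesis
  proof (rule mod_homI)
    fix c assume c: "c \<in> carrier (free_module A S)"
    then show "linear_extension A N \<sigma> c \<in> carrier N"
      unfolding linear_extension_def using free[OF c] term_closed[OF c]
      by (intro N.finsum_closed) auto
    fix d assume d: "d \<in> carrier (free_module A S)"
    let ?T = "?supp c \<union> ?supp d"
    have T: "finite ?T" "?T \<subseteq> S" using free[OF c] free[OF d] by auto
    have "linear_extension A N \<sigma> (c \<oplus>\<^bsub>free_module A S\<^esub> d) =
        (\<Oplus>\<^bsub>N\<^esub>v\<in>?T. (c v \<oplus>\<^bsub>A\<^esub> d v) \<odot>\<^bsub>N\<^esub> \<sigma> v)"
      using eq[OF S.a_closed[OF c d] T] by (force simp: free_module_def)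
    also have "\<dots> = (\<Oplus>\<^bsub>N\<^esub>v\<in>?T. c v \<odot>\<^bsub>N\<^esub> \<sigma> v \<oplus>\<^bsub>N\<^esub> d v \<odot>\<^bsub>N\<^esub> \<sigma> v)"
      using T(2) assms(2) free[OF c] free[OF d] term_closed[OF c] term_closed[OF d]
      by (intro N.finsum_cong') (auto intro!: N.smult_l_distr)
    also have "\<dots> = (\<Oplus>\<^bsub>N\<^esub>v\<in>?T. c v \<odot>\<^bsub>N\<^esub> \<sigma> v) \<oplus>\<^bsub>N\<^esub> (\<Oplus>\<^bsub>N\<^esub>v\<in>?T. d v \<odot>\<^bsub>N\<^esub> \<sigma> v)"
      using T term_closed[OF c] term_closed[OF d] by (intro N.finsum_addf) auto
    also have "\<dots> = linear_extension A N \<sigma> c \<oplus>\<^bsub>N\<^esub> linear_extension A N \<sigma> d"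
      using eq[OF c T] eq[OF d T] by auto
    finally show "linear_extension A N \<sigma> (c \<oplus>\<^bsub>free_module A S\<^esub> d) =
        linear_extension A N \<sigma> c \<oplus>\<^bsub>N\<^esub> linear_extension A N \<sigma> d" .
  next
    fix a c assume a: "a \<in> carrier A" and c: "c \<in> carrier (free_module A S)"
    have "linear_extension A N \<sigma> (a \<odot>\<^bsub>free_module A S\<^esub> c) =
        (\<Oplus>\<^bsub>N\<^esub>v\<in>?supp c. (a \<otimes>\<^bsub>A\<^esub> c v) \<odot>\<^bsub>N\<^esub> \<sigma> v)"
      using eq[OF S.smult_closed[OF a c] free(1,2)[OF c]] a by (force simp: free_module_def)
    also have "\<dots> = (\<Oplus>\<^bsub>N\<^esub>v\<in>?supp c. a \<odot>\<^bsub>N\<^esub> (c v \<odot>\<^bsub>N\<^esub> \<sigma> v))"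
      using a assms(2) free[OF c] term_closed[OF c]
      by (intro N.finsum_cong') (auto intro!: N.smult_assoc1)
    also have "\<dots> = a \<odot>\<^bsub>N\<^esub> linear_extension A N \<sigma> c"
      unfolding linear_extension_def using a free[OF c] term_closed[OF c]
      by (intro N.finsum_smult_ldistr[symmetric]) auto
    finally show "linear_extension A N \<sigma> (a \<odot>\<^bsub>free_module A S\<^esub> c) = a \<odot>\<^bsub>N\<^esub> linear_extension A N \<sigma> c" .
  qed
qed

lemma mod_hom_linear_extension:
  assumes "module A N" "module A N'" "p \<in> mod_hom A N N'" "\<sigma> \<in> S \<rightarrow> carrier N"
    and "c \<in> carrier (free_module A S)"
  shows "p (linear_extension A N \<sigma> c) = linear_extension A N' (\<lambda>v. p (\<sigma> v)) c"
proof -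
  interpret N: module A N by fact
  interpret N': module A N' by fact
  have "p (\<Oplus>\<^bsub>N\<^esub>v\<in>T. c v \<odot>\<^bsub>N\<^esub> \<sigma> v) = (\<Oplus>\<^bsub>N'\<^esub>v\<in>T. c v \<odot>\<^bsub>N'\<^esub> p (\<sigma> v))"
    if "finite T" "T \<subseteq> S" for T
    using that
  proof (induction T rule: finite_induct)
    case empty
    then show ?case using mod_hom_zero[OF assms(1-3)] by (simp add: N.finsum_empty N'.finsum_empty)
  next
    case (insert u T)
    have c: "c v \<in> carrier A" for v using assms(5) by (auto simp: free_module_def)
    have \<sigma>: "\<sigma> v \<in> carrier N" "p (\<sigma> v) \<in> carrier N'" if "v \<in> insert u T" for v
      using that insert.prems assms(4) mod_hom_closed[OF assms(3)] by auto
    have "(\<Oplus>\<^bsub>N\<^esub>v\<in>T. c v \<odot>\<^bsub>N\<^esub> \<sigma> v) \<in> carrier N"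
      using c \<sigma> by (intro N.finsum_closed) auto
    then show ?case
      using insert c \<sigma>
      by (simp add: N.finsum_insert N'.finsum_insert Pi_iff mod_hom_add[OF assms(3)]
          mod_hom_smult[OF assms(3)])
  qed
  then show ?thesis
    using assms(5) by (auto simp: linear_extension_def free_module_def)
qed

text \<open>
  The definition of projectivity tests only modules on two types. Lifting the identity along
  the surjection from the free module on \<open>carrier M\<close> gives a section of it; composing the section
  with a lift of the basis gives the lifting property against a surjection of modules on any types.
\<close>

lemma projective_lift:
  assumes "projective_module A M" "module A N" "module A N'"
    and p: "p \<in> mod_hom A N N'" "p ` carrier N = carrier N'" and h: "h \<in> mod_hom A M N'"
  shows "\<exists>k\<in>mod_hom A M N. \<forall>v\<in>carrier M. p (k v) = h v"
proof -
  have M: "module A M" using assms(1) by (auto simp: projective_module_def)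
  interpret M: module A M by (rule M)
  interpret N: module A N by fact
  interpret N': module A N' by fact
  let ?F = "free_module A (carrier M)"
  let ?e = "linear_extension A M (\<lambda>v. v)"
  have F: "module A ?F" by (rule free_module_module[OF M.is_cring])
  have e: "?e \<in> mod_hom A ?F M" by (rule linear_extension_mod_hom[OF M]) auto
  have "v \<in> ?e ` carrier ?F" if v: "v \<in> carrier M" for v
  proof
    let ?c = "\<lambda>w. if w = v then \<one>\<^bsub>A\<^esub> else \<zero>\<^bsub>A\<^esub>"
    have "{w. ?c w \<noteq> \<zero>\<^bsub>A\<^esub>} \<subseteq> {v}" by auto
    then show c: "?c \<in> carrier ?F"
      using v finite_subset[of "{w. ?c w \<noteq> \<zero>\<^bsub>A\<^esub>}" "{v}"] by (auto simp: free_module_def)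
    have "?e ?c = (\<Oplus>\<^bsub>M\<^esub>w\<in>{v}. ?c w \<odot>\<^bsub>M\<^esub> w)"
      by (rule linear_extension_eq[OF M c]) (use v in auto)
    then show "v = ?e ?c" using v by (simp add: M.finsum_insert M.finsum_empty)
  qed
  then have "?e ` carrier ?F = carrier M" using mod_hom_closed[OF e] by auto
  then obtain t where t: "t \<in> mod_hom A M ?F" "\<forall>v\<in>carrier M. ?e (t v) = v"
    using assms(1) F M e mod_hom_id unfolding projective_module_def by metis
  have hp: "\<exists>w. w \<in> carrier N \<and> p w = h v" if "v \<in> carrier M" for v
    using mod_hom_closed[OF h that] p(2) by (metis imageE)
  then obtain \<sigma> where \<sigma>: "\<And>v. v \<in> carrier M \<Longrightarrow> \<sigma> v \<in> carrier N \<and> p (\<sigma> v) = h v"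
    by metis
  have \<sigma>': "\<sigma> \<in> carrier M \<rightarrow> carrier N" using \<sigma> by auto
  let ?k = "linear_extension A N \<sigma>"
  have k: "?k \<in> mod_hom A ?F N" by (rule linear_extension_mod_hom[OF assms(2) \<sigma>'])
  have lift: "p (?k (t v)) = h v" if v: "v \<in> carrier M" for v
  proof -
    have tv: "t v \<in> carrier ?F" using mod_hom_closed[OF t(1) v] .
    have "p (?k (t v)) = linear_extension A N' (\<lambda>w. p (\<sigma> w)) (t v)"
      by (rule mod_hom_linear_extension[OF assms(2,3) p(1) \<sigma>' tv])
    also have "\<dots> = linear_extension A N' h (t v)"
      unfolding linear_extension_def
    proof (rule N'.finsum_cong')
      show "(\<lambda>w. t v w \<odot>\<^bsub>N'\<^esub> h w) \<in> {w. t v w \<noteq> \<zero>\<^bsub>A\<^esub>} \<rightarrow> carrier N'"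
        using tv mod_hom_closed[OF h] by (auto simp: free_module_def)
      show "t v w \<odot>\<^bsub>N'\<^esub> p (\<sigma> w) = t v w \<odot>\<^bsub>N'\<^esub> h w" if "w \<in> {w. t v w \<noteq> \<zero>\<^bsub>A\<^esub>}" for w
        using that tv \<sigma> by (auto simp: free_module_def)
    qed simp
    also have "\<dots> = h (?e (t v))"
      by (rule mod_hom_linear_extension[OF M assms(3) h _ tv, symmetric]) auto
    finally show ?thesis using t(2) v by simp
  qed
  show ?thesis
    by (rule bexI[OF _ mod_hom_compose[OF t(1) k]]) (simp add: lift)
qed

text \<open>Lifts along differentials take this form, with the boundaries as the image of \<open>p\<close>.\<close>

lemma projective_lift_image:
  assumes "projective_module A M" "module A N" "module A N'"
    and p: "p \<in> mod_hom A N N'" and h: "h \<in> mod_hom A M N'"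
    and im: "\<And>v. v \<in> carrier M \<Longrightarrow> h v \<in> p ` carrier N"
  shows "\<exists>k\<in>mod_hom A M N. \<forall>v\<in>carrier M. p (k v) = h v"
proof -
  let ?I = "N'\<lparr>carrier := p ` carrier N\<rparr>"
  have I: "module A ?I"
    by (rule submodule.submodule_is_module[OF image_submodule[OF assms(2,3) p] assms(3)])
  have "p \<in> mod_hom A N ?I" "h \<in> mod_hom A M ?I"
    using p h im by (auto simp: mod_hom_def)
  then show ?thesis using projective_lift[OF assms(1,2) I] by simp
qed

section \<open>Cohomology\<close>

lemma complex_module: "is_complex A C \<Longrightarrow> module A (obj C n)"
  by (simp add: is_complex_def)

lemma complex_diff: "is_complex A C \<Longrightarrow> diff C n \<in> mod_hom A (obj C n) (obj C (n + 1))"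
  by (simp add: is_complex_def)

lemma complex_diff': "is_complex A C \<Longrightarrow> diff C (n - 1) \<in> mod_hom A (obj C (n - 1)) (obj C n)"
  using complex_diff[of A C "n - 1"] by simp

lemma complex_diff_diff:
  "is_complex A C \<Longrightarrow> v \<in> carrier (obj C n) \<Longrightarrow> diff C (n + 1) (diff C n v) = \<zero>\<^bsub>obj C (n + 1 + 1)\<^esub>"
  by (simp add: is_complex_def)

lemma complex_diff_diff':
  "is_complex A C \<Longrightarrow> v \<in> carrier (obj C (n - 1)) \<Longrightarrow> diff C n (diff C (n - 1) v) = \<zero>\<^bsub>obj C (n + 1)\<^esub>"
  using complex_diff_diff[of A C v "n - 1"] by simp

lemma complex_diff_zero: "is_complex A C \<Longrightarrow> diff C n \<zero>\<^bsub>obj C n\<^esub> = \<zero>\<^bsub>obj C (n + 1)\<^esub>"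
  by (rule mod_hom_zero[OF complex_module complex_module complex_diff])

lemma cycles_simps [simp]:
  "carrier (cycles C n) = {v \<in> carrier (obj C n). diff C n v = \<zero>\<^bsub>obj C (n + 1)\<^esub>}"
  "zero (cycles C n) = zero (obj C n)" "add (cycles C n) = add (obj C n)"
  "smult (cycles C n) = smult (obj C n)"
  by (auto simp: cycles_def)

lemma cycles_module: "is_complex A C \<Longrightarrow> module A (cycles C n)"
  unfolding cycles_def by (intro kernel_module_module complex_module complex_diff)

lemma boundaries_submodule:
  assumes "is_complex A C" shows "submodule (boundaries C n) A (cycles C n)"
proof -
  have "diff C (n - 1) \<in> mod_hom A (obj C (n - 1)) (cycles C n)"
    using complex_diff'[OF assms, of n] complex_diff_diff'[OF assms, of _ n]
    by (auto simp: mod_hom_def)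
  then show ?thesis
    unfolding boundaries_def
    by (intro image_submodule complex_module[OF assms] cycles_module[OF assms])
qed

lemma cohomology_module: "is_complex A C \<Longrightarrow> module A (cohomology C n)"
  unfolding cohomology_def by (intro quotient_module_module cycles_module boundaries_submodule)

lemma coh_class_mod_hom: "is_complex A C \<Longrightarrow> coh_class C n \<in> mod_hom A (cycles C n) (cohomology C n)"
  using quotient_map_mod_hom[OF cycles_module boundaries_submodule, of A C n]
  by (simp add: cohomology_def coh_class_def[abs_def])

lemma carrier_cohomology:
  "is_complex A C \<Longrightarrow> carrier (cohomology C n) = coh_class C n ` carrier (cycles C n)"
  using quotient_module_simps(1)[OF cycles_module boundaries_submodule, of A C n]
  by (simp add: cohomology_def coh_class_def[abs_def])

lemma coh_class_closed:
  "is_complex A C \<Longrightarrow> v \<in> carrier (cycles C n) \<Longrightarrow> coh_class C n v \<in> carrier (cohomology C n)"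
  using carrier_cohomology by blast

lemma cohomologyE:
  assumes "is_complex A C" "u \<in> carrier (cohomology C n)"
  obtains v where "v \<in> carrier (cycles C n)" "u = coh_class C n v"
  using assms carrier_cohomology by blast

lemma coh_class_eq_iff:
  assumes "is_complex A C" "v \<in> carrier (cycles C n)" "w \<in> carrier (cycles C n)"
  shows "coh_class C n v = coh_class C n w \<longleftrightarrow>
    (\<exists>y\<in>carrier (obj C (n - 1)). v = diff C (n - 1) y \<oplus>\<^bsub>obj C n\<^esub> w)"
  using coset_eq_iff[OF cycles_module[OF assms(1)] boundaries_submodule[OF assms(1)] assms(2,3)]
  by (auto simp: coh_class_def boundaries_def)

lemma coh_class_eq_zero_iff:
  assumes "is_complex A C" "v \<in> carrier (cycles C n)"
  shows "coh_class C n v = \<zero>\<^bsub>cohomology C n\<^esub> \<longleftrightarrow> (\<exists>y\<in>carrier (obj C (n - 1)). v = diff C (n - 1) y)"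
  using coset_eq_zero_iff[OF cycles_module[OF assms(1)] boundaries_submodule[OF assms(1)] assms(2)]
  by (auto simp: coh_class_def boundaries_def cohomology_def)

lemma coh_class_zero: "is_complex A C \<Longrightarrow> coh_class C n \<zero>\<^bsub>obj C n\<^esub> = \<zero>\<^bsub>cohomology C n\<^esub>"
  using mod_hom_zero[OF cycles_module cohomology_module coh_class_mod_hom, of A C n] by simp

lemma coh_class_add:
  "is_complex A C \<Longrightarrow> v \<in> carrier (cycles C n) \<Longrightarrow> w \<in> carrier (cycles C n) \<Longrightarrow>
    coh_class C n (v \<oplus>\<^bsub>obj C n\<^esub> w) = coh_class C n v \<oplus>\<^bsub>cohomology C n\<^esub> coh_class C n w"
  using mod_hom_add[OF coh_class_mod_hom[of A C n]] by simp

lemma coh_class_smult: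
  "is_complex A C \<Longrightarrow> a \<in> carrier A \<Longrightarrow> v \<in> carrier (cycles C n) \<Longrightarrow>
    coh_class C n (a \<odot>\<^bsub>obj C n\<^esub> v) = a \<odot>\<^bsub>cohomology C n\<^esub> coh_class C n v"
  using mod_hom_smult[OF coh_class_mod_hom[of A C n]] by simp

lemma the_elem_image_coh_class:
  assumes "is_complex A C" "v \<in> carrier (cycles C n)"
    and "\<And>y. y \<in> carrier (obj C (n - 1)) \<Longrightarrow> k (diff C (n - 1) y \<oplus>\<^bsub>obj C n\<^esub> v) = k v"
  shows "the_elem (k ` coh_class C n v) = k v"
  unfolding coh_class_def
  by (rule the_elem_image_coset[OF cycles_module[OF assms(1)] boundaries_submodule[OF assms(1)] assms(2)])
    (auto simp: boundaries_def assms(3))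

lemma chain_map_mod_hom: "chain_map A C D g \<Longrightarrow> g n \<in> mod_hom A (obj C n) (obj D n)"
  by (simp add: chain_map_def)

lemma chain_map_diff:
  "chain_map A C D g \<Longrightarrow> v \<in> carrier (obj C n) \<Longrightarrow> diff D n (g n v) = g (n + 1) (diff C n v)"
  by (simp add: chain_map_def)

lemma chain_map_diff':
  "chain_map A C D g \<Longrightarrow> v \<in> carrier (obj C (n - 1)) \<Longrightarrow>
    diff D (n - 1) (g (n - 1) v) = g n (diff C (n - 1) v)"
  using chain_map_diff[of A C D g v "n - 1"] by simp

lemma chain_map_closed: "chain_map A C D g \<Longrightarrow> v \<in> carrier (obj C n) \<Longrightarrow> g n v \<in> carrier (obj D n)"
  by (rule mod_hom_closed[OF chain_map_mod_hom])

lemma chain_map_zero: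
  "is_complex A C \<Longrightarrow> is_complex A D \<Longrightarrow> chain_map A C D g \<Longrightarrow> g n \<zero>\<^bsub>obj C n\<^esub> = \<zero>\<^bsub>obj D n\<^esub>"
  by (rule mod_hom_zero[OF complex_module complex_module chain_map_mod_hom])

lemma chain_map_cycle:
  "is_complex A C \<Longrightarrow> is_complex A D \<Longrightarrow> chain_map A C D g \<Longrightarrow>
    v \<in> carrier (cycles C n) \<Longrightarrow> g n v \<in> carrier (cycles D n)"
  by (simp add: chain_map_closed chain_map_diff chain_map_zero)

lemma chain_map_compose:
  assumes "chain_map A C D g" "chain_map A D E k"
  shows "chain_map A C E (\<lambda>n v. k n (g n v))"
  unfolding chain_map_def
proof (intro allI conjI ballI)
  fix n
  show "(\<lambda>v. k n (g n v)) \<in> mod_hom A (obj C n) (obj E n)"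
    by (rule mod_hom_compose[OF chain_map_mod_hom[OF assms(1)] chain_map_mod_hom[OF assms(2)]])
  show "diff E n (k n (g n v)) = k (n + 1) (g (n + 1) (diff C n v))" if "v \<in> carrier (obj C n)" for v
    using that by (simp add: chain_map_diff[OF assms(1)] chain_map_diff[OF assms(2)]
        chain_map_closed[OF assms(1)])
qed

lemma chain_map_cong:
  assumes "is_complex A C" "chain_map A C D g" "\<And>n v. v \<in> carrier (obj C n) \<Longrightarrow> g' n v = g n v"
  shows "chain_map A C D g'"
  unfolding chain_map_def
proof (intro allI conjI ballI)
  fix n
  show "g' n \<in> mod_hom A (obj C n) (obj D n)"
    by (rule mod_hom_cong[OF complex_module[OF assms(1)] chain_map_mod_hom[OF assms(2)]])
      (simp add: assms(3))
  show "diff D n (g' n v) = g' (n + 1) (diff C n v)" if "v \<in> carrier (obj C n)" for v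
    using that mod_hom_closed[OF complex_diff[OF assms(1)] that]
    by (simp add: assms(3) chain_map_diff[OF assms(2)])
qed

lemma chain_map_id: "chain_map A C C (\<lambda>n v. v)"
  by (auto simp: chain_map_def mod_hom_id)

lemma chain_map_const_zero:
  assumes "is_complex A D" shows "chain_map A C D (\<lambda>n v. \<zero>\<^bsub>obj D n\<^esub>)"
  unfolding chain_map_def
  by (simp add: mod_hom_const_zero[OF complex_module[OF assms]] complex_diff_zero[OF assms])

lemma chain_map_add:
  assumes "is_complex A C" "is_complex A D" "chain_map A C D g" "chain_map A C D g'"
  shows "chain_map A C D (\<lambda>n v. g n v \<oplus>\<^bsub>obj D n\<^esub> g' n v)"
  unfolding chain_map_def
proof (intro allI conjI ballI)
  fix n
  show "(\<lambda>v. g n v \<oplus>\<^bsub>obj D n\<^esub> g' n v) \<in> mod_hom A (obj C n) (obj D n)"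
    by (intro mod_hom_add_fun complex_module[OF assms(2)] chain_map_mod_hom assms)
  show "diff D n (g n v \<oplus>\<^bsub>obj D n\<^esub> g' n v) = g (n + 1) (diff C n v) \<oplus>\<^bsub>obj D (n + 1)\<^esub> g' (n + 1) (diff C n v)"
    if "v \<in> carrier (obj C n)" for v
    using that assms by (simp add: mod_hom_add[OF complex_diff[OF assms(2)]] chain_map_closed chain_map_diff)
qed

lemma chain_map_smult:
  assumes "is_complex A C" "is_complex A D" "chain_map A C D g" "a \<in> carrier A"
  shows "chain_map A C D (\<lambda>n v. a \<odot>\<^bsub>obj D n\<^esub> g n v)"
  unfolding chain_map_def
proof (intro allI conjI ballI)
  fix n
  show "(\<lambda>v. a \<odot>\<^bsub>obj D n\<^esub> g n v) \<in> mod_hom A (obj C n) (obj D n)"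
    by (intro mod_hom_smult_fun complex_module[OF assms(2)] chain_map_mod_hom assms)
  show "diff D n (a \<odot>\<^bsub>obj D n\<^esub> g n v) = a \<odot>\<^bsub>obj D (n + 1)\<^esub> g (n + 1) (diff C n v)"
    if "v \<in> carrier (obj C n)" for v
    using that assms by (simp add: mod_hom_smult[OF complex_diff[OF assms(2)]] chain_map_closed chain_map_diff)
qed

lemma coh_map_class:
  assumes "is_complex A C" "is_complex A D" "chain_map A C D g" "v \<in> carrier (cycles C n)"
  shows "coh_map D n g (coh_class C n v) = coh_class D n (g n v)"
  unfolding coh_map_def
proof (rule the_elem_image_coh_class[OF assms(1,4)])
  fix y assume y: "y \<in> carrier (obj C (n - 1))"
  have dy: "diff C (n - 1) y \<in> carrier (cycles C n)"
    using y mod_hom_closed[OF complex_diff'[OF assms(1)]] complex_diff_diff'[OF assms(1)] by simp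
  have g: "g n (diff C (n - 1) y \<oplus>\<^bsub>obj C n\<^esub> v) = diff D (n - 1) (g (n - 1) y) \<oplus>\<^bsub>obj D n\<^esub> g n v"
    using y dy assms(4) mod_hom_add[OF chain_map_mod_hom[OF assms(3)]] chain_map_diff'[OF assms(3) y]
    by simp
  interpret Z: module A "cycles C n" by (rule cycles_module[OF assms(1)])
  have "diff C (n - 1) y \<oplus>\<^bsub>obj C n\<^esub> v \<in> carrier (cycles C n)"
    using Z.a_closed[OF dy assms(4)] by simp
  then show "coh_class D n (g n (diff C (n - 1) y \<oplus>\<^bsub>obj C n\<^esub> v)) = coh_class D n (g n v)"
    using g chain_map_closed[OF assms(3) y] chain_map_cycle[OF assms(1-3)] assms(4)
    by (subst coh_class_eq_iff[OF assms(2)]) blast+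
qed

text \<open>
  For chain maps the difference in the definition of homotopy can be moved to the other side, which
  spares the inverses.
\<close>

lemma homotopic_iff:
  assumes "is_complex A C" "is_complex A D" "chain_map A C D g" "chain_map A C D g'"
  shows "homotopic A C D g g' \<longleftrightarrow> (\<exists>h. \<forall>n. h n \<in> mod_hom A (obj C n) (obj D (n - 1)) \<and>
        (\<forall>v\<in>carrier (obj C n).
           g n v = (diff D (n - 1) (h n v) \<oplus>\<^bsub>obj D n\<^esub> h (n + 1) (diff C n v)) \<oplus>\<^bsub>obj D n\<^esub> g' n v))"
proof -
  have "g n v \<ominus>\<^bsub>obj D n\<^esub> g' n v = diff D (n - 1) (h n v) \<oplus>\<^bsub>obj D n\<^esub> h (n + 1) (diff C n v) \<longleftrightarrow>
      g n v = (diff D (n - 1) (h n v) \<oplus>\<^bsub>obj D n\<^esub> h (n + 1) (diff C n v)) \<oplus>\<^bsub>obj D n\<^esub> g' n v"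
    if "\<forall>n. h n \<in> mod_hom A (obj C n) (obj D (n - 1))" "v \<in> carrier (obj C n)" for h n v
  proof -
    interpret D: module A "obj D n" by (rule complex_module[OF assms(2)])
    have "h n v \<in> carrier (obj D (n - 1))" using mod_hom_closed[OF that(1)[rule_format] that(2)] .
    moreover have "h (n + 1) (diff C n v) \<in> carrier (obj D n)"
      using mod_hom_closed[OF that(1)[rule_format, of "n + 1"]
          mod_hom_closed[OF complex_diff[OF assms(1)] that(2)]] by simp
    ultimately show ?thesis
      using that(2) assms(3,4) mod_hom_closed[OF complex_diff'[OF assms(2)]]
      by (intro module_minus_eq_iff[OF D.module_axioms]) (auto simp: chain_map_closed)
  qed
  then show ?thesis unfolding homotopic_def by (intro ex_cong1) blast
qed

lemma homotopicI:
  assumes "is_complex A C" "is_complex A D" "chain_map A C D g" "chain_map A C D g'"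
    and "\<And>n. h n \<in> mod_hom A (obj C n) (obj D (n - 1))"
    and "\<And>n v. v \<in> carrier (obj C n) \<Longrightarrow>
      g n v = (diff D (n - 1) (h n v) \<oplus>\<^bsub>obj D n\<^esub> h (n + 1) (diff C n v)) \<oplus>\<^bsub>obj D n\<^esub> g' n v"
  shows "homotopic A C D g g'"
  unfolding homotopic_iff[OF assms(1-4)] using assms(5,6) by blast

lemma homotopicE:
  assumes "homotopic A C D g g'"
    and "is_complex A C" "is_complex A D" "chain_map A C D g" "chain_map A C D g'"
  obtains h where "\<And>n. h n \<in> mod_hom A (obj C n) (obj D (n - 1))"
    and "\<And>n v. v \<in> carrier (obj C n) \<Longrightarrow>
      g n v = (diff D (n - 1) (h n v) \<oplus>\<^bsub>obj D n\<^esub> h (n + 1) (diff C n v)) \<oplus>\<^bsub>obj D n\<^esub> g' n v"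
  using assms(1) unfolding homotopic_iff[OF assms(2-5)] by blast

lemma homotopic_of_eq:
  assumes "is_complex A C" "is_complex A D" "chain_map A C D g" "chain_map A C D g'"
    and "\<And>n v. v \<in> carrier (obj C n) \<Longrightarrow> g n v = g' n v"
  shows "homotopic A C D g g'"
proof (rule homotopicI[OF assms(1-4), of "\<lambda>n v. \<zero>\<^bsub>obj D (n - 1)\<^esub>"])
  fix n v assume v: "v \<in> carrier (obj C n)"
  interpret D: module A "obj D n" by (rule complex_module[OF assms(2)])
  show "g n v = (diff D (n - 1) \<zero>\<^bsub>obj D (n - 1)\<^esub> \<oplus>\<^bsub>obj D n\<^esub> \<zero>\<^bsub>obj D (n + 1 - 1)\<^esub>) \<oplus>\<^bsub>obj D n\<^esub> g' n v"
    using v assms(4,5) complex_diff_zero[OF assms(2), of "n - 1"] by (simp add: chain_map_closed)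
qed (intro mod_hom_const_zero complex_module[OF assms(2)])

lemma homotopic_compose_left:
  assumes "is_complex A C" "is_complex A D" "is_complex A E"
    and "chain_map A C D g" "chain_map A C D g'" "chain_map A D E k" "homotopic A C D g g'"
  shows "homotopic A C E (\<lambda>n v. k n (g n v)) (\<lambda>n v. k n (g' n v))"
proof -
  obtain h where h: "\<And>n. h n \<in> mod_hom A (obj C n) (obj D (n - 1))"
    "\<And>n v. v \<in> carrier (obj C n) \<Longrightarrow>
      g n v = (diff D (n - 1) (h n v) \<oplus>\<^bsub>obj D n\<^esub> h (n + 1) (diff C n v)) \<oplus>\<^bsub>obj D n\<^esub> g' n v"
    by (rule homotopicE[OF assms(7,1,2,4,5)]) (rule that)
  show ?thesis
  proof (rule homotopicI[OF assms(1,3) chain_map_compose[OF assms(4,6)] chain_map_compose[OF assms(5,6)],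
        of "\<lambda>n v. k (n - 1) (h n v)"])
    show "(\<lambda>v. k (n - 1) (h n v)) \<in> mod_hom A (obj C n) (obj E (n - 1))" for n
      by (rule mod_hom_compose[OF h(1) chain_map_mod_hom[OF assms(6)]])
    fix n v assume v: "v \<in> carrier (obj C n)"
    interpret D: module A "obj D n" by (rule complex_module[OF assms(2)])
    have h1: "h n v \<in> carrier (obj D (n - 1))" by (rule mod_hom_closed[OF h(1) v])
    have h2: "h (n + 1) (diff C n v) \<in> carrier (obj D n)"
      using mod_hom_closed[OF h(1) mod_hom_closed[OF complex_diff[OF assms(1)] v]] by simp
    have "diff D (n - 1) (h n v) \<in> carrier (obj D n)"
      by (rule mod_hom_closed[OF complex_diff'[OF assms(2)] h1])
    then show "k n (g n v) = (diff E (n - 1) (k (n - 1) (h n v)) \<oplus>\<^bsub>obj E n\<^esub>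
        k (n + 1 - 1) (h (n + 1) (diff C n v))) \<oplus>\<^bsub>obj E n\<^esub> k n (g' n v)"
      using h1 h2 v by (simp add: h(2) mod_hom_add[OF chain_map_mod_hom[OF assms(6)]]
          chain_map_closed[OF assms(5)] chain_map_diff'[OF assms(6)])
  qed
qed

lemma homotopic_coh_class:
  assumes "is_complex A C" "is_complex A D" "chain_map A C D g" "chain_map A C D g'"
    and "homotopic A C D g g'" and v: "v \<in> carrier (cycles C n)"
  shows "coh_class D n (g n v) = coh_class D n (g' n v)"
proof -
  obtain h where h: "\<And>n. h n \<in> mod_hom A (obj C n) (obj D (n - 1))"
    "\<And>n v. v \<in> carrier (obj C n) \<Longrightarrow>
      g n v = (diff D (n - 1) (h n v) \<oplus>\<^bsub>obj D n\<^esub> h (n + 1) (diff C n v)) \<oplus>\<^bsub>obj D n\<^esub> g' n v"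
    by (rule homotopicE[OF assms(5,1-4)]) (rule that)
  interpret D: module A "obj D n" by (rule complex_module[OF assms(2)])
  have h0: "h (n + 1) \<zero>\<^bsub>obj C (n + 1)\<^esub> = \<zero>\<^bsub>obj D n\<^esub>"
    using mod_hom_zero[OF complex_module[OF assms(1)] complex_module[OF assms(2)] h(1), of "n + 1"]
    by simp
  have h1: "h n v \<in> carrier (obj D (n - 1))" using v by (auto intro: mod_hom_closed[OF h(1)])
  then have "g n v = diff D (n - 1) (h n v) \<oplus>\<^bsub>obj D n\<^esub> g' n v"
    using h(2)[of v n] v h0 mod_hom_closed[OF complex_diff'[OF assms(2)] h1] by simp
  then show ?thesis
    using h1 chain_map_cycle[OF assms(1,2,3) v] chain_map_cycle[OF assms(1,2,4) v]
    by (subst coh_class_eq_iff[OF assms(2)]) blast+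
qed

section \<open>The complex of homomorphisms\<close>

lemma hom_module_simps [simp]:
  "carrier (hom_module A M N) = mod_hom A M N \<inter> extensional (carrier M)"
  "\<zero>\<^bsub>hom_module A M N\<^esub> = (\<lambda>v\<in>carrier M. \<zero>\<^bsub>N\<^esub>)"
  "h \<oplus>\<^bsub>hom_module A M N\<^esub> k = (\<lambda>v\<in>carrier M. h v \<oplus>\<^bsub>N\<^esub> k v)"
  "a \<odot>\<^bsub>hom_module A M N\<^esub> h = (\<lambda>v\<in>carrier M. a \<odot>\<^bsub>N\<^esub> h v)"
  by (simp_all add: hom_module_def)

lemma hom_complex_simps:
  "carrier (obj (hom_complex A C X) n) =
    {\<phi>. \<forall>p. \<phi> p \<in> mod_hom A (obj C p) (obj X (p + n)) \<inter> extensional (carrier (obj C p))}"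
  "\<zero>\<^bsub>obj (hom_complex A C X) n\<^esub> = (\<lambda>p. \<lambda>v\<in>carrier (obj C p). \<zero>\<^bsub>obj X (p + n)\<^esub>)"
  "\<phi> \<oplus>\<^bsub>obj (hom_complex A C X) n\<^esub> \<psi> = (\<lambda>p. \<lambda>v\<in>carrier (obj C p). \<phi> p v \<oplus>\<^bsub>obj X (p + n)\<^esub> \<psi> p v)"
  "a \<odot>\<^bsub>obj (hom_complex A C X) n\<^esub> \<phi> = (\<lambda>p. \<lambda>v\<in>carrier (obj C p). a \<odot>\<^bsub>obj X (p + n)\<^esub> \<phi> p v)"
  by (simp_all add: hom_complex_def)

lemma hom_complex_diff:
  "diff (hom_complex A C X) n \<phi> = (\<lambda>p. \<lambda>v\<in>carrier (obj C p).
        if even n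
        then diff X (p + n) (\<phi> p v) \<ominus>\<^bsub>obj X (p + n + 1)\<^esub> \<phi> (p + 1) (diff C p v)
        else diff X (p + n) (\<phi> p v) \<oplus>\<^bsub>obj X (p + n + 1)\<^esub> \<phi> (p + 1) (diff C p v))"
  by (simp add: hom_complex_def)

lemma hom_module_module:
  assumes M: "module A M" and N: "module A N" shows "module A (hom_module A M N)"
proof -
  interpret M: module A M by fact
  interpret N: module A N by fact
  let ?H = "hom_module A M N"
  have sub: "h v \<in> carrier N" if "h \<in> carrier ?H" "v \<in> carrier M" for h v
    using that by (auto intro: mod_hom_closed)
  show ?thesis
  proof (rule moduleI[OF M.is_cring])
    show "abelian_group ?H"
    proof (rule abelian_groupI)
      fix h assume h: "h \<in> carrier ?H"
      then have "(\<lambda>v\<in>carrier M. \<ominus>\<^bsub>N\<^esub> h v) \<in> carrier ?H"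
        using mod_hom_restrict[OF M mod_hom_neg_fun[OF N]] by auto
      then show "\<exists>k\<in>carrier ?H. k \<oplus>\<^bsub>?H\<^esub> h = \<zero>\<^bsub>?H\<^esub>"
        by (rule rev_bexI) (auto simp: N.l_neg sub[OF h] fun_eq_iff)
    next
      fix h k assume h: "h \<in> carrier ?H" and k: "k \<in> carrier ?H"
      then show "h \<oplus>\<^bsub>?H\<^esub> k \<in> carrier ?H"
        using mod_hom_restrict[OF M mod_hom_add_fun[OF N]] by auto
      show "h \<oplus>\<^bsub>?H\<^esub> k = k \<oplus>\<^bsub>?H\<^esub> h"
        by (auto simp: fun_eq_iff N.a_comm sub[OF h] sub[OF k])
      fix l assume l: "l \<in> carrier ?H"
      show "h \<oplus>\<^bsub>?H\<^esub> k \<oplus>\<^bsub>?H\<^esub> l = h \<oplus>\<^bsub>?H\<^esub> (k \<oplus>\<^bsub>?H\<^esub> l)"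
        by (auto simp: fun_eq_iff N.a_assoc sub[OF h] sub[OF k] sub[OF l])
    next
      show "\<zero>\<^bsub>?H\<^esub> \<in> carrier ?H"
        using mod_hom_restrict[OF M mod_hom_const_zero[OF N]] by auto
      fix h assume h: "h \<in> carrier ?H"
      then show "\<zero>\<^bsub>?H\<^esub> \<oplus>\<^bsub>?H\<^esub> h = h"
        using sub[OF h] by (auto simp: fun_eq_iff extensional_def)
    qed
  next
    fix a h assume a: "a \<in> carrier A" and h: "h \<in> carrier ?H"
    then show "a \<odot>\<^bsub>?H\<^esub> h \<in> carrier ?H"
      using mod_hom_restrict[OF M mod_hom_smult_fun[OF N]] by auto
    fix b assume b: "b \<in> carrier A"
    show "(a \<oplus>\<^bsub>A\<^esub> b) \<odot>\<^bsub>?H\<^esub> h = a \<odot>\<^bsub>?H\<^esub> h \<oplus>\<^bsub>?H\<^esub> b \<odot>\<^bsub>?H\<^esub> h"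
      using a b by (auto simp: fun_eq_iff N.smult_l_distr sub[OF h])
    show "(a \<otimes>\<^bsub>A\<^esub> b) \<odot>\<^bsub>?H\<^esub> h = a \<odot>\<^bsub>?H\<^esub> (b \<odot>\<^bsub>?H\<^esub> h)"
      using a b by (auto simp: fun_eq_iff N.smult_assoc1 sub[OF h])
  next
    fix a h k assume a: "a \<in> carrier A" and h: "h \<in> carrier ?H" and k: "k \<in> carrier ?H"
    show "a \<odot>\<^bsub>?H\<^esub> (h \<oplus>\<^bsub>?H\<^esub> k) = a \<odot>\<^bsub>?H\<^esub> h \<oplus>\<^bsub>?H\<^esub> a \<odot>\<^bsub>?H\<^esub> k"
      using a by (auto simp: fun_eq_iff N.smult_r_distr sub[OF h] sub[OF k])
  next
    fix h assume h: "h \<in> carrier ?H"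
    then show "\<one>\<^bsub>A\<^esub> \<odot>\<^bsub>?H\<^esub> h = h"
      using sub[OF h] by (auto simp: fun_eq_iff extensional_def)
  qed
qed

lemma product_module_module:
  assumes "cring A" "\<And>p. module A (M p)"
    and "carrier Q = {\<phi>. \<forall>p. \<phi> p \<in> carrier (M p)}" "zero Q = (\<lambda>p. \<zero>\<^bsub>M p\<^esub>)"
    and "\<And>\<phi> \<psi>. \<phi> \<oplus>\<^bsub>Q\<^esub> \<psi> = (\<lambda>p. \<phi> p \<oplus>\<^bsub>M p\<^esub> \<psi> p)" "\<And>a \<phi>. a \<odot>\<^bsub>Q\<^esub> \<phi> = (\<lambda>p. a \<odot>\<^bsub>M p\<^esub> \<phi> p)"
  shows "module A Q"
proof -
  interpret M: module A "M p" for p by (rule assms(2))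
  show ?thesis
  proof (rule moduleI[OF assms(1)])
    show "abelian_group Q"
    proof (rule abelian_groupI)
      fix \<phi> assume "\<phi> \<in> carrier Q"
      then show "\<exists>\<psi>\<in>carrier Q. \<psi> \<oplus>\<^bsub>Q\<^esub> \<phi> = \<zero>\<^bsub>Q\<^esub>"
        by (intro bexI[of _ "\<lambda>p. \<ominus>\<^bsub>M p\<^esub> \<phi> p"]) (auto simp: assms M.l_neg)
    qed (auto simp: assms M.a_ac)
  qed (auto simp: assms M.smult_l_distr M.smult_r_distr M.smult_assoc1)
qed

lemma hom_complex_module:
  assumes "cring A" "is_complex A C" "is_complex A X"
  shows "module A (obj (hom_complex A C X) n)"
  by (rule product_module_module[OF assms(1),
        of "\<lambda>p. hom_module A (obj C p) (obj X (p + n))"])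
    (simp_all add: hom_complex_simps hom_module_module complex_module assms)

text \<open>
  The two mixed terms \<open>d \<phi> d\<close> of the squared differential cancel because consecutive degrees have
  opposite parity.
\<close>

lemma hom_complex_is_complex:
  assumes "cring A" "is_complex A C" "is_complex A X"
  shows "is_complex A (hom_complex A C X)"
  unfolding is_complex_def
proof (intro allI conjI ballI)
  let ?H = "hom_complex A C X"
  interpret X: module A "obj X n" for n by (rule complex_module[OF assms(3)])
  fix n
  show "module A (obj ?H n)" by (rule hom_complex_module[OF assms])
  have eq: "p + 1 + n = p + n + 1" "p + (n + 1) = p + n + 1" for p :: int by simp_all
  have \<phi>: "\<phi> p \<in> mod_hom A (obj C p) (obj X (p + n))"
    "\<phi> (p + 1) \<in> mod_hom A (obj C (p + 1)) (obj X (p + n + 1))"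
    if "\<phi> \<in> carrier (obj ?H n)" for \<phi> p
    using that unfolding hom_complex_simps by (auto simp flip: eq(1))
  have d\<phi>: "(\<lambda>v. diff X (p + n) (\<phi> p v)) \<in> mod_hom A (obj C p) (obj X (p + n + 1))"
    "(\<lambda>v. \<phi> (p + 1) (diff C p v)) \<in> mod_hom A (obj C p) (obj X (p + n + 1))"
    if "\<phi> \<in> carrier (obj ?H n)" for \<phi> p
    by (rule mod_hom_compose[OF \<phi>(1)[OF that] complex_diff[OF assms(3)]],
      rule mod_hom_compose[OF complex_diff[OF assms(2)] \<phi>(2)[OF that]])
  have cl: "\<phi> p v \<in> carrier (obj X (p + n))" "diff X (p + n) (\<phi> p v) \<in> carrier (obj X (p + n + 1))"
    "\<phi> (p + 1) (diff C p v) \<in> carrier (obj X (p + n + 1))"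
    if "\<phi> \<in> carrier (obj ?H n)" "v \<in> carrier (obj C p)" for \<phi> p v
    using mod_hom_closed[OF d\<phi>(1)[OF that(1)] that(2)] mod_hom_closed[OF d\<phi>(2)[OF that(1)] that(2)]
      mod_hom_closed[OF \<phi>(1)[OF that(1)] that(2)] by auto
  have dC: "diff C p v \<in> carrier (obj C (p + 1))" if "v \<in> carrier (obj C p)" for p v
    by (rule mod_hom_closed[OF complex_diff[OF assms(2)] that])
  show "diff ?H n \<in> mod_hom A (obj ?H n) (obj ?H (n + 1))"
  proof (rule mod_homI)
    fix \<phi> assume \<phi>H: "\<phi> \<in> carrier (obj ?H n)"
    have "diff ?H n \<phi> p \<in> mod_hom A (obj C p) (obj X (p + n + 1)) \<inter> extensional (carrier (obj C p))" for p
      unfolding hom_complex_diff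
      using mod_hom_minus_fun[OF X.module_axioms d\<phi>[OF \<phi>H]] mod_hom_add_fun[OF X.module_axioms d\<phi>[OF \<phi>H]]
      by (cases "even n") (auto intro: mod_hom_restrict[OF complex_module[OF assms(2)]])
    then show "diff ?H n \<phi> \<in> carrier (obj ?H (n + 1))"
      unfolding hom_complex_simps eq by simp
  next
    fix \<phi> \<psi> assume \<phi>H: "\<phi> \<in> carrier (obj ?H n)" and \<psi>H: "\<psi> \<in> carrier (obj ?H n)"
    show "diff ?H n (\<phi> \<oplus>\<^bsub>obj ?H n\<^esub> \<psi>) = diff ?H n \<phi> \<oplus>\<^bsub>obj ?H (n + 1)\<^esub> diff ?H n \<psi>"
      unfolding hom_complex_diff hom_complex_simps eq
      by (auto simp: fun_eq_iff cl[OF \<phi>H] cl[OF \<psi>H] dC mod_hom_add[OF complex_diff[OF assms(3)]]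
          a_minus_def X.minus_add X.a_ac)
  next
    fix a \<phi> assume a: "a \<in> carrier A" and \<phi>H: "\<phi> \<in> carrier (obj ?H n)"
    show "diff ?H n (a \<odot>\<^bsub>obj ?H n\<^esub> \<phi>) = a \<odot>\<^bsub>obj ?H (n + 1)\<^esub> diff ?H n \<phi>"
      unfolding hom_complex_diff hom_complex_simps eq
      using a by (auto simp: fun_eq_iff cl[OF \<phi>H] dC mod_hom_smult[OF complex_diff[OF assms(3)]]
          a_minus_def X.smult_r_minus X.smult_r_distr)
  qed
  fix \<phi> assume \<phi>H: "\<phi> \<in> carrier (obj ?H n)"
  have ddX: "diff X (p + n + 1) (diff X (p + n) (\<phi> p v)) = \<zero>\<^bsub>obj X (p + n + 1 + 1)\<^esub>"
    if "v \<in> carrier (obj C p)" for p v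
    by (rule complex_diff_diff[OF assms(3) cl(1)[OF \<phi>H that]])
  have ddC: "\<phi> (p + 1 + 1) (diff C (p + 1) (diff C p v)) = \<zero>\<^bsub>obj X (p + n + 1 + 1)\<^esub>"
    if "v \<in> carrier (obj C p)" for p v
  proof -
    have "\<phi> (p + 1 + 1) \<zero>\<^bsub>obj C (p + 1 + 1)\<^esub> = \<zero>\<^bsub>obj X (p + 1 + n + 1)\<^esub>"
      by (rule mod_hom_zero[OF complex_module complex_module \<phi>(2)[OF \<phi>H]]) (rule assms)+
    then show ?thesis
      by (simp add: complex_diff_diff[OF assms(2) that] eq)
  qed
  have d\<phi>d: "diff X (p + n + 1) (\<phi> (p + 1) (diff C p v)) \<in> carrier (obj X (p + n + 1 + 1))"
    if "v \<in> carrier (obj C p)" for p v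
    by (rule mod_hom_closed[OF complex_diff[OF assms(3)] cl(3)[OF \<phi>H that]])
  have "diff ?H (n + 1) (diff ?H n \<phi>) p v = \<zero>\<^bsub>obj X (p + n + 1 + 1)\<^esub>" if v: "v \<in> carrier (obj C p)" for p v
  proof (cases "even n")
    case True
    have "diff ?H (n + 1) (diff ?H n \<phi>) p v =
       diff X (p + n + 1) (diff X (p + n) (\<phi> p v) \<ominus>\<^bsub>obj X (p + n + 1)\<^esub> \<phi> (p + 1) (diff C p v))
       \<oplus>\<^bsub>obj X (p + n + 1 + 1)\<^esub> (diff X (p + n + 1) (\<phi> (p + 1) (diff C p v))
         \<ominus>\<^bsub>obj X (p + n + 1 + 1)\<^esub> \<phi> (p + 1 + 1) (diff C (p + 1) (diff C p v)))"
      unfolding hom_complex_diff eq using True v dC[OF v] by simp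
    also have "\<dots> = \<zero>\<^bsub>obj X (p + n + 1 + 1)\<^esub>"
      unfolding mod_hom_minus[OF X.module_axioms X.module_axioms complex_diff[OF assms(3)]
          cl(2,3)[OF \<phi>H v]] ddX[OF v] ddC[OF v]
      using d\<phi>d[OF v] by (simp add: a_minus_def X.l_neg module_neg_zero[OF X.module_axioms])
    finally show ?thesis .
  next
    case False
    have "diff ?H (n + 1) (diff ?H n \<phi>) p v =
       diff X (p + n + 1) (diff X (p + n) (\<phi> p v) \<oplus>\<^bsub>obj X (p + n + 1)\<^esub> \<phi> (p + 1) (diff C p v))
       \<ominus>\<^bsub>obj X (p + n + 1 + 1)\<^esub> (diff X (p + n + 1) (\<phi> (p + 1) (diff C p v))
         \<oplus>\<^bsub>obj X (p + n + 1 + 1)\<^esub> \<phi> (p + 1 + 1) (diff C (p + 1) (diff C p v)))"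
      unfolding hom_complex_diff eq using False v dC[OF v] by simp
    also have "\<dots> = \<zero>\<^bsub>obj X (p + n + 1 + 1)\<^esub>"
      unfolding mod_hom_add[OF complex_diff[OF assms(3)] cl(2,3)[OF \<phi>H v]] ddX[OF v] ddC[OF v]
      using d\<phi>d[OF v] by (simp add: a_minus_def X.r_neg)
    finally show ?thesis .
  qed
  moreover have "diff ?H (n + 1) (diff ?H n \<phi>) p v = undefined" if "v \<notin> carrier (obj C p)" for p v
    using that by (simp add: hom_complex_diff)
  ultimately show "diff ?H (n + 1) (diff ?H n \<phi>) = \<zero>\<^bsub>obj ?H (n + 1 + 1)\<^esub>"
    unfolding hom_complex_simps by (auto simp: fun_eq_iff add.assoc restrict_def)
qed

definition restrict_map :: "('a, 'p) cplx \<Rightarrow> (int \<Rightarrow> 'p \<Rightarrow> 'm) \<Rightarrow> int \<Rightarrow> 'p \<Rightarrow> 'm" where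
  "restrict_map C g = (\<lambda>p. restrict (g p) (carrier (obj C p)))"

text \<open>Elements of the Hom complex are extensional, whence the restriction to the carriers.\<close>

definition hom_class ::
  "('a, 'r) ring_scheme \<Rightarrow> ('a, 'p) cplx \<Rightarrow> ('a, 'm) cplx \<Rightarrow> (int \<Rightarrow> 'p \<Rightarrow> 'm) \<Rightarrow> (int \<Rightarrow> 'p \<Rightarrow> 'm) set" where
  "hom_class A C X g = coh_class (hom_complex A C X) 0 (restrict_map C g)"

lemma hom_complex_cycles_iff:
  assumes "is_complex A C" "is_complex A X"
  shows "\<phi> \<in> carrier (cycles (hom_complex A C X) 0) \<longleftrightarrow>
    chain_map A C X \<phi> \<and> (\<forall>p. \<phi> p \<in> extensional (carrier (obj C p)))"
proof -
  have "diff X p (\<phi> p v) \<ominus>\<^bsub>obj X (p + 1)\<^esub> \<phi> (p + 1) (diff C p v) = \<zero>\<^bsub>obj X (p + 1)\<^esub> \<longleftrightarrow>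
      diff X p (\<phi> p v) = \<phi> (p + 1) (diff C p v)"
    if "\<forall>p. \<phi> p \<in> mod_hom A (obj C p) (obj X p)" "v \<in> carrier (obj C p)" for p v
  proof -
    interpret X: module A "obj X (p + 1)" by (rule complex_module[OF assms(2)])
    have "diff X p (\<phi> p v) \<in> carrier (obj X (p + 1))"
      by (rule mod_hom_closed[OF complex_diff[OF assms(2)] mod_hom_closed[OF that(1)[rule_format] that(2)]])
    moreover have "\<phi> (p + 1) (diff C p v) \<in> carrier (obj X (p + 1))"
      by (rule mod_hom_closed[OF that(1)[rule_format] mod_hom_closed[OF complex_diff[OF assms(1)] that(2)]])
    ultimately show ?thesis by (simp add: module_minus_eq_iff[OF X.module_axioms])
  qed
  then show ?thesis
    by (auto simp: hom_complex_simps hom_complex_diff chain_map_def fun_eq_iff restrict_def)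
qed

lemma restrict_map_cycle:
  assumes "is_complex A C" "is_complex A X" "chain_map A C X g"
  shows "restrict_map C g \<in> carrier (cycles (hom_complex A C X) 0)"
  unfolding hom_complex_cycles_iff[OF assms(1,2)]
  using chain_map_cong[OF assms(1,3), of "restrict_map C g"] by (simp add: restrict_map_def)

lemma hom_class_closed:
  assumes "cring A" "is_complex A C" "is_complex A X" "chain_map A C X g"
  shows "hom_class A C X g \<in> carrier (cohomology (hom_complex A C X) 0)"
  unfolding hom_class_def
  by (rule coh_class_closed[OF hom_complex_is_complex[OF assms(1-3)] restrict_map_cycle[OF assms(2-4)]])

lemma hom_classE:
  assumes "cring A" "is_complex A C" "is_complex A X" "w \<in> carrier (cohomology (hom_complex A C X) 0)"
  obtains g where "chain_map A C X g" "w = hom_class A C X g"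
proof -
  obtain \<phi> where \<phi>: "\<phi> \<in> carrier (cycles (hom_complex A C X) 0)" "w = coh_class (hom_complex A C X) 0 \<phi>"
    by (rule cohomologyE[OF hom_complex_is_complex[OF assms(1-3)] assms(4)])
  then have "restrict_map C \<phi> = \<phi>" "chain_map A C X \<phi>"
    unfolding hom_complex_cycles_iff[OF assms(2,3)]
    by (auto simp: restrict_map_def fun_eq_iff extensional_def)
  then show thesis using that \<phi>(2) by (simp add: hom_class_def)
qed

text \<open>Degree \<open>0\<close> boundaries of the Hom complex are the null-homotopic chain maps.\<close>

lemma hom_class_eq_iff:
  assumes "cring A" "is_complex A C" "is_complex A X" "chain_map A C X g" "chain_map A C X g'"
  shows "hom_class A C X g = hom_class A C X g' \<longleftrightarrow> homotopic A C X g g'"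
proof -
  let ?H = "hom_complex A C X"
  have odd: "odd (- 1 :: int)" by simp
  have "hom_class A C X g = hom_class A C X g' \<longleftrightarrow>
      (\<exists>\<eta>\<in>carrier (obj ?H (-1)). restrict_map C g = diff ?H (-1) \<eta> \<oplus>\<^bsub>obj ?H 0\<^esub> restrict_map C g')"
    unfolding hom_class_def
    using coh_class_eq_iff[OF hom_complex_is_complex[OF assms(1-3)]
        restrict_map_cycle[OF assms(2-4)] restrict_map_cycle[OF assms(2,3,5)]] by simp
  also have "\<dots> \<longleftrightarrow> (\<exists>\<eta>\<in>carrier (obj ?H (-1)). \<forall>p. \<forall>v\<in>carrier (obj C p).
      g p v = (diff X (p - 1) (\<eta> p v) \<oplus>\<^bsub>obj X p\<^esub> \<eta> (p + 1) (diff C p v)) \<oplus>\<^bsub>obj X p\<^esub> g' p v)"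
    by (intro bex_cong refl)
      (auto simp: hom_complex_simps hom_complex_diff restrict_map_def fun_eq_iff restrict_def)
  also have "\<dots> \<longleftrightarrow> (\<exists>h. \<forall>n. h n \<in> mod_hom A (obj C n) (obj X (n - 1)) \<and>
        (\<forall>v\<in>carrier (obj C n).
           g n v = (diff X (n - 1) (h n v) \<oplus>\<^bsub>obj X n\<^esub> h (n + 1) (diff C n v)) \<oplus>\<^bsub>obj X n\<^esub> g' n v))"
    (is "?L \<longleftrightarrow> ?R")
  proof
    assume ?L then show ?R unfolding hom_complex_simps by (elim bexE) (rule exI, auto)
  next
    assume ?R
    then obtain h where h: "\<And>n. h n \<in> mod_hom A (obj C n) (obj X (n - 1))"
      and eq: "\<And>n v. v \<in> carrier (obj C n) \<Longrightarrow>
        g n v = (diff X (n - 1) (h n v) \<oplus>\<^bsub>obj X n\<^esub> h (n + 1) (diff C n v)) \<oplus>\<^bsub>obj X n\<^esub> g' n v"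
      by (elim exE) (rule that, simp_all)
    have "restrict_map C h \<in> carrier (obj ?H (-1))"
      unfolding hom_complex_simps restrict_map_def
      using mod_hom_restrict[OF complex_module[OF assms(2)] h] by simp
    then show ?L
      by (rule rev_bexI)
        (simp add: restrict_map_def eq[symmetric] mod_hom_closed[OF complex_diff[OF assms(2)]])
  qed
  also have "\<dots> \<longleftrightarrow> homotopic A C X g g'" by (rule homotopic_iff[OF assms(2-5), symmetric])
  finally show ?thesis .
qed

lemma hom_class_cong:
  assumes "\<And>n v. v \<in> carrier (obj C n) \<Longrightarrow> g n v = g' n v"
  shows "hom_class A C X g = hom_class A C X g'"
proof -
  have "restrict_map C g = restrict_map C g'"
    using assms by (auto simp: restrict_map_def fun_eq_iff restrict_def)
  then show ?thesis by (simp add: hom_class_def)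
qed

lemma hom_class_add:
  assumes "cring A" "is_complex A C" "is_complex A X" "chain_map A C X g" "chain_map A C X g'"
  shows "hom_class A C X (\<lambda>n v. g n v \<oplus>\<^bsub>obj X n\<^esub> g' n v) =
    hom_class A C X g \<oplus>\<^bsub>cohomology (hom_complex A C X) 0\<^esub> hom_class A C X g'"
proof -
  have "restrict_map C (\<lambda>n v. g n v \<oplus>\<^bsub>obj X n\<^esub> g' n v) =
      restrict_map C g \<oplus>\<^bsub>obj (hom_complex A C X) 0\<^esub> restrict_map C g'"
    by (auto simp: hom_complex_simps restrict_map_def fun_eq_iff restrict_def)
  then show ?thesis
    unfolding hom_class_def
    by (simp add: coh_class_add[OF hom_complex_is_complex restrict_map_cycle restrict_map_cycle] assms)
qed

lemma hom_class_smult: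
  assumes "cring A" "is_complex A C" "is_complex A X" "chain_map A C X g" "a \<in> carrier A"
  shows "hom_class A C X (\<lambda>n v. a \<odot>\<^bsub>obj X n\<^esub> g n v) =
    a \<odot>\<^bsub>cohomology (hom_complex A C X) 0\<^esub> hom_class A C X g"
proof -
  have "restrict_map C (\<lambda>n v. a \<odot>\<^bsub>obj X n\<^esub> g n v) = a \<odot>\<^bsub>obj (hom_complex A C X) 0\<^esub> restrict_map C g"
    by (auto simp: hom_complex_simps restrict_map_def fun_eq_iff restrict_def)
  then show ?thesis
    unfolding hom_class_def
    by (simp add: coh_class_smult[OF hom_complex_is_complex _ restrict_map_cycle] assms)
qed

lemma precompose_chain_map:
  assumes "is_complex A C" "is_complex A D" "is_complex A X" "chain_map A C D g"
  shows "chain_map A (hom_complex A D X) (hom_complex A C X) (precompose C g)"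
  unfolding chain_map_def
proof (intro allI conjI ballI)
  fix n
  have g: "g p v \<in> carrier (obj D p)" if "v \<in> carrier (obj C p)" for p v
    using that by (rule chain_map_closed[OF assms(4)])
  have dC: "diff C p v \<in> carrier (obj C (p + 1))" if "v \<in> carrier (obj C p)" for p v
    by (rule mod_hom_closed[OF complex_diff[OF assms(1)] that])
  show "precompose C g n \<in> mod_hom A (obj (hom_complex A D X) n) (obj (hom_complex A C X) n)"
  proof (rule mod_homI)
    fix \<phi> assume \<phi>: "\<phi> \<in> carrier (obj (hom_complex A D X) n)"
    have "(\<lambda>v\<in>carrier (obj C p). \<phi> p (g p v)) \<in> mod_hom A (obj C p) (obj X (p + n))" for p
      using \<phi> unfolding hom_complex_simps
      by (intro mod_hom_restrict[OF complex_module[OF assms(1)]]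
          mod_hom_compose[OF chain_map_mod_hom[OF assms(4)]]) auto
    then show "precompose C g n \<phi> \<in> carrier (obj (hom_complex A C X) n)"
      unfolding hom_complex_simps precompose_def by simp
  qed (auto simp: hom_complex_simps precompose_def fun_eq_iff g)
  show "diff (hom_complex A C X) n (precompose C g n \<phi>) =
      precompose C g (n + 1) (diff (hom_complex A D X) n \<phi>)" for \<phi>
    by (auto simp: hom_complex_diff precompose_def fun_eq_iff g dC chain_map_diff[OF assms(4)])
qed

lemma precompose_hom_class:
  assumes "cring A" "is_complex A C" "is_complex A D" "is_complex A X"
    and "chain_map A C D k" "chain_map A D X g"
  shows "coh_map (hom_complex A C X) 0 (precompose C k) (hom_class A D X g) =
    hom_class A C X (\<lambda>n v. g n (k n v))"
proof -
  have "precompose C k 0 (restrict_map D g) = restrict_map C (\<lambda>n v. g n (k n v))"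
    by (auto simp: precompose_def restrict_map_def fun_eq_iff chain_map_closed[OF assms(5)])
  then show ?thesis
    unfolding hom_class_def
    by (simp add: coh_map_class[OF hom_complex_is_complex hom_complex_is_complex precompose_chain_map
          restrict_map_cycle] assms)
qed

lemma hom_class_zero:
  assumes "cring A" "is_complex A C" "is_complex A X"
  shows "hom_class A C X (\<lambda>n v. \<zero>\<^bsub>obj X n\<^esub>) = \<zero>\<^bsub>cohomology (hom_complex A C X) 0\<^esub>"
proof -
  have "restrict_map C (\<lambda>n v. \<zero>\<^bsub>obj X n\<^esub>) = \<zero>\<^bsub>obj (hom_complex A C X) 0\<^esub>"
    by (simp add: hom_complex_simps restrict_map_def)
  then show ?thesis
    unfolding hom_class_def by (simp add: coh_class_zero[OF hom_complex_is_complex] assms)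
qed

text \<open>
  Homotopic chain maps have cohomologous values at the cycle \<open>1\<close>, so the value of \<open>eval_one\<close> can be
  computed on any representative.
\<close>

lemma eval_one_hom_class:
  assumes "cring A" "is_complex A T" "is_complex A X" "chain_map A T X g"
    and one: "\<one>\<^bsub>A\<^esub> \<in> carrier (cycles T q)"
  shows "eval_one A X q (hom_class A T X g) = coh_class X q (g q \<one>\<^bsub>A\<^esub>)"
proof -
  let ?H = "hom_complex A T X"
  have H: "is_complex A ?H" by (rule hom_complex_is_complex[OF assms(1-3)])
  have c: "restrict_map T g \<in> carrier (cycles ?H 0)" by (rule restrict_map_cycle[OF assms(2-4)])
  interpret Z: module A "cycles ?H 0" by (rule cycles_module[OF H])
  have "eval_one A X q (hom_class A T X g) = coh_class X q (restrict_map T g q \<one>\<^bsub>A\<^esub>)"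
    unfolding eval_one_def hom_class_def
  proof (rule the_elem_image_coh_class[OF H c])
    fix \<eta> assume \<eta>: "\<eta> \<in> carrier (obj ?H (0 - 1))"
    let ?\<phi> = "diff ?H (0 - 1) \<eta> \<oplus>\<^bsub>obj ?H 0\<^esub> restrict_map T g"
    have "diff ?H (0 - 1) \<eta> \<in> carrier (cycles ?H 0)"
      using mod_hom_closed[OF complex_diff'[OF H] \<eta>] complex_diff_diff'[OF H \<eta>] by simp
    from Z.a_closed[OF this c] have \<phi>: "?\<phi> \<in> carrier (cycles ?H 0)" by (simp only: cycles_simps)
    then have \<phi>': "chain_map A T X ?\<phi>" by (simp only: hom_complex_cycles_iff[OF assms(2,3)])
    have g: "chain_map A T X (restrict_map T g)"
      using c by (simp only: hom_complex_cycles_iff[OF assms(2,3)])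
    have rr: "restrict_map T \<psi> = \<psi>" if "\<psi> \<in> carrier (cycles ?H 0)" for \<psi>
      using that unfolding hom_complex_cycles_iff[OF assms(2,3)] by (auto simp: restrict_map_def fun_eq_iff extensional_def)
    have "coh_class ?H 0 ?\<phi> = coh_class ?H 0 (restrict_map T g)"
      by (subst coh_class_eq_iff[OF H \<phi> c]) (rule bexI[OF refl \<eta>])
    then have "hom_class A T X ?\<phi> = hom_class A T X (restrict_map T g)"
      unfolding hom_class_def rr[OF \<phi>] rr[OF c] .
    then have "homotopic A T X ?\<phi> (restrict_map T g)"
      unfolding hom_class_eq_iff[OF assms(1-3) \<phi>' g] .
    from homotopic_coh_class[OF assms(2,3) \<phi>' g this one]
    show "coh_class X q (?\<phi> q \<one>\<^bsub>A\<^esub>) = coh_class X q (restrict_map T g q \<one>\<^bsub>A\<^esub>)" .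
  qed
  then show ?thesis using one by (simp add: restrict_map_def)
qed

section \<open>Morphisms from a projective module in the derived category\<close>

lemma concentrated_simps [simp]:
  "carrier (obj (concentrated M) n) = (if n = 0 then carrier M else {\<zero>\<^bsub>M\<^esub>})"
  "zero (obj (concentrated M) n) = zero M" "add (obj (concentrated M) n) = add M"
  "smult (obj (concentrated M) n) = smult M" "diff (concentrated M) n v = \<zero>\<^bsub>M\<^esub>"
  by (auto simp: concentrated_def)

lemma concentrated_is_complex:
  assumes "module A M" shows "is_complex A (concentrated M)"
proof -
  interpret M: module A M by fact
  have "module A (obj (concentrated M) n)" for n
    using zero_submodule_module[OF assms] assms by (simp add: concentrated_def)
  then show ?thesis by (auto simp: is_complex_def mod_hom_def)
qed

lemma coh_class_concentrated:
  assumes "module A M" "z \<in> carrier M" shows "coh_class (concentrated M) 0 z = {z}"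
proof -
  interpret M: module A M by fact
  show ?thesis using assms(2) by (auto simp: coh_class_def boundaries_def a_r_coset_def')
qed

lemma quasi_iso_chain_map: "quasi_iso A C D g \<Longrightarrow> chain_map A C D g"
  by (simp add: quasi_iso_def)

lemma quasi_iso_inj:
  assumes "is_complex A C" "is_complex A D" "quasi_iso A C D g"
    and "v \<in> carrier (cycles C n)" "w \<in> carrier (cycles C n)"
    and "coh_class D n (g n v) = coh_class D n (g n w)"
  shows "coh_class C n v = coh_class C n w"
proof -
  have g: "chain_map A C D g" by (rule quasi_iso_chain_map[OF assms(3)])
  have "inj_on (coh_map D n g) (carrier (cohomology C n))"
    using assms(3) by (simp add: quasi_iso_def bij_betw_def)
  moreover have "coh_map D n g (coh_class C n v) = coh_map D n g (coh_class C n w)"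
    using assms(6) by (simp add: coh_map_class[OF assms(1,2) g assms(4)]
        coh_map_class[OF assms(1,2) g assms(5)])
  ultimately show ?thesis
    by (rule inj_onD[OF _ _ coh_class_closed[OF assms(1,4)] coh_class_closed[OF assms(1,5)]])
qed

lemma quasi_iso_surj:
  assumes "is_complex A C" "is_complex A D" "quasi_iso A C D g" "w \<in> carrier (cycles D n)"
  shows "\<exists>v\<in>carrier (cycles C n). coh_class D n (g n v) = coh_class D n w"
proof -
  have g: "chain_map A C D g" by (rule quasi_iso_chain_map[OF assms(3)])
  have "coh_class D n w \<in> coh_map D n g ` carrier (cohomology C n)"
    using assms(3) coh_class_closed[OF assms(2,4)] by (simp add: quasi_iso_def bij_betw_def)
  then obtain u where u: "u \<in> carrier (cohomology C n)" "coh_class D n w = coh_map D n g u"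
    by (rule imageE) (rule that)
  obtain v where "v \<in> carrier (cycles C n)" "u = coh_class C n v"
    by (rule cohomologyE[OF assms(1) u(1)]) (rule that)
  then show ?thesis using u(2) coh_map_class[OF assms(1,2) g] by (intro bexI[of _ v]) simp_all
qed

lemma quasi_iso_onto_concentrated:
  assumes "is_complex A C" "module A M" "quasi_iso A C (concentrated M) g" "z \<in> carrier M"
  shows "\<exists>v\<in>carrier (cycles C 0). g 0 v = z"
proof -
  have "z \<in> carrier (cycles (concentrated M) 0)" using assms(4) by simp
  from quasi_iso_surj[OF assms(1) concentrated_is_complex[OF assms(2)] assms(3) this]
  obtain v where v: "v \<in> carrier (cycles C 0)"
    "coh_class (concentrated M) 0 (g 0 v) = coh_class (concentrated M) 0 z"
    by (rule bexE) (rule that)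
  have "g 0 v \<in> carrier M"
    using chain_map_closed[OF quasi_iso_chain_map[OF assms(3)], of v 0] v(1) by simp
  then show ?thesis
    using v assms(4) by (intro bexI[of _ v]) (simp_all add: coh_class_concentrated[OF assms(2)])
qed

lemma quasi_iso_concentrated_exact:
  assumes Z: "is_complex A Z" and M: "module A M" and s: "quasi_iso A Z (concentrated M) s"
    and n: "n \<noteq> 0" and v: "v \<in> carrier (cycles Z n)"
  shows "\<exists>y\<in>carrier (obj Z (n - 1)). v = diff Z (n - 1) y"
proof -
  have CM: "is_complex A (concentrated M)" by (rule concentrated_is_complex[OF M])
  have sm: "chain_map A Z (concentrated M) s" by (rule quasi_iso_chain_map[OF s])
  interpret Z: module A "obj Z m" for m by (rule complex_module[OF Z])
  have "s n v \<in> carrier (obj (concentrated M) n)" by (rule chain_map_closed[OF sm]) (use v in simp)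
  then have "s n v = s n \<zero>\<^bsub>obj Z n\<^esub>" using n chain_map_zero[OF Z CM sm, of n] by simp
  then have "coh_class Z n v = coh_class Z n \<zero>\<^bsub>obj Z n\<^esub>"
    using complex_diff_zero[OF Z, of n] by (intro quasi_iso_inj[OF Z CM s v]) simp_all
  then show ?thesis using coh_class_eq_zero_iff[OF Z v] coh_class_zero[OF Z, of n] by simp
qed

lemma quasi_iso_of_identity:
  assumes "is_complex A C" "chain_map A C C g" "\<And>n v. v \<in> carrier (obj C n) \<Longrightarrow> g n v = v"
  shows "quasi_iso A C C g"
  unfolding quasi_iso_def
proof (intro conjI allI)
  fix n
  have "coh_map C n g u = u" if u: "u \<in> carrier (cohomology C n)" for u
  proof -
    obtain v where v: "v \<in> carrier (cycles C n)" "u = coh_class C n v"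
      by (rule cohomologyE[OF assms(1) u]) (rule that)
    then show ?thesis by (simp add: coh_map_class[OF assms(1,1,2)] assms(3))
  qed
  then show "bij_betw (coh_map C n g) (carrier (cohomology C n)) (carrier (cohomology C n))"
    using bij_betw_cong[of "carrier (cohomology C n)" "coh_map C n g" id] by simp
qed fact

definition from_degree_0 :: "('a, 'm) cplx \<Rightarrow> ('l \<Rightarrow> 'm) \<Rightarrow> int \<Rightarrow> 'l \<Rightarrow> 'm" where
  "from_degree_0 C t = (\<lambda>n v. if n = 0 then t v else \<zero>\<^bsub>obj C n\<^esub>)"

lemma from_degree_0_chain_map:
  assumes "module A M" "is_complex A C" "t \<in> mod_hom A M (cycles C 0)"
  shows "chain_map A (concentrated M) C (from_degree_0 C t)"
  unfolding chain_map_def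
proof (intro allI conjI ballI)
  fix n
  have t: "t v \<in> carrier (obj C 0)" "diff C 0 (t v) = \<zero>\<^bsub>obj C 1\<^esub>" if "v \<in> carrier M" for v
    using mod_hom_closed[OF assms(3) that] by simp_all
  have t0: "t \<zero>\<^bsub>M\<^esub> = \<zero>\<^bsub>obj C 0\<^esub>"
    using mod_hom_zero[OF assms(1) cycles_module[OF assms(2)] assms(3)] by simp
  interpret C: module A "obj C n" for n by (rule complex_module[OF assms(2)])
  interpret M: module A M by fact
  show "from_degree_0 C t n \<in> mod_hom A (obj (concentrated M) n) (obj C n)"
    using assms(3) by (auto simp: from_degree_0_def mod_hom_def)
  show "diff C n (from_degree_0 C t n v) = from_degree_0 C t (n + 1) (diff (concentrated M) n v)"
    if "v \<in> carrier (obj (concentrated M) n)" for v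
    using that t t0 complex_diff_zero[OF assms(2), of n] by (auto simp: from_degree_0_def split: if_splits)
qed

text \<open>
  The difference of two chain maps that agree on cohomology takes values in the boundaries, so it lifts
  along the differential, and the lift is a homotopy.
\<close>

lemma homotopic_from_projective:
  assumes "projective_module A F" "is_complex A X"
    and g: "chain_map A (concentrated F) X g" and g': "chain_map A (concentrated F) X g'"
    and eq: "\<And>z. z \<in> carrier F \<Longrightarrow> coh_class X 0 (g 0 z) = coh_class X 0 (g' 0 z)"
  shows "homotopic A (concentrated F) X g g'"
proof -
  have F: "module A F" using assms(1) by (simp add: projective_module_def)
  have CF: "is_complex A (concentrated F)" by (rule concentrated_is_complex[OF F])
  interpret X: module A "obj X n" for n by (rule complex_module[OF assms(2)])
  interpret F: module A F by fact
  have gF: "g 0 \<in> mod_hom A F (obj X 0)" "g' 0 \<in> mod_hom A F (obj X 0)"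
    using chain_map_mod_hom[OF g, of 0] chain_map_mod_hom[OF g', of 0] by (simp_all add: concentrated_def)
  have "g 0 z \<ominus>\<^bsub>obj X 0\<^esub> g' 0 z \<in> diff X (-1) ` carrier (obj X (-1))" if z: "z \<in> carrier F" for z
  proof -
    have "g 0 z \<in> carrier (cycles X 0)" "g' 0 z \<in> carrier (cycles X 0)"
      using z by (auto intro!: chain_map_cycle[OF CF assms(2)] g g' simp del: cycles_simps simp add: cycles_simps[of "concentrated F"])
    from eq[OF z, unfolded coh_class_eq_iff[OF assms(2) this]]
    obtain y where y: "y \<in> carrier (obj X (-1))" "g 0 z = diff X (-1) y \<oplus>\<^bsub>obj X 0\<^esub> g' 0 z"
      by auto
    then have "g 0 z \<ominus>\<^bsub>obj X 0\<^esub> g' 0 z = diff X (-1) y"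
      using mod_hom_closed[OF complex_diff'[OF assms(2)], of y 0] mod_hom_closed[OF gF(1) z]
        mod_hom_closed[OF gF(2) z]
      by (simp add: module_minus_eq_iff[OF X.module_axioms])
    then show ?thesis using y(1) by auto
  qed
  moreover have "diff X (-1) \<in> mod_hom A (obj X (-1)) (obj X 0)"
    using complex_diff'[OF assms(2), of 0] by simp
  ultimately obtain k where k: "k \<in> mod_hom A F (obj X (-1))"
    "\<forall>z\<in>carrier F. diff X (-1) (k z) = g 0 z \<ominus>\<^bsub>obj X 0\<^esub> g' 0 z"
    using projective_lift_image[OF assms(1) X.module_axioms X.module_axioms _
        mod_hom_minus_fun[OF X.module_axioms gF]] by meson
  define h where "h = (\<lambda>n v. if n = 0 then k v else \<zero>\<^bsub>obj X (n - 1)\<^esub>)"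
  have k0: "k \<zero>\<^bsub>F\<^esub> = \<zero>\<^bsub>obj X (-1)\<^esub>" by (rule mod_hom_zero[OF F X.module_axioms k(1)])
  show ?thesis
  proof (rule homotopicI[OF CF assms(2) g g', of h])
    fix n
    show "h n \<in> mod_hom A (obj (concentrated F) n) (obj X (n - 1))"
      using k(1) by (auto simp: h_def mod_hom_def)
    fix v assume v: "v \<in> carrier (obj (concentrated F) n)"
    have hd: "h (n + 1) (diff (concentrated F) n v) = \<zero>\<^bsub>obj X n\<^esub>"
      using k0 by (cases "n = -1") (auto simp: h_def)
    show "g n v = (diff X (n - 1) (h n v) \<oplus>\<^bsub>obj X n\<^esub> h (n + 1) (diff (concentrated F) n v))
      \<oplus>\<^bsub>obj X n\<^esub> g' n v"
    proof (cases "n = 0")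
      case True
      with v have z: "v \<in> carrier F" by simp
      have cl: "diff X (-1) (k v) \<in> carrier (obj X 0)"
        using mod_hom_closed[OF complex_diff'[OF assms(2), of 0]] mod_hom_closed[OF k(1) z] by simp
      then have "g 0 v = diff X (-1) (k v) \<oplus>\<^bsub>obj X 0\<^esub> g' 0 v"
        using k(2) z mod_hom_closed[OF gF(1) z] mod_hom_closed[OF gF(2) z]
        by (subst module_minus_eq_iff[OF X.module_axioms, symmetric]) auto
      then show ?thesis using True cl unfolding hd by (simp add: h_def)
    next
      case False
      then have "v = \<zero>\<^bsub>obj (concentrated F) n\<^esub>" using v by simp
      then have "g n v = \<zero>\<^bsub>obj X n\<^esub>" "g' n v = \<zero>\<^bsub>obj X n\<^esub>"
        using chain_map_zero[OF CF assms(2) g, of n] chain_map_zero[OF CF assms(2) g', of n]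
        by (simp_all del: concentrated_simps)
      then show ?thesis
        using False complex_diff_zero[OF assms(2), of "n - 1"] unfolding hd by (simp add: h_def)
    qed
  qed
qed

text \<open>
  The inverse of the isomorphism on cohomology is avoided by evaluating at classes of the form
  \<open>s \<zeta>\<close>; since \<open>s\<close> is a quasi-isomorphism, these are all classes.
\<close>

lemma roof_coh_eq:
  assumes "is_complex A C" "is_complex A X" "(Z, s, g) \<in> roofs A C X" "\<zeta> \<in> carrier (cycles Z n)"
  shows "roof_coh C X n (Z, s, g) (coh_class C n (s n \<zeta>)) = coh_class X n (g n \<zeta>)"
proof -
  have Z: "is_complex A Z" and s: "quasi_iso A Z C s" and g: "chain_map A Z X g"
    using assms(3) by (auto simp: roofs_def)
  have "inj_on (coh_map C n s) (carrier (cohomology Z n))"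
    using s by (simp add: quasi_iso_def bij_betw_def)
  then have "inv_into (carrier (cohomology Z n)) (coh_map C n s) (coh_class C n (s n \<zeta>)) = coh_class Z n \<zeta>"
    using coh_class_closed[OF Z assms(4)] coh_map_class[OF Z assms(1) quasi_iso_chain_map[OF s] assms(4)]
    by (metis inv_into_f_f)
  then show ?thesis by (simp add: roof_coh_def coh_map_class[OF Z assms(2) g assms(4)])
qed

definition roof_H0 :: "('a, 'm) module \<Rightarrow> ('a, 'm) cplx \<Rightarrow> ('a, 'm) roof \<Rightarrow> 'm \<Rightarrow> 'm set" where
  "roof_H0 F X r = (\<lambda>z\<in>carrier F. roof_coh (concentrated F) X 0 r (coh_class (concentrated F) 0 z))"

lemma roof_H0_eq:
  assumes "module A F" "is_complex A X" "(Z, s, g) \<in> roofs A (concentrated F) X"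
    and "\<zeta> \<in> carrier (cycles Z 0)" "s 0 \<zeta> = z" "z \<in> carrier F"
  shows "roof_H0 F X (Z, s, g) z = coh_class X 0 (g 0 \<zeta>)"
  using roof_coh_eq[OF concentrated_is_complex[OF assms(1)] assms(2,3,4)] assms(5,6)
  by (simp add: roof_H0_def)

text \<open>
  The backward leg is onto on cycles of degree \<open>0\<close> because it is onto on \<open>H\<^sup>0\<close> and the target has no
  boundaries; projectivity then splits it.
\<close>

lemma roof_section:
  assumes "projective_module A F" "(Z, s, g) \<in> roofs A (concentrated F) X"
  shows "\<exists>t\<in>mod_hom A F (cycles Z 0). \<forall>z\<in>carrier F. s 0 (t z) = z"
proof -
  have F: "module A F" using assms(1) by (simp add: projective_module_def)
  have Z: "is_complex A Z" and s: "quasi_iso A Z (concentrated F) s"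
    using assms(2) by (auto simp: roofs_def)
  have "s 0 \<in> mod_hom A (obj Z 0) F"
    using chain_map_mod_hom[OF quasi_iso_chain_map[OF s], of 0] by (simp add: concentrated_def)
  then have s0: "s 0 \<in> mod_hom A (cycles Z 0) F" by (auto simp: mod_hom_def)
  have "s 0 ` carrier (cycles Z 0) = carrier F"
  proof
    show "s 0 ` carrier (cycles Z 0) \<subseteq> carrier F" using mod_hom_closed[OF s0] by auto
    show "carrier F \<subseteq> s 0 ` carrier (cycles Z 0)"
    proof
      fix z assume "z \<in> carrier F"
      from quasi_iso_onto_concentrated[OF Z F s this] show "z \<in> s 0 ` carrier (cycles Z 0)"
        by (metis imageI)
    qed
  qed
  from projective_lift[OF assms(1) cycles_module[OF Z] F s0 this mod_hom_id]
  show ?thesis .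
qed

lemma roof_H0_section:
  assumes "projective_module A F" "is_complex A X" "(Z, s, g) \<in> roofs A (concentrated F) X"
    and "t \<in> mod_hom A F (cycles Z 0)" "\<forall>z\<in>carrier F. s 0 (t z) = z" "z \<in> carrier F"
  shows "roof_H0 F X (Z, s, g) z = coh_class X 0 (g 0 (t z))"
  using assms mod_hom_closed[OF assms(4,6)]
  by (intro roof_H0_eq[of A]) (simp_all add: projective_module_def)

lemma roof_H0_mod_hom:
  assumes "projective_module A F" "is_complex A X" "r \<in> roofs A (concentrated F) X"
  shows "roof_H0 F X r \<in> carrier (hom_module A F (cohomology X 0))"
proof -
  obtain Z s g where r: "r = (Z, s, g)" by (cases r)
  have F: "module A F" using assms(1) by (simp add: projective_module_def)
  have roof: "(Z, s, g) \<in> roofs A (concentrated F) X" using assms(3) r by simp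
  then have Z: "is_complex A Z" and g: "chain_map A Z X g" by (auto simp: roofs_def)
  obtain t where t: "t \<in> mod_hom A F (cycles Z 0)" "\<forall>z\<in>carrier F. s 0 (t z) = z"
    by (rule bexE[OF roof_section[OF assms(1) roof]]) (rule that)
  have g0: "g 0 \<in> mod_hom A (cycles Z 0) (cycles X 0)"
    using chain_map_mod_hom[OF g, of 0] chain_map_cycle[OF Z assms(2) g, of _ 0]
    by (auto simp: mod_hom_def)
  have "(\<lambda>z. coh_class X 0 (g 0 (t z))) \<in> mod_hom A F (cohomology X 0)"
    by (rule mod_hom_compose[OF mod_hom_compose[OF t(1) g0] coh_class_mod_hom[OF assms(2)]])
  then have "roof_H0 F X r \<in> mod_hom A F (cohomology X 0)"
    by (rule mod_hom_cong[OF F]) (simp add: r roof_H0_section[OF assms(1,2) roof t])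
  then show ?thesis by (simp add: roof_H0_def)
qed

lemma roof_of_hom:
  assumes "projective_module A F" "is_complex A X" "h \<in> carrier (hom_module A F (cohomology X 0))"
  obtains g where "(concentrated F, \<lambda>n v. v, g) \<in> roofs A (concentrated F) X"
    and "roof_H0 F X (concentrated F, \<lambda>n v. v, g) = h"
proof -
  have F: "module A F" using assms(1) by (simp add: projective_module_def)
  have CF: "is_complex A (concentrated F)" by (rule concentrated_is_complex[OF F])
  have h: "h \<in> mod_hom A F (cohomology X 0)" "h \<in> extensional (carrier F)" using assms(3) by auto
  from projective_lift[OF assms(1) cycles_module[OF assms(2)] cohomology_module[OF assms(2)]
      coh_class_mod_hom[OF assms(2)] carrier_cohomology[OF assms(2), symmetric] h(1)]
  obtain k where k: "k \<in> mod_hom A F (cycles X 0)" "\<forall>z\<in>carrier F. coh_class X 0 (k z) = h z"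
    by (rule bexE) (rule that)
  let ?r = "(concentrated F, \<lambda>n v. v, from_degree_0 X k)"
  have r: "?r \<in> roofs A (concentrated F) X"
    using CF quasi_iso_of_identity[OF CF chain_map_id] from_degree_0_chain_map[OF F assms(2) k(1)]
    by (simp add: roofs_def)
  moreover have "roof_H0 F X ?r z = h z" if "z \<in> carrier F" for z
    using roof_H0_eq[OF F assms(2) r, of z z] that k(2) by (simp add: from_degree_0_def)
  then have "roof_H0 F X ?r = h"
    using h(2) by (auto simp: roof_H0_def fun_eq_iff extensional_def)
  ultimately show thesis by (rule that)
qed

text \<open>
  Sections of the two backward legs make \<open>F\<close> itself a common denominator, over which the fractions become
  chain maps from \<open>F\<close> to \<open>X\<close>; these are homotopic if they agree on \<open>H\<^sup>0\<close>. Conversely, the class of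
  \<open>z \<in> F\<close> is lifted to a cycle of the common denominator \<open>Y\<close> and pushed to \<open>X\<close> along both paths.
\<close>

lemma roof_rel_iff:
  assumes "projective_module A F" "is_complex A X"
  shows "(r, r') \<in> roof_rel A (concentrated F) X \<longleftrightarrow>
    r \<in> roofs A (concentrated F) X \<and> r' \<in> roofs A (concentrated F) X \<and> roof_H0 F X r = roof_H0 F X r'"
proof -
  let ?C = "concentrated F"
  have F: "module A F" using assms(1) by (simp add: projective_module_def)
  have CF: "is_complex A ?C" by (rule concentrated_is_complex[OF F])
  obtain Z s g Z' s' g' where r: "r = (Z, s, g)" "r' = (Z', s', g')" by (cases r, cases r')
  show ?thesis
  proof (cases "r \<in> roofs A ?C X \<and> r' \<in> roofs A ?C X")
    case False
    then show ?thesis by (auto simp: roof_rel_def)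
  next
    case True
    then have R: "(Z, s, g) \<in> roofs A ?C X" "(Z', s', g') \<in> roofs A ?C X" using r by auto
    then have Z: "is_complex A Z" "is_complex A Z'" and s: "quasi_iso A Z ?C s" "quasi_iso A Z' ?C s'"
      and g: "chain_map A Z X g" "chain_map A Z' X g'" by (auto simp: roofs_def)
    note s' = quasi_iso_chain_map[OF s(1)] quasi_iso_chain_map[OF s(2)]
    show ?thesis
    proof
      assume "(r, r') \<in> roof_rel A ?C X"
      then obtain Y :: "('a, 'c) cplx" and u u' where Y: "is_complex A Y"
        and u: "chain_map A Y Z u" "chain_map A Y Z' u'"
        and su: "quasi_iso A Y ?C (\<lambda>n v. s n (u n v))"
        and hs: "homotopic A Y ?C (\<lambda>n v. s n (u n v)) (\<lambda>n v. s' n (u' n v))"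
        and hg: "homotopic A Y X (\<lambda>n v. g n (u n v)) (\<lambda>n v. g' n (u' n v))"
        using r by (auto simp: roof_rel_def)
      have "roof_H0 F X r z = roof_H0 F X r' z" if z: "z \<in> carrier F" for z
      proof -
        obtain y where y: "y \<in> carrier (cycles Y 0)" "s 0 (u 0 y) = z"
          by (rule bexE[OF quasi_iso_onto_concentrated[OF Y F su z]]) (rule that)
        have "coh_class ?C 0 (s 0 (u 0 y)) = coh_class ?C 0 (s' 0 (u' 0 y))"
          by (rule homotopic_coh_class[OF Y CF chain_map_compose[OF u(1) s'(1)]
              chain_map_compose[OF u(2) s'(2)] hs y(1)])
        moreover have "s' 0 (u' 0 y) \<in> carrier F"
          using chain_map_closed[OF chain_map_compose[OF u(2) s'(2)], of y 0] y(1) by simp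
        ultimately have y': "s' 0 (u' 0 y) = z"
          using y(2) z by (simp add: coh_class_concentrated[OF F])
        have "coh_class X 0 (g 0 (u 0 y)) = coh_class X 0 (g' 0 (u' 0 y))"
          by (rule homotopic_coh_class[OF Y assms(2) chain_map_compose[OF u(1) g(1)]
              chain_map_compose[OF u(2) g(2)] hg y(1)])
        then show ?thesis
          using roof_H0_eq[OF F assms(2) R(1) chain_map_cycle[OF Y Z(1) u(1) y(1)] y(2) z]
            roof_H0_eq[OF F assms(2) R(2) chain_map_cycle[OF Y Z(2) u(2) y(1)] y' z] r by simp
      qed
      then have "roof_H0 F X r = roof_H0 F X r'" by (auto simp: roof_H0_def fun_eq_iff)
      with True show "r \<in> roofs A ?C X \<and> r' \<in> roofs A ?C X \<and> roof_H0 F X r = roof_H0 F X r'" by simp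
    next
      assume eq: "r \<in> roofs A ?C X \<and> r' \<in> roofs A ?C X \<and> roof_H0 F X r = roof_H0 F X r'"
      obtain t where t: "t \<in> mod_hom A F (cycles Z 0)" "\<forall>z\<in>carrier F. s 0 (t z) = z"
        by (rule bexE[OF roof_section[OF assms(1) R(1)]]) (rule that)
      obtain t' where t': "t' \<in> mod_hom A F (cycles Z' 0)" "\<forall>z\<in>carrier F. s' 0 (t' z) = z"
        by (rule bexE[OF roof_section[OF assms(1) R(2)]]) (rule that)
      define u where "u = from_degree_0 Z t"
      define u' where "u' = from_degree_0 Z' t'"
      have u: "chain_map A ?C Z u" "chain_map A ?C Z' u'"
        unfolding u_def u'_def by (rule from_degree_0_chain_map[OF F Z(1) t(1)],
          rule from_degree_0_chain_map[OF F Z(2) t'(1)])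
      have su: "s n (u n v) = v" "s' n (u' n v) = v" if "v \<in> carrier (obj ?C n)" for n v
        using that t(2) t'(2) chain_map_zero[OF Z(1) CF s'(1), of n] chain_map_zero[OF Z(2) CF s'(2), of n]
        by (auto simp: u_def u'_def from_degree_0_def split: if_splits)
      have 1: "quasi_iso A ?C ?C (\<lambda>n v. s n (u n v))"
        by (rule quasi_iso_of_identity[OF CF chain_map_compose[OF u(1) s'(1)] su(1)])
      have 2: "homotopic A ?C ?C (\<lambda>n v. s n (u n v)) (\<lambda>n v. s' n (u' n v))"
        by (rule homotopic_of_eq[OF CF CF chain_map_compose[OF u(1) s'(1)]
            chain_map_compose[OF u(2) s'(2)]]) (simp add: su del: concentrated_simps)
      have 3: "homotopic A ?C X (\<lambda>n v. g n (u n v)) (\<lambda>n v. g' n (u' n v))"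
      proof (rule homotopic_from_projective[OF assms chain_map_compose[OF u(1) g(1)]
              chain_map_compose[OF u(2) g(2)]])
        fix z assume z: "z \<in> carrier F"
        show "coh_class X 0 (g 0 (u 0 z)) = coh_class X 0 (g' 0 (u' 0 z))"
          using roof_H0_section[OF assms R(1) t z] roof_H0_section[OF assms R(2) t' z] eq r
          by (simp add: u_def u'_def from_degree_0_def)
      qed
      have "\<exists>(Y :: ('a, 'c) cplx) u u'.
        is_complex A Y \<and> chain_map A Y Z u \<and> chain_map A Y Z' u' \<and>
        quasi_iso A Y ?C (\<lambda>n v. s n (u n v)) \<and>
        homotopic A Y ?C (\<lambda>n v. s n (u n v)) (\<lambda>n v. s' n (u' n v)) \<and>
        homotopic A Y X (\<lambda>n v. g n (u n v)) (\<lambda>n v. g' n (u' n v))"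
        by (intro exI[of _ ?C] exI[of _ u] exI[of _ u'] conjI CF u 1 2 3)
      then show "(r, r') \<in> roof_rel A ?C X"
        using R r unfolding roof_rel_def by simp
    qed
  qed
qed

context
  fixes A :: "('a, 'r) ring_scheme" and F :: "('a, 'm) module" and X :: "('a, 'm) cplx"
  assumes F: "projective_module A F" and X: "is_complex A X"
begin

text \<open>
  A morphism of the derived category is a whole class of roofs. The classes are the fibres of
  \<open>roof_H0\<close>, and each fibre contains a roof whose backward leg is the identity of \<open>F\<close>; two such roofs
  have a common denominator, so the sum of two classes is never taken over the empty set.
\<close>

definition roofs_over :: "('m \<Rightarrow> 'm set) \<Rightarrow> ('a, 'm) roof set" where
  "roofs_over h = {r \<in> roofs A (concentrated F) X. roof_H0 F X r = h}"

lemma roof_rel_image: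
  "roof_rel A (concentrated F) X `` R =
    \<Union>((\<lambda>r. roofs_over (roof_H0 F X r)) ` (R \<inter> roofs A (concentrated F) X))"
  by (auto simp: roofs_over_def roof_rel_iff[OF F X])

lemma roofs_over_nonempty:
  assumes "h \<in> carrier (hom_module A F (cohomology X 0))"
  obtains g where "(concentrated F, \<lambda>n v. v, g) \<in> roofs_over h"
  by (rule roof_of_hom[OF F X assms]) (rule that, simp add: roofs_over_def)

lemma carrier_derived_hom:
  "carrier (derived_hom A (concentrated F) X) = roofs_over ` carrier (hom_module A F (cohomology X 0))"
proof -
  have "roofs A (concentrated F) X // roof_rel A (concentrated F) X =
      (\<lambda>r. roofs_over (roof_H0 F X r)) ` roofs A (concentrated F) X"
    unfolding quotient_def roof_rel_image by auto
  also have "\<dots> = roofs_over ` roof_H0 F X ` roofs A (concentrated F) X" by (rule image_image[symmetric])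
  also have "roof_H0 F X ` roofs A (concentrated F) X = carrier (hom_module A F (cohomology X 0))"
  proof
    show "roof_H0 F X ` roofs A (concentrated F) X \<subseteq> carrier (hom_module A F (cohomology X 0))"
      using roof_H0_mod_hom[OF F X] by auto
    show "carrier (hom_module A F (cohomology X 0)) \<subseteq> roof_H0 F X ` roofs A (concentrated F) X"
    proof
      fix h assume "h \<in> carrier (hom_module A F (cohomology X 0))"
      then obtain g where "(concentrated F, \<lambda>n v. v, g) \<in> roofs_over h" by (rule roofs_over_nonempty)
      then show "h \<in> roof_H0 F X ` roofs A (concentrated F) X" by (auto simp: roofs_over_def)
    qed
  qed
  finally show ?thesis by (simp add: derived_hom_def)
qed

lemma derived_H0_roofs_over:
  assumes "h \<in> carrier (hom_module A F (cohomology X 0))"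
  shows "derived_H0 F X (roofs_over h) = h"
proof -
  obtain g where "(concentrated F, \<lambda>n v. v, g) \<in> roofs_over h" by (rule roofs_over_nonempty[OF assms])
  then have "(SOME r. r \<in> roofs_over h) \<in> roofs_over h" by (rule someI)
  then show ?thesis by (simp add: roofs_over_def derived_H0_def derived_coh_def roof_H0_def)
qed

lemma roof_H0_add:
  assumes "(Z, s, g) \<in> roofs A (concentrated F) X" "(Z, s, g') \<in> roofs A (concentrated F) X"
  shows "(Z, s, \<lambda>n v. g n v \<oplus>\<^bsub>obj X n\<^esub> g' n v) \<in> roofs A (concentrated F) X"
    and "roof_H0 F X (Z, s, \<lambda>n v. g n v \<oplus>\<^bsub>obj X n\<^esub> g' n v) =
      roof_H0 F X (Z, s, g) \<oplus>\<^bsub>hom_module A F (cohomology X 0)\<^esub> roof_H0 F X (Z, s, g')"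
proof -
  have Z: "is_complex A Z" and g: "chain_map A Z X g" "chain_map A Z X g'"
    using assms by (auto simp: roofs_def)
  show sum: "(Z, s, \<lambda>n v. g n v \<oplus>\<^bsub>obj X n\<^esub> g' n v) \<in> roofs A (concentrated F) X"
    using assms chain_map_add[OF Z X g] by (simp add: roofs_def)
  obtain t where t: "t \<in> mod_hom A F (cycles Z 0)" "\<forall>z\<in>carrier F. s 0 (t z) = z"
    by (rule bexE[OF roof_section[OF F assms(1)]]) (rule that)
  have "roof_H0 F X (Z, s, \<lambda>n v. g n v \<oplus>\<^bsub>obj X n\<^esub> g' n v) z =
      roof_H0 F X (Z, s, g) z \<oplus>\<^bsub>cohomology X 0\<^esub> roof_H0 F X (Z, s, g') z" if z: "z \<in> carrier F" for z
    using coh_class_add[OF X chain_map_cycle[OF Z X g(1)] chain_map_cycle[OF Z X g(2)], of "t z" 0 "t z"]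
      mod_hom_closed[OF t(1) z]
    unfolding roof_H0_section[OF F X sum t z] roof_H0_section[OF F X assms(1) t z]
      roof_H0_section[OF F X assms(2) t z] by blast
  then show "roof_H0 F X (Z, s, \<lambda>n v. g n v \<oplus>\<^bsub>obj X n\<^esub> g' n v) =
      roof_H0 F X (Z, s, g) \<oplus>\<^bsub>hom_module A F (cohomology X 0)\<^esub> roof_H0 F X (Z, s, g')"
    by (auto simp: fun_eq_iff roof_H0_def)
qed

lemma roof_H0_smult:
  assumes "(Z, s, g) \<in> roofs A (concentrated F) X" "a \<in> carrier A"
  shows "(Z, s, \<lambda>n v. a \<odot>\<^bsub>obj X n\<^esub> g n v) \<in> roofs A (concentrated F) X"
    and "roof_H0 F X (Z, s, \<lambda>n v. a \<odot>\<^bsub>obj X n\<^esub> g n v) =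
      a \<odot>\<^bsub>hom_module A F (cohomology X 0)\<^esub> roof_H0 F X (Z, s, g)"
proof -
  have Z: "is_complex A Z" and g: "chain_map A Z X g"
    using assms by (auto simp: roofs_def)
  show prod: "(Z, s, \<lambda>n v. a \<odot>\<^bsub>obj X n\<^esub> g n v) \<in> roofs A (concentrated F) X"
    using assms chain_map_smult[OF Z X g assms(2)] by (simp add: roofs_def)
  obtain t where t: "t \<in> mod_hom A F (cycles Z 0)" "\<forall>z\<in>carrier F. s 0 (t z) = z"
    by (rule bexE[OF roof_section[OF F assms(1)]]) (rule that)
  have "roof_H0 F X (Z, s, \<lambda>n v. a \<odot>\<^bsub>obj X n\<^esub> g n v) z =
      a \<odot>\<^bsub>cohomology X 0\<^esub> roof_H0 F X (Z, s, g) z" if z: "z \<in> carrier F" for z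
    using coh_class_smult[OF X assms(2) chain_map_cycle[OF Z X g], of "t z" 0]
      mod_hom_closed[OF t(1) z]
    unfolding roof_H0_section[OF F X prod t z] roof_H0_section[OF F X assms(1) t z] by blast
  then show "roof_H0 F X (Z, s, \<lambda>n v. a \<odot>\<^bsub>obj X n\<^esub> g n v) =
      a \<odot>\<^bsub>hom_module A F (cohomology X 0)\<^esub> roof_H0 F X (Z, s, g)"
    by (auto simp: fun_eq_iff roof_H0_def)
qed

lemma derived_hom_add:
  assumes h: "h \<in> carrier (hom_module A F (cohomology X 0))"
    and k: "k \<in> carrier (hom_module A F (cohomology X 0))"
  shows "roofs_over h \<oplus>\<^bsub>derived_hom A (concentrated F) X\<^esub> roofs_over k =
    roofs_over (h \<oplus>\<^bsub>hom_module A F (cohomology X 0)\<^esub> k)"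
proof -
  let ?R = "{(Z, s, \<lambda>n v. g n v \<oplus>\<^bsub>obj X n\<^esub> g' n v) | Z s g g'.
    (Z, s, g) \<in> roofs_over h \<and> (Z, s, g') \<in> roofs_over k}"
  have R: "r \<in> roofs A (concentrated F) X \<and> roof_H0 F X r = h \<oplus>\<^bsub>hom_module A F (cohomology X 0)\<^esub> k"
    if "r \<in> ?R" for r
    using that roof_H0_add by (auto simp: roofs_over_def simp del: hom_module_simps)
  obtain g where g: "(concentrated F, \<lambda>n v. v, g) \<in> roofs_over h" by (rule roofs_over_nonempty[OF h])
  obtain g' where g': "(concentrated F, \<lambda>n v. v, g') \<in> roofs_over k" by (rule roofs_over_nonempty[OF k])
  obtain r where "r \<in> ?R" using g g' by blast
  then have "?R \<inter> roofs A (concentrated F) X \<noteq> {}" using R by blast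
  then have "\<Union>((\<lambda>r. roofs_over (roof_H0 F X r)) ` (?R \<inter> roofs A (concentrated F) X)) =
      roofs_over (h \<oplus>\<^bsub>hom_module A F (cohomology X 0)\<^esub> k)"
    by (rule SUP_eq_const) (rule arg_cong[OF conjunct2[OF R[OF IntD1]]])
  then show ?thesis unfolding derived_hom_def ring.simps roof_rel_image .
qed

lemma derived_hom_smult:
  assumes a: "a \<in> carrier A" and h: "h \<in> carrier (hom_module A F (cohomology X 0))"
  shows "a \<odot>\<^bsub>derived_hom A (concentrated F) X\<^esub> roofs_over h =
    roofs_over (a \<odot>\<^bsub>hom_module A F (cohomology X 0)\<^esub> h)"
proof -
  let ?R = "{(Z, s, \<lambda>n v. a \<odot>\<^bsub>obj X n\<^esub> g n v) | Z s g. (Z, s, g) \<in> roofs_over h}"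
  have R: "r \<in> roofs A (concentrated F) X \<and> roof_H0 F X r = a \<odot>\<^bsub>hom_module A F (cohomology X 0)\<^esub> h"
    if "r \<in> ?R" for r
    using that roof_H0_smult[OF _ a] by (auto simp: roofs_over_def simp del: hom_module_simps)
  obtain g where g: "(concentrated F, \<lambda>n v. v, g) \<in> roofs_over h" by (rule roofs_over_nonempty[OF h])
  obtain r where "r \<in> ?R" using g by blast
  then have "?R \<inter> roofs A (concentrated F) X \<noteq> {}" using R by blast
  then have "\<Union>((\<lambda>r. roofs_over (roof_H0 F X r)) ` (?R \<inter> roofs A (concentrated F) X)) =
      roofs_over (a \<odot>\<^bsub>hom_module A F (cohomology X 0)\<^esub> h)"
    by (rule SUP_eq_const) (rule arg_cong[OF conjunct2[OF R[OF IntD1]]])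
  then show ?thesis unfolding derived_hom_def module.simps roof_rel_image .
qed

lemma derived_H0_iso:
  "derived_H0 F X \<in> mod_iso A (derived_hom A (concentrated F) X) (hom_module A F (cohomology X 0))"
proof -
  let ?H = "hom_module A F (cohomology X 0)"
  have FM: "module A F" using F by (simp add: projective_module_def)
  interpret H: module A ?H by (rule hom_module_module[OF FM cohomology_module[OF X]])
  have "derived_H0 F X \<in> mod_hom A (derived_hom A (concentrated F) X) ?H"
    by (rule mod_homI)
      (auto simp: carrier_derived_hom derived_H0_roofs_over derived_hom_add derived_hom_smult
        simp del: hom_module_simps)
  moreover have "bij_betw (derived_H0 F X) (carrier (derived_hom A (concentrated F) X)) (carrier ?H)"
    unfolding carrier_derived_hom
    by (rule bij_betw_byWitness[where f' = roofs_over])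
      (auto simp: derived_H0_roofs_over simp del: hom_module_simps)
  ultimately show ?thesis by (simp add: mod_iso_def)
qed

lemma roof_of_derived_hom:
  assumes "h \<in> carrier (hom_module A F (cohomology X 0))"
    and "r \<in> inv_into (carrier (derived_hom A (concentrated F) X)) (derived_H0 F X) h"
  shows "r \<in> roofs A (concentrated F) X" "roof_H0 F X r = h"
proof -
  have "inj_on (derived_H0 F X) (carrier (derived_hom A (concentrated F) X))"
    using derived_H0_iso by (simp add: mod_iso_def bij_betw_def)
  moreover have "roofs_over h \<in> carrier (derived_hom A (concentrated F) X)"
    using assms(1) unfolding carrier_derived_hom by (rule imageI)
  ultimately have "inv_into (carrier (derived_hom A (concentrated F) X)) (derived_H0 F X) h = roofs_over h"
    using derived_H0_roofs_over[OF assms(1)] by (metis inv_into_f_f)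
  then show "r \<in> roofs A (concentrated F) X" "roof_H0 F X r = h"
    using assms(2) by (simp_all add: roofs_over_def)
qed

end

section \<open>Homotopies from complexes of projective modules\<close>

text \<open>
  The comparison theorem of homological algebra, with the homotopy constructed downwards from
  degree \<open>0\<close>. A partial homotopy \<open>k\<close> in degree \<open>n\<close> can be continued as soon as \<open>d k d = (g - g') d\<close>
  on degree \<open>n - 1\<close>; this condition mentions no earlier part, so it is the invariant of the recursion.
\<close>

lemma homotopic_from_projective_complex:
  assumes P: "is_complex A P" "\<And>n. projective_module A (obj P n)"
    and P_top: "\<And>n. n > 0 \<Longrightarrow> carrier (obj P n) = {\<zero>\<^bsub>obj P n\<^esub>}"
    and Y: "is_complex A Y"
    and exact: "\<And>n v. n < 0 \<Longrightarrow> v \<in> carrier (cycles Y n) \<Longrightarrow> v \<in> diff Y (n - 1) ` carrier (obj Y (n - 1))"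
    and g: "chain_map A P Y g" and g': "chain_map A P Y g'"
    and eq0: "\<And>v. v \<in> carrier (obj P 0) \<Longrightarrow> coh_class Y 0 (g 0 v) = coh_class Y 0 (g' 0 v)"
  shows "homotopic A P Y g g'"
proof -
  interpret Y: module A "obj Y n" for n by (rule complex_module[OF Y])
  interpret P: module A "obj P n" for n by (rule complex_module[OF P(1)])
  define e where "e = (\<lambda>n v. g n v \<ominus>\<^bsub>obj Y n\<^esub> g' n v)"
  have e: "e n \<in> mod_hom A (obj P n) (obj Y n)" for n
    unfolding e_def by (rule mod_hom_minus_fun[OF Y.module_axioms chain_map_mod_hom[OF g] chain_map_mod_hom[OF g']])
  have e_diff: "diff Y (n - 1) (e (n - 1) v) = e n (diff P (n - 1) v)" if "v \<in> carrier (obj P (n - 1))" for n v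
    unfolding e_def
    using that by (simp add: mod_hom_minus[OF Y.module_axioms Y.module_axioms complex_diff'[OF Y]]
        chain_map_closed[OF g] chain_map_closed[OF g'] chain_map_diff'[OF g] chain_map_diff'[OF g'])
  have e_eq: "g n v = w \<oplus>\<^bsub>obj Y n\<^esub> g' n v"
    if "v \<in> carrier (obj P n)" "w \<in> carrier (obj Y n)" "w = e n v" for n v w
    using that chain_map_closed[OF g that(1)] chain_map_closed[OF g' that(1)]
    by (subst module_minus_eq_iff[OF Y.module_axioms, symmetric]) (auto simp: e_def)
  have dP: "diff P (n - 1) v \<in> carrier (obj P n)" if "v \<in> carrier (obj P (n - 1))" for n v
    by (rule mod_hom_closed[OF complex_diff'[OF P(1)] that])
  define I where "I = (\<lambda>n k. k \<in> mod_hom A (obj P n) (obj Y (n - 1)) \<and>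
    (\<forall>v\<in>carrier (obj P (n - 1)). diff Y (n - 1) (k (diff P (n - 1) v)) = e n (diff P (n - 1) v)))"
  define S where "S = (\<lambda>n k k'. \<forall>v\<in>carrier (obj P (n - 1)).
    diff Y (n - 1 - 1) (k' v) = e (n - 1) v \<ominus>\<^bsub>obj Y (n - 1)\<^esub> k (diff P (n - 1) v))"
  have step: "\<exists>k'. I (n - 1) k' \<and> S n k k'" if n: "n \<le> 0" and k: "I n k" for n k
  proof -
    have k1: "k \<in> mod_hom A (obj P n) (obj Y (n - 1))"
      and k2: "\<And>v. v \<in> carrier (obj P (n - 1)) \<Longrightarrow>
        diff Y (n - 1) (k (diff P (n - 1) v)) = e n (diff P (n - 1) v)"
      using k by (auto simp: I_def)
    let ?f = "\<lambda>v. e (n - 1) v \<ominus>\<^bsub>obj Y (n - 1)\<^esub> k (diff P (n - 1) v)"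
    have f: "?f \<in> mod_hom A (obj P (n - 1)) (obj Y (n - 1))"
      by (rule mod_hom_minus_fun[OF Y.module_axioms e mod_hom_compose[OF complex_diff'[OF P(1)] k1]])
    have "?f v \<in> diff Y (n - 1 - 1) ` carrier (obj Y (n - 1 - 1))" if v: "v \<in> carrier (obj P (n - 1))" for v
    proof (rule exact)
      have cl: "e (n - 1) v \<in> carrier (obj Y (n - 1))" "k (diff P (n - 1) v) \<in> carrier (obj Y (n - 1))"
        using mod_hom_closed[OF e v] mod_hom_closed[OF k1 dP[OF v]] .
      have "diff Y (n - 1) (?f v) = e n (diff P (n - 1) v) \<ominus>\<^bsub>obj Y n\<^esub> e n (diff P (n - 1) v)"
        by (simp add: mod_hom_minus[OF Y.module_axioms Y.module_axioms complex_diff'[OF Y] cl]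
            k2[OF v] e_diff[OF v])
      also have "\<dots> = \<zero>\<^bsub>obj Y n\<^esub>"
        by (rule module_minus_self[OF Y.module_axioms mod_hom_closed[OF e dP[OF v]]])
      finally show "?f v \<in> carrier (cycles Y (n - 1))" using cl by simp
    qed (use n in simp)
    then have "\<exists>k'\<in>mod_hom A (obj P (n - 1)) (obj Y (n - 1 - 1)).
        \<forall>v\<in>carrier (obj P (n - 1)). diff Y (n - 1 - 1) (k' v) = ?f v"
      by (rule projective_lift_image[OF P(2) Y.module_axioms Y.module_axioms complex_diff'[OF Y] f])
    then obtain k' where k': "k' \<in> mod_hom A (obj P (n - 1)) (obj Y (n - 1 - 1))"
      "\<forall>v\<in>carrier (obj P (n - 1)). diff Y (n - 1 - 1) (k' v) = ?f v"
      by (rule bexE) (rule that)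
    have "diff Y (n - 1 - 1) (k' (diff P (n - 1 - 1) v)) = e (n - 1) (diff P (n - 1 - 1) v)"
      if v: "v \<in> carrier (obj P (n - 1 - 1))" for v
    proof -
      have "k (diff P (n - 1) (diff P (n - 1 - 1) v)) = \<zero>\<^bsub>obj Y (n - 1)\<^esub>"
        using mod_hom_zero[OF P.module_axioms Y.module_axioms k1] complex_diff_diff'[OF P(1) v] by simp
      then show ?thesis
        using k'(2) dP[OF v] mod_hom_closed[OF e dP[OF v]]
        by (simp add: a_minus_def module_neg_zero[OF Y.module_axioms])
    qed
    with k' show ?thesis by (auto simp: I_def S_def)
  qed
  have "e 0 v \<in> diff Y (0 - 1) ` carrier (obj Y (0 - 1))" if v: "v \<in> carrier (obj P 0)" for v
  proof -
    have "diff P 0 v = \<zero>\<^bsub>obj P (0 + 1)\<^esub>"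
      using mod_hom_closed[OF complex_diff[OF P(1)] v] P_top[of "0 + 1"] by simp
    then have c: "v \<in> carrier (cycles P 0)" using v by simp
    note gc = chain_map_cycle[OF P(1) Y g c] chain_map_cycle[OF P(1) Y g' c]
    from eq0[OF v, unfolded coh_class_eq_iff[OF Y gc]]
    obtain y where y: "y \<in> carrier (obj Y (0 - 1))" "g 0 v = diff Y (0 - 1) y \<oplus>\<^bsub>obj Y 0\<^esub> g' 0 v"
      by (rule bexE) (rule that)
    have "e 0 v = diff Y (0 - 1) y"
      using y gc mod_hom_closed[OF complex_diff'[OF Y] y(1)]
      unfolding e_def by (subst module_minus_eq_iff[OF Y.module_axioms]) auto
    with y(1) show ?thesis by (rule image_eqI[rotated])
  qed
  then have "\<exists>k0\<in>mod_hom A (obj P 0) (obj Y (0 - 1)).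
      \<forall>v\<in>carrier (obj P 0). diff Y (0 - 1) (k0 v) = e 0 v"
    by (rule projective_lift_image[OF P(2) Y.module_axioms Y.module_axioms complex_diff'[OF Y] e])
  then obtain k0 where k0: "k0 \<in> mod_hom A (obj P 0) (obj Y (0 - 1))"
    "\<forall>v\<in>carrier (obj P 0). diff Y (0 - 1) (k0 v) = e 0 v"
    by (rule bexE) (rule that)
  have I0: "I 0 k0" using k0 dP[of _ 0] by (simp add: I_def)
  have neg: "- int (Suc m) = - int m - 1" for m by simp
  \<comment> \<open>The invariant also records the start \<open>k0\<close>, whose relation to \<open>e 0\<close> is stronger than \<open>I\<close>.\<close>
  have "\<exists>f. \<forall>m. (I (- int m) (f m) \<and> (m = 0 \<longrightarrow> f m = k0)) \<and> S (- int m) (f m) (f (Suc m))"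
  proof (rule dependent_nat_choice)
    show "\<exists>k. I (- int 0) k \<and> (0 = (0::nat) \<longrightarrow> k = k0)" using I0 by auto
    show "\<exists>k'. (I (- int (Suc m)) k' \<and> (Suc m = 0 \<longrightarrow> k' = k0)) \<and> S (- int m) k k'"
      if "I (- int m) k \<and> (m = 0 \<longrightarrow> k = k0)" for k m
      using step[of "- int m" k] that unfolding neg by auto
  qed
  then obtain f where f: "\<And>m. I (- int m) (f m)" "f 0 = k0" "\<And>m. S (- int m) (f m) (f (Suc m))"
    by blast
  define h where "h = (\<lambda>n. if n \<le> 0 then f (nat (- n)) else (\<lambda>v. \<zero>\<^bsub>obj Y (n - 1)\<^esub>))"
  have h: "h n \<in> mod_hom A (obj P n) (obj Y (n - 1))" for n
    using f(1)[of "nat (- n)"] mod_hom_const_zero[OF Y.module_axioms]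
    by (cases "n \<le> 0") (simp_all add: h_def I_def)
  show ?thesis
  proof (rule homotopicI[OF P(1) Y g g' h])
    fix n v assume v: "v \<in> carrier (obj P n)"
    have dv: "diff P n v \<in> carrier (obj P (n + 1))" by (rule mod_hom_closed[OF complex_diff[OF P(1)] v])
    have cl: "diff Y (n - 1) (h n v) \<in> carrier (obj Y n)" "h (n + 1) (diff P n v) \<in> carrier (obj Y n)"
      using mod_hom_closed[OF complex_diff'[OF Y] mod_hom_closed[OF h v]] mod_hom_closed[OF h dv] by simp_all
    have ev: "e n v \<in> carrier (obj Y n)" by (rule mod_hom_closed[OF e v])
    have "diff Y (n - 1) (h n v) \<oplus>\<^bsub>obj Y n\<^esub> h (n + 1) (diff P n v) = e n v"
    proof (cases "n < 0")
      case True
      define m where "m = nat (- n - 1)"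
      have n: "n = - int m - 1" "nat (- n) = Suc m" "nat (- (n + 1)) = m" using True by (auto simp: m_def)
      have "S (n + 1) (h (n + 1)) (h n)"
        using f(3)[of m] True n by (simp add: h_def)
      then have "diff Y (n - 1) (h n v) = e n v \<ominus>\<^bsub>obj Y n\<^esub> h (n + 1) (diff P n v)"
        using v by (simp add: S_def)
      from this[symmetric] show ?thesis
        by (subst (asm) module_minus_eq_iff[OF Y.module_axioms ev cl(2,1)]) (rule sym)
    next
      case False
      then have "diff P n v = \<zero>\<^bsub>obj P (n + 1)\<^esub>" using P_top[of "n + 1"] dv by simp
      then have "h (n + 1) (diff P n v) = \<zero>\<^bsub>obj Y n\<^esub>" using False by (simp add: h_def)
      moreover have "diff Y (n - 1) (h n v) = e n v"
      proof (cases "n = 0")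
        case True
        then show ?thesis using k0(2) v f(2) by (simp add: h_def)
      next
        case n: False
        then have "v = \<zero>\<^bsub>obj P n\<^esub>" using False P_top[of n] v by simp
        then show ?thesis
          using n False mod_hom_zero[OF P.module_axioms Y.module_axioms e] complex_diff_zero[OF Y, of "n - 1"]
          by (simp add: h_def)
      qed
      ultimately show ?thesis using cl(1) by simp
    qed
    then show "g n v = (diff Y (n - 1) (h n v) \<oplus>\<^bsub>obj Y n\<^esub> h (n + 1) (diff P n v)) \<oplus>\<^bsub>obj Y n\<^esub> g' n v"
      by (rule e_eq[OF v Y.a_closed[OF cl]])
  qed
qed

section \<open>Derived homomorphisms out of the quotient ring\<close>

text \<open>
  A chain map from the two-term complex \<open>A \<rightarrow> A\<close> with differential \<open>x\<close>, in degrees \<open>-1\<close> and \<open>0\<close>, to \<open>Y\<close> is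
  given by the images \<open>a\<close> and \<open>b\<close> of the two generators, subject to the condition \<open>twisted_cycle\<close> below.
  The map \<open>comparison_map\<close> is its composite with a chain map from \<open>P\<close> to the two-term complex, whose
  components are \<open>c\<^sub>1\<close> and \<open>c\<^sub>0\<close>.
\<close>

definition comparison_map ::
  "('p \<Rightarrow> 'a) \<Rightarrow> ('p \<Rightarrow> 'a) \<Rightarrow> ('a, 'm) cplx \<Rightarrow> 'm \<Rightarrow> 'm \<Rightarrow> int \<Rightarrow> 'p \<Rightarrow> 'm" where
  "comparison_map c\<^sub>1 c\<^sub>0 Y a b = (\<lambda>n v.
     if n = -1 then c\<^sub>1 v \<odot>\<^bsub>obj Y (-1)\<^esub> a else if n = 0 then c\<^sub>0 v \<odot>\<^bsub>obj Y 0\<^esub> b else \<zero>\<^bsub>obj Y n\<^esub>)"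

definition twisted_cycle :: "('a, 'm) cplx \<Rightarrow> 'a \<Rightarrow> 'm \<Rightarrow> 'm \<Rightarrow> bool" where
  "twisted_cycle Y x a b \<longleftrightarrow> a \<in> carrier (obj Y (-1)) \<and> b \<in> carrier (cycles Y 0) \<and>
     diff Y (-1) a = x \<odot>\<^bsub>obj Y 0\<^esub> b"

locale two_term_map =
  fixes A :: "('a, 'r) ring_scheme" and x :: 'a and P :: "('a, 'p) cplx"
    and c\<^sub>1 c\<^sub>0 :: "'p \<Rightarrow> 'a"
  assumes A: "cring A" and x: "x \<in> carrier A" and P: "is_complex A P"
    and c0: "c\<^sub>0 \<in> mod_hom A (obj P 0) (regular_module A)"
    and c1: "c\<^sub>1 \<in> mod_hom A (obj P (-1)) (regular_module A)"
    and c_diff: "\<And>v. v \<in> carrier (obj P (-1)) \<Longrightarrow> c\<^sub>0 (diff P (-1) v) = x \<otimes>\<^bsub>A\<^esub> c\<^sub>1 v"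
    and c1_diff: "\<And>v. v \<in> carrier (obj P (-2)) \<Longrightarrow> c\<^sub>1 (diff P (-2) v) = \<zero>\<^bsub>A\<^esub>"
begin

lemma c_closed:
  "v \<in> carrier (obj P 0) \<Longrightarrow> c\<^sub>0 v \<in> carrier A" "v \<in> carrier (obj P (-1)) \<Longrightarrow> c\<^sub>1 v \<in> carrier A"
  using mod_hom_closed[OF c0] mod_hom_closed[OF c1] by auto

lemma comparison_map:
  assumes Y: "is_complex A Y" and ab: "twisted_cycle Y x a b"
  shows "chain_map A P Y (comparison_map c\<^sub>1 c\<^sub>0 Y a b)"
  unfolding chain_map_def
proof (intro allI conjI ballI)
  interpret A: cring A by (rule A)
  interpret Y: module A "obj Y n" for n by (rule complex_module[OF Y])
  have a: "a \<in> carrier (obj Y (-1))" and b: "b \<in> carrier (obj Y 0)" "diff Y 0 b = \<zero>\<^bsub>obj Y 1\<^esub>"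
    and d: "diff Y (-1) a = x \<odot>\<^bsub>obj Y 0\<^esub> b"
    using ab by (auto simp: twisted_cycle_def)
  fix n
  have sc: "(\<lambda>v. c v \<odot>\<^bsub>obj Y n\<^esub> w) \<in> mod_hom A (obj P n) (obj Y n)"
    if "c \<in> mod_hom A (obj P n) (regular_module A)" "w \<in> carrier (obj Y n)" for c w n
    using that by (auto simp: mod_hom_def Pi_iff Y.smult_l_distr Y.smult_assoc1)
  show "comparison_map c\<^sub>1 c\<^sub>0 Y a b n \<in> mod_hom A (obj P n) (obj Y n)"
    using sc[OF c1 a] sc[OF c0 b(1)] mod_hom_const_zero[OF Y.module_axioms]
    by (cases "n = -1"; cases "n = 0") (simp_all add: comparison_map_def)
  fix v assume v: "v \<in> carrier (obj P n)"
  show "diff Y n (comparison_map c\<^sub>1 c\<^sub>0 Y a b n v) = comparison_map c\<^sub>1 c\<^sub>0 Y a b (n + 1) (diff P n v)"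
  proof -
    consider "n = -1" | "n = 0" | "n = -2" | "n \<notin> {-2,-1,0}" by auto
    then show ?thesis
    proof cases
      case 1
      have cv: "c\<^sub>1 v \<in> carrier A" using mod_hom_closed[OF c1] v 1 by simp
      have "diff Y (-1) (c\<^sub>1 v \<odot>\<^bsub>obj Y (-1)\<^esub> a) = c\<^sub>1 v \<odot>\<^bsub>obj Y 0\<^esub> (x \<odot>\<^bsub>obj Y 0\<^esub> b)"
        using mod_hom_smult[OF complex_diff[OF Y, of "-1"] cv a] d by simp
      also have "\<dots> = c\<^sub>0 (diff P (-1) v) \<odot>\<^bsub>obj Y 0\<^esub> b"
        using cv b x v 1 by (simp add: c_diff Y.smult_assoc1[symmetric] A.m_comm)
      finally show ?thesis using 1 by (simp add: comparison_map_def)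
    next
      case 2
      have cv: "c\<^sub>0 v \<in> carrier A" using mod_hom_closed[OF c0] v 2 by simp
      then have "diff Y 0 (c\<^sub>0 v \<odot>\<^bsub>obj Y 0\<^esub> b) = \<zero>\<^bsub>obj Y 1\<^esub>"
        using mod_hom_smult[OF complex_diff[OF Y, of 0] cv b(1)] b(2) by simp
      then show ?thesis using 2 by (simp add: comparison_map_def)
    next
      case 3
      then show ?thesis
        using c1_diff[of v] v a complex_diff_zero[OF Y, of "-2"] by (simp add: comparison_map_def)
    next
      case 4
      then show ?thesis using complex_diff_zero[OF Y, of n] by (auto simp: comparison_map_def)
    qed
  qed
qed

end

text \<open>
  A chain map \<open>(p\<^sub>1, p\<^sub>0)\<close> back from the two-term complex to \<open>P\<close>, such that the composite on \<open>P\<close> is homotopic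
  to the identity. The other composite is multiplication by \<open>c\<^sub>0 p\<^sub>0 = c\<^sub>1 p\<^sub>1\<close>, which is \<open>1\<close> modulo \<open>x\<close>
  and hence homotopic to the identity as well.
\<close>

locale two_term_retraction = two_term_map A x P c\<^sub>1 c\<^sub>0
  for A :: "('a, 'r) ring_scheme" and x :: 'a and P :: "('a, 'p) cplx"
    and c\<^sub>1 c\<^sub>0 :: "'p \<Rightarrow> 'a" +
  fixes p\<^sub>1 p\<^sub>0 :: 'p
  assumes p: "twisted_cycle P x p\<^sub>1 p\<^sub>0"
    and c0_p0: "\<exists>t\<in>carrier A. c\<^sub>0 p\<^sub>0 = x \<otimes>\<^bsub>A\<^esub> t \<oplus>\<^bsub>A\<^esub> \<one>\<^bsub>A\<^esub>"
    and c1_p1: "c\<^sub>1 p\<^sub>1 = c\<^sub>0 p\<^sub>0"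
    and retraction: "homotopic A P P (comparison_map c\<^sub>1 c\<^sub>0 P p\<^sub>1 p\<^sub>0) (\<lambda>n v. v)"
begin

lemma p_closed:
  "p\<^sub>1 \<in> carrier (obj P (-1))" "p\<^sub>0 \<in> carrier (obj P 0)" "p\<^sub>0 \<in> carrier (cycles P 0)"
  "diff P (-1) p\<^sub>1 = x \<odot>\<^bsub>obj P 0\<^esub> p\<^sub>0"
  using p by (auto simp: twisted_cycle_def)

end

locale retraction_target = two_term_retraction A x P c\<^sub>1 c\<^sub>0 p\<^sub>1 p\<^sub>0
  for A :: "('a, 'r) ring_scheme" and x :: 'a and P :: "('a, 'p) cplx"
    and c\<^sub>1 c\<^sub>0 :: "'p \<Rightarrow> 'a" and p\<^sub>1 p\<^sub>0 :: 'p +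
  fixes X :: "('a, 'm) cplx"
  assumes X: "is_complex A X"
begin

sublocale A: cring A by (rule A)
sublocale X: module A "obj X n" for n by (rule complex_module[OF X])

abbreviation W :: "('a, (int \<Rightarrow> 'p \<Rightarrow> 'm) set) module" where
  "W \<equiv> cohomology (hom_complex A P X) 0"

definition twisted_class :: "'m \<Rightarrow> 'm \<Rightarrow> (int \<Rightarrow> 'p \<Rightarrow> 'm) set" where
  "twisted_class a b = hom_class A P X (comparison_map c\<^sub>1 c\<^sub>0 X a b)"

lemma W_module: "module A W"
  by (rule cohomology_module[OF hom_complex_is_complex[OF A P X]])

lemma twisted_class_closed: "twisted_cycle X x a b \<Longrightarrow> twisted_class a b \<in> carrier W"
  unfolding twisted_class_def by (rule hom_class_closed[OF A P X comparison_map[OF X]])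

lemma twisted_cycleD:
  assumes "twisted_cycle X x a b"
  shows "a \<in> carrier (obj X (-1))" "b \<in> carrier (obj X 0)" "b \<in> carrier (cycles X 0)"
    "diff X (-1) a = x \<odot>\<^bsub>obj X 0\<^esub> b"
  using assms by (auto simp: twisted_cycle_def)

lemma diff_mod_hom: "diff X (-1) \<in> mod_hom A (obj X (-1)) (obj X 0)" "diff X (-2) \<in> mod_hom A (obj X (-2)) (obj X (-1))"
  using complex_diff'[OF X, of 0] complex_diff'[OF X, of "-1"] by simp_all

text \<open>
  Composing \<open>g\<close> with the retraction does not change its homotopy class, and the composite is
  determined by the values of \<open>g\<close> at \<open>p\<^sub>1\<close> and \<open>p\<^sub>0\<close>.
\<close>

lemma hom_class_eq_twisted_class:
  assumes g: "chain_map A P X g"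
  shows "twisted_cycle X x (g (-1) p\<^sub>1) (g 0 p\<^sub>0)" "hom_class A P X g = twisted_class (g (-1) p\<^sub>1) (g 0 p\<^sub>0)"
proof -
  have "diff X (-1) (g (-1) p\<^sub>1) = x \<odot>\<^bsub>obj X 0\<^esub> g 0 p\<^sub>0"
    using chain_map_diff[OF g p_closed(1)] mod_hom_smult[OF chain_map_mod_hom[OF g] x p_closed(2)]
    by (simp add: p_closed(4))
  then show tw: "twisted_cycle X x (g (-1) p\<^sub>1) (g 0 p\<^sub>0)"
    using chain_map_closed[OF g p_closed(1)] chain_map_cycle[OF P X g p_closed(3)]
    by (simp add: twisted_cycle_def)
  have "comparison_map c\<^sub>1 c\<^sub>0 X (g (-1) p\<^sub>1) (g 0 p\<^sub>0) n v = g n (comparison_map c\<^sub>1 c\<^sub>0 P p\<^sub>1 p\<^sub>0 n v)"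
    if "v \<in> carrier (obj P n)" for n v
    using that c_closed p_closed chain_map_zero[OF P X g]
    by (auto simp: comparison_map_def mod_hom_smult[OF chain_map_mod_hom[OF g]])
  from hom_class_cong[OF this, where A = A and X = X]
  have "twisted_class (g (-1) p\<^sub>1) (g 0 p\<^sub>0) = hom_class A P X (\<lambda>n v. g n (comparison_map c\<^sub>1 c\<^sub>0 P p\<^sub>1 p\<^sub>0 n v))"
    unfolding twisted_class_def .
  also have "\<dots> = hom_class A P X g"
    by (subst hom_class_eq_iff[OF A P X chain_map_compose[OF comparison_map[OF P p] g] g])
      (rule homotopic_compose_left[OF P P X comparison_map[OF P p] chain_map_id g retraction])
  finally show "hom_class A P X g = twisted_class (g (-1) p\<^sub>1) (g 0 p\<^sub>0)" by simp
qed

lemma twisted_classE: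
  assumes "w \<in> carrier W"
  obtains a b where "twisted_cycle X x a b" "w = twisted_class a b"
proof -
  obtain g where "chain_map A P X g" "w = hom_class A P X g"
    by (rule hom_classE[OF A P X assms]) (rule that)
  then show thesis using hom_class_eq_twisted_class by (intro that) simp_all
qed

lemma twisted_class_add:
  assumes "twisted_cycle X x a b" "twisted_cycle X x a' b'"
  shows "twisted_class (a \<oplus>\<^bsub>obj X (-1)\<^esub> a') (b \<oplus>\<^bsub>obj X 0\<^esub> b') = twisted_class a b \<oplus>\<^bsub>W\<^esub> twisted_class a' b'"
proof -
  note D = twisted_cycleD[OF assms(1)] twisted_cycleD[OF assms(2)]
  have "twisted_class (a \<oplus>\<^bsub>obj X (-1)\<^esub> a') (b \<oplus>\<^bsub>obj X 0\<^esub> b') =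
      hom_class A P X (\<lambda>n v. comparison_map c\<^sub>1 c\<^sub>0 X a b n v \<oplus>\<^bsub>obj X n\<^esub> comparison_map c\<^sub>1 c\<^sub>0 X a' b' n v)"
    unfolding twisted_class_def
    by (rule hom_class_cong) (auto simp: comparison_map_def X.smult_r_distr c_closed D(1,2,5,6))
  also have "\<dots> = twisted_class a b \<oplus>\<^bsub>W\<^esub> twisted_class a' b'"
    unfolding twisted_class_def
    by (rule hom_class_add[OF A P X comparison_map[OF X assms(1)] comparison_map[OF X assms(2)]])
  finally show ?thesis .
qed

lemma twisted_class_smult:
  assumes "twisted_cycle X x a b" "r \<in> carrier A"
  shows "twisted_class (r \<odot>\<^bsub>obj X (-1)\<^esub> a) (r \<odot>\<^bsub>obj X 0\<^esub> b) = r \<odot>\<^bsub>W\<^esub> twisted_class a b"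
proof -
  note D = twisted_cycleD[OF assms(1)]
  have "twisted_class (r \<odot>\<^bsub>obj X (-1)\<^esub> a) (r \<odot>\<^bsub>obj X 0\<^esub> b) =
      hom_class A P X (\<lambda>n v. r \<odot>\<^bsub>obj X n\<^esub> comparison_map c\<^sub>1 c\<^sub>0 X a b n v)"
    unfolding twisted_class_def
    by (rule hom_class_cong)
      (auto simp: comparison_map_def X.smult_assoc1[symmetric] c_closed D(1,2) assms(2) A.m_comm)
  also have "\<dots> = r \<odot>\<^bsub>W\<^esub> twisted_class a b"
    unfolding twisted_class_def by (rule hom_class_smult[OF A P X comparison_map[OF X assms(1)] assms(2)])
  finally show ?thesis .
qed

text \<open>
  A null-homotopy on \<open>P\<close>, evaluated at \<open>p\<^sub>1\<close> and \<open>p\<^sub>0\<close>, shows that \<open>(1 + x t) a\<close> and \<open>(1 + x t) b\<close> have the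
  required form for some \<open>t\<close>. Because \<open>x b = d a\<close>, the pair \<open>(x t a, x t b)\<close> has that form too, with
  \<open>z = t a\<close> and \<open>y = 0\<close>, and it can be subtracted. Conversely \<open>y\<close> and \<open>z\<close> define a null-homotopy.
\<close>

lemma twisted_class_eq_zero_iff:
  assumes ab: "twisted_cycle X x a b"
  shows "twisted_class a b = \<zero>\<^bsub>W\<^esub> \<longleftrightarrow> (\<exists>y\<in>carrier (obj X (-2)). \<exists>z\<in>carrier (obj X (-1)).
    a = diff X (-2) y \<oplus>\<^bsub>obj X (-1)\<^esub> x \<odot>\<^bsub>obj X (-1)\<^esub> z \<and> b = diff X (-1) z)"
proof -
  note D = twisted_cycleD[OF ab]
  note g = comparison_map[OF X ab] and o = chain_map_const_zero[OF X, of P]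
  have "twisted_class a b = \<zero>\<^bsub>W\<^esub> \<longleftrightarrow> homotopic A P X (comparison_map c\<^sub>1 c\<^sub>0 X a b) (\<lambda>n v. \<zero>\<^bsub>obj X n\<^esub>)"
    unfolding twisted_class_def hom_class_zero[OF A P X, symmetric] by (rule hom_class_eq_iff[OF A P X g o])
  also have "\<dots> \<longleftrightarrow> (\<exists>y\<in>carrier (obj X (-2)). \<exists>z\<in>carrier (obj X (-1)).
    a = diff X (-2) y \<oplus>\<^bsub>obj X (-1)\<^esub> x \<odot>\<^bsub>obj X (-1)\<^esub> z \<and> b = diff X (-1) z)" (is "_ \<longleftrightarrow> ?R")
  proof
    assume "homotopic A P X (comparison_map c\<^sub>1 c\<^sub>0 X a b) (\<lambda>n v. \<zero>\<^bsub>obj X n\<^esub>)"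
    then obtain h where h: "\<And>n. h n \<in> mod_hom A (obj P n) (obj X (n - 1))"
      and eq: "\<And>n v. v \<in> carrier (obj P n) \<Longrightarrow> comparison_map c\<^sub>1 c\<^sub>0 X a b n v =
        (diff X (n - 1) (h n v) \<oplus>\<^bsub>obj X n\<^esub> h (n + 1) (diff P n v)) \<oplus>\<^bsub>obj X n\<^esub> \<zero>\<^bsub>obj X n\<^esub>"
      by (rule homotopicE[OF _ P X g o]) (rule that)
    obtain t where t: "t \<in> carrier A" "c\<^sub>0 p\<^sub>0 = x \<otimes>\<^bsub>A\<^esub> t \<oplus>\<^bsub>A\<^esub> \<one>\<^bsub>A\<^esub>"
      by (rule bexE[OF c0_p0]) (rule that)
    define y where "y = h (-1) p\<^sub>1"
    define z where "z = h 0 p\<^sub>0"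
    have y: "y \<in> carrier (obj X (-2))" and z: "z \<in> carrier (obj X (-1))"
      using mod_hom_closed[OF h p_closed(1)] mod_hom_closed[OF h p_closed(2)] by (simp_all add: y_def z_def)
    note dy = mod_hom_closed[OF diff_mod_hom(2) y] and dz = mod_hom_closed[OF diff_mod_hom(1) z]
    have "h 1 \<zero>\<^bsub>obj P 1\<^esub> = \<zero>\<^bsub>obj X 0\<^esub>"
      using mod_hom_zero[OF complex_module[OF P] X.module_axioms h, of 1] by simp
    then have b_eq: "(x \<otimes>\<^bsub>A\<^esub> t \<oplus>\<^bsub>A\<^esub> \<one>\<^bsub>A\<^esub>) \<odot>\<^bsub>obj X 0\<^esub> b = diff X (-1) z"
      using eq[OF p_closed(2)] p_closed(3) t(2) dz by (simp add: comparison_map_def z_def)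
    have "h 0 (x \<odot>\<^bsub>obj P 0\<^esub> p\<^sub>0) = x \<odot>\<^bsub>obj X (-1)\<^esub> z"
      using mod_hom_smult[OF h x p_closed(2)] by (simp add: z_def)
    then have a_eq: "(x \<otimes>\<^bsub>A\<^esub> t \<oplus>\<^bsub>A\<^esub> \<one>\<^bsub>A\<^esub>) \<odot>\<^bsub>obj X (-1)\<^esub> a = diff X (-2) y \<oplus>\<^bsub>obj X (-1)\<^esub> x \<odot>\<^bsub>obj X (-1)\<^esub> z"
      using eq[OF p_closed(1)] p_closed(4) c1_p1 t(2) x z dy by (simp add: comparison_map_def y_def)
    \<comment> \<open>Subtracting \<open>(x t a, x t b)\<close> replaces \<open>z\<close> by \<open>z - t a\<close>.\<close>
    define z' where "z' = z \<oplus>\<^bsub>obj X (-1)\<^esub> (\<ominus>\<^bsub>A\<^esub> t) \<odot>\<^bsub>obj X (-1)\<^esub> a"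
    have z': "z' \<in> carrier (obj X (-1))" using z t D by (simp add: z'_def)
    have a': "a = (x \<otimes>\<^bsub>A\<^esub> t \<oplus>\<^bsub>A\<^esub> \<one>\<^bsub>A\<^esub>) \<odot>\<^bsub>obj X (-1)\<^esub> a \<oplus>\<^bsub>obj X (-1)\<^esub> (\<ominus>\<^bsub>A\<^esub> (x \<otimes>\<^bsub>A\<^esub> t)) \<odot>\<^bsub>obj X (-1)\<^esub> a"
      using D(1) x t(1) by (simp add: X.smult_l_distr X.smult_l_minus X.a_ac X.r_neg)
    have b': "b = (x \<otimes>\<^bsub>A\<^esub> t \<oplus>\<^bsub>A\<^esub> \<one>\<^bsub>A\<^esub>) \<odot>\<^bsub>obj X 0\<^esub> b \<oplus>\<^bsub>obj X 0\<^esub> (\<ominus>\<^bsub>A\<^esub> (x \<otimes>\<^bsub>A\<^esub> t)) \<odot>\<^bsub>obj X 0\<^esub> b"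
      using D(2) x t(1) by (simp add: X.smult_l_distr X.smult_l_minus X.a_ac X.r_neg)
    have xt: "\<ominus>\<^bsub>A\<^esub> (x \<otimes>\<^bsub>A\<^esub> t) = x \<otimes>\<^bsub>A\<^esub> (\<ominus>\<^bsub>A\<^esub> t)" "\<ominus>\<^bsub>A\<^esub> (x \<otimes>\<^bsub>A\<^esub> t) = (\<ominus>\<^bsub>A\<^esub> t) \<otimes>\<^bsub>A\<^esub> x"
      using x t(1) by (simp_all add: A.r_minus A.l_minus A.m_comm)
    have "a = diff X (-2) y \<oplus>\<^bsub>obj X (-1)\<^esub> x \<odot>\<^bsub>obj X (-1)\<^esub> z'"
    proof -
      have "a = (diff X (-2) y \<oplus>\<^bsub>obj X (-1)\<^esub> x \<odot>\<^bsub>obj X (-1)\<^esub> z) \<oplus>\<^bsub>obj X (-1)\<^esub>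
          (x \<otimes>\<^bsub>A\<^esub> (\<ominus>\<^bsub>A\<^esub> t)) \<odot>\<^bsub>obj X (-1)\<^esub> a"
        using a' unfolding a_eq xt(1) .
      also have "\<dots> = diff X (-2) y \<oplus>\<^bsub>obj X (-1)\<^esub> x \<odot>\<^bsub>obj X (-1)\<^esub> z'"
        using dy z D(1) x t(1) by (simp add: z'_def X.smult_r_distr X.smult_assoc1 X.a_assoc)
      finally show ?thesis .
    qed
    moreover have "b = diff X (-1) z'"
    proof -
      have "b = diff X (-1) z \<oplus>\<^bsub>obj X 0\<^esub> ((\<ominus>\<^bsub>A\<^esub> t) \<otimes>\<^bsub>A\<^esub> x) \<odot>\<^bsub>obj X 0\<^esub> b"
        using b' unfolding b_eq xt(2) .
      also have "\<dots> = diff X (-1) z'"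
        using z D x t(1) by (simp add: z'_def X.smult_assoc1 mod_hom_add[OF diff_mod_hom(1)]
            mod_hom_smult[OF diff_mod_hom(1)])
      finally show ?thesis .
    qed
    ultimately show ?R using y z' by (intro bexI[of _ y] bexI[of _ z'] conjI)
  next
    assume ?R
    then obtain y z where y: "y \<in> carrier (obj X (-2))" and z: "z \<in> carrier (obj X (-1))"
      and a: "a = diff X (-2) y \<oplus>\<^bsub>obj X (-1)\<^esub> x \<odot>\<^bsub>obj X (-1)\<^esub> z" and b: "b = diff X (-1) z"
      by (elim bexE conjE) (rule that)
    note dy = mod_hom_closed[OF diff_mod_hom(2) y] and dz = mod_hom_closed[OF diff_mod_hom(1) z]
    define h where "h = (\<lambda>n v. if n = 0 then c\<^sub>0 v \<odot>\<^bsub>obj X (-1)\<^esub> z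
      else if n = -1 then c\<^sub>1 v \<odot>\<^bsub>obj X (-2)\<^esub> y else \<zero>\<^bsub>obj X (n - 1)\<^esub>)"
    show "homotopic A P X (comparison_map c\<^sub>1 c\<^sub>0 X a b) (\<lambda>n v. \<zero>\<^bsub>obj X n\<^esub>)"
    proof (rule homotopicI[OF P X g o, of h])
      fix n
      have sc: "(\<lambda>v. c v \<odot>\<^bsub>obj X m\<^esub> w) \<in> mod_hom A (obj P n) (obj X m)"
        if "c \<in> mod_hom A (obj P n) (regular_module A)" "w \<in> carrier (obj X m)" for c w n m
        using that by (auto simp: mod_hom_def Pi_iff X.smult_l_distr X.smult_assoc1)
      show "h n \<in> mod_hom A (obj P n) (obj X (n - 1))"
        using sc[OF c0 z] sc[OF c1 y] mod_hom_const_zero[OF X.module_axioms]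
        by (cases "n = 0"; cases "n = -1") (simp_all add: h_def)
      fix v assume v: "v \<in> carrier (obj P n)"
      consider "n = -1" | "n = 0" | "n = -2" | "n \<notin> {-2,-1,0}" by auto
      then show "comparison_map c\<^sub>1 c\<^sub>0 X a b n v =
        (diff X (n - 1) (h n v) \<oplus>\<^bsub>obj X n\<^esub> h (n + 1) (diff P n v)) \<oplus>\<^bsub>obj X n\<^esub> \<zero>\<^bsub>obj X n\<^esub>"
      proof cases
        case 1
        then have "c\<^sub>1 v \<in> carrier A" "v \<in> carrier (obj P (-1))" using c_closed v by simp_all
        then show ?thesis
          using 1 x y z dy by (simp add: comparison_map_def h_def a mod_hom_smult[OF diff_mod_hom(2)]
              X.smult_r_distr X.smult_assoc1[symmetric] c_diff A.m_comm)
      next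
        case 2
        then have "c\<^sub>0 v \<in> carrier A" using c_closed v by simp
        then show ?thesis
          using 2 z dz by (simp add: comparison_map_def h_def b mod_hom_smult[OF diff_mod_hom(1)])
      next
        case 3
        then show ?thesis
          using v y c1_diff[of v] complex_diff_zero[OF X, of "-3"] by (simp add: comparison_map_def h_def)
      next
        case 4
        then show ?thesis
          using complex_diff_zero[OF X, of "n - 1"] by (auto simp: comparison_map_def h_def)
      qed
    qed
  qed
  finally show ?thesis .
qed

end

lemma ring_quotient_module: "cring A \<Longrightarrow> x \<in> carrier A \<Longrightarrow> module A (ring_quotient A x)"
  unfolding ring_quotient_def
  by (intro quotient_module_module multiples_submodule regular_module_module)

lemma ring_quotient_proj_mod_hom:
  "cring A \<Longrightarrow> x \<in> carrier A \<Longrightarrow> ring_quotient_proj A x \<in> mod_hom A (regular_module A) (ring_quotient A x)"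
  unfolding ring_quotient_def ring_quotient_proj_def[abs_def]
  by (intro quotient_map_mod_hom multiples_submodule regular_module_module)

lemma ring_quotient_proj_eq_iff:
  assumes "cring A" "x \<in> carrier A" "b \<in> carrier A" "b' \<in> carrier A"
  shows "ring_quotient_proj A x b = ring_quotient_proj A x b' \<longleftrightarrow> (\<exists>t\<in>carrier A. b = x \<otimes>\<^bsub>A\<^esub> t \<oplus>\<^bsub>A\<^esub> b')"
  using coset_eq_iff[OF regular_module_module[OF assms(1)]
      multiples_submodule[OF regular_module_module[OF assms(1)] assms(2)], of b b'] assms(3,4)
  by (simp add: ring_quotient_proj_def multiples_def)

text \<open>
  At the top degree of \<open>C\<close> there is no room for a homotopy into a module.
\<close>

lemma homotopic_to_concentrated:
  assumes "is_complex A C" "module A B" "carrier (obj C 1) = {\<zero>\<^bsub>obj C 1\<^esub>}"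
    and "homotopic A C (concentrated B) g g'" "v \<in> carrier (obj C 0)" "g 0 v \<in> carrier B" "g' 0 v \<in> carrier B"
  shows "g 0 v = g' 0 v"
proof -
  interpret B: module A B by fact
  have B0: "obj (concentrated B) 0 = B" by (simp add: concentrated_def)
  obtain h where h: "\<And>n. h n \<in> mod_hom A (obj C n) (obj (concentrated B) (n - 1))"
    and eq: "\<And>n v. v \<in> carrier (obj C n) \<Longrightarrow> g n v \<ominus>\<^bsub>obj (concentrated B) n\<^esub> g' n v =
      diff (concentrated B) (n - 1) (h n v) \<oplus>\<^bsub>obj (concentrated B) n\<^esub> h (n + 1) (diff C n v)"
    using assms(4) unfolding homotopic_def by (elim exE) (rule that, simp_all)
  have "diff C 0 v = \<zero>\<^bsub>obj C 1\<^esub>"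
    using mod_hom_closed[OF complex_diff[OF assms(1)] assms(5)] assms(3) by simp
  moreover have "h 1 \<zero>\<^bsub>obj C 1\<^esub> = \<zero>\<^bsub>B\<^esub>"
    using mod_hom_zero[OF complex_module[OF assms(1)] complex_module[OF concentrated_is_complex[OF assms(2)]] h, of 1]
    by simp
  ultimately have "g 0 v \<ominus>\<^bsub>B\<^esub> g' 0 v = \<zero>\<^bsub>B\<^esub>" using eq[OF assms(5)] by (simp add: B0)
  then show ?thesis using assms(6,7) by (simp add: module_minus_eq_iff[OF assms(2)])
qed

lemma cone_of_mult_simps:
  assumes "cring A"
  shows "obj (cone_of_mult A x) n = direct_sum (obj (ring_complex A) (n + 1)) (obj (ring_complex A) n)"
    and "p \<in> carrier (obj (cone_of_mult A x) n) \<Longrightarrow> fst (diff (cone_of_mult A x) n p) = \<zero>\<^bsub>A\<^esub>"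
    and "p \<in> carrier (obj (cone_of_mult A x) n) \<Longrightarrow> x \<in> carrier A \<Longrightarrow>
      snd (diff (cone_of_mult A x) n p) = x \<otimes>\<^bsub>A\<^esub> fst p"
proof -
  interpret A: cring A by fact
  have R: "is_complex A (ring_complex A)"
    unfolding ring_complex_def by (rule concentrated_is_complex[OF regular_module_module[OF assms]])
  show "obj (cone_of_mult A x) n = direct_sum (obj (ring_complex A) (n + 1)) (obj (ring_complex A) n)"
    by (simp add: cone_of_mult_def mapping_cone_def)
  show "fst (diff (cone_of_mult A x) n p) = \<zero>\<^bsub>A\<^esub>" if "p \<in> carrier (obj (cone_of_mult A x) n)"
    using module_neg_zero[OF complex_module[OF R, of "n + 1 + 1"]]
    by (simp add: cone_of_mult_def mapping_cone_def ring_complex_def)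
  show "snd (diff (cone_of_mult A x) n p) = x \<otimes>\<^bsub>A\<^esub> fst p"
    if "p \<in> carrier (obj (cone_of_mult A x) n)" "x \<in> carrier A"
    using that by (auto simp: cone_of_mult_def mapping_cone_def ring_complex_def split: if_splits)
qed

lemma shifted_ring_complex:
  assumes "cring A"
  shows "is_complex A (translate (ring_complex A) (-1))"
    and "\<And>n. obj (translate (ring_complex A) (-1)) n = obj (ring_complex A) (n + 1)"
    and "\<And>n v. diff (translate (ring_complex A) (-1)) n v = \<zero>\<^bsub>A\<^esub>"
proof -
  have R: "is_complex A (ring_complex A)"
    unfolding ring_complex_def by (rule concentrated_is_complex[OF regular_module_module[OF assms]])
  show o: "obj (translate (ring_complex A) (-1)) n = obj (ring_complex A) (n + 1)" for n
    by (simp add: translate_def)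
  show d: "diff (translate (ring_complex A) (-1)) n v = \<zero>\<^bsub>A\<^esub>" for n v
    using module_neg_zero[OF complex_module[OF R, of "n + 1 + 1"]]
    by (simp add: translate_def ring_complex_def)
  have zero: "zero (obj (ring_complex A) n) = zero A" for n by (simp add: ring_complex_def)
  show "is_complex A (translate (ring_complex A) (-1))"
    unfolding is_complex_def
  proof (intro allI conjI ballI)
    fix n
    show "module A (obj (translate (ring_complex A) (-1)) n)" unfolding o by (rule complex_module[OF R])
    have "(\<lambda>v. \<zero>\<^bsub>A\<^esub>) \<in> mod_hom A (obj (ring_complex A) (n + 1)) (obj (ring_complex A) (n + 1 + 1))"
      using mod_hom_const_zero[OF complex_module[OF R, of "n + 1 + 1"]] by (simp add: zero)
    then show "diff (translate (ring_complex A) (-1)) n \<in>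
        mod_hom A (obj (translate (ring_complex A) (-1)) n) (obj (translate (ring_complex A) (-1)) (n + 1))"
      unfolding o by (simp add: d[abs_def])
  qed (simp add: d o zero)
qed

lemma fst_cone_chain_map:
  assumes A: "cring A" and c: "chain_map A P (cone_of_mult A x) c"
  shows "chain_map A P (translate (ring_complex A) (-1)) (\<lambda>n v. fst (c n v))"
  unfolding chain_map_def
proof (intro allI conjI ballI)
  fix n
  show "(\<lambda>v. fst (c n v)) \<in> mod_hom A (obj P n) (obj (translate (ring_complex A) (-1)) n)"
    using mod_hom_compose[OF chain_map_mod_hom[OF c, of n, unfolded cone_of_mult_simps(1)[OF A]] mod_hom_fst]
    by (simp add: shifted_ring_complex(2)[OF A])
  show "diff (translate (ring_complex A) (-1)) n (fst (c n v)) = fst (c (n + 1) (diff P n v))"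
    if "v \<in> carrier (obj P n)" for v
    using chain_map_diff[OF c that] cone_of_mult_simps(2)[OF A chain_map_closed[OF c that]]
    by (simp add: shifted_ring_complex(3)[OF A])
qed

text \<open>
  The element \<open>j 0 1\<close> is a lift \<open>p\<^sub>0\<close> of the generator of \<open>A/xA\<close> to \<open>P\<^sup>0\<close>. Since \<open>x p\<^sub>0\<close> maps to zero in \<open>A/xA\<close>, it is
  the boundary of some \<open>p\<^sub>1\<close>. The composite \<open>P \<rightarrow> (A \<rightarrow> A) \<rightarrow> P\<close> induces the identity on \<open>A/xA\<close>, so it is
  homotopic to the identity by the comparison theorem. That \<open>c\<^sub>1 p\<^sub>1 = c\<^sub>0 p\<^sub>0\<close> follows from the chain map
  property by cancelling \<open>x\<close>.
\<close>

lemma resolution_retraction: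
  assumes A: "cring A" and x: "x \<in> carrier A" and nzd: "nonzerodivisor_on (regular_module A) x"
    and res: "projective_resolution A P (ring_quotient A x) \<epsilon>"
    and j: "represents_projection A x P \<epsilon> j"
    and c: "chain_map A P (cone_of_mult A x) c"
    and c\<epsilon>: "homotopic A P (concentrated (ring_quotient A x)) (\<lambda>n v. ring_quotient_proj A x (snd (c n v))) \<epsilon>"
  shows "\<exists>p\<^sub>1. two_term_retraction A x P (\<lambda>v. fst (c (-1) v)) (\<lambda>v. snd (c 0 v)) p\<^sub>1 (j 0 \<one>\<^bsub>A\<^esub>)"
proof -
  interpret A: cring A by (rule A)
  let ?B = "ring_quotient A x" and ?q = "ring_quotient_proj A x"
  let ?c1 = "\<lambda>v. fst (c (-1) v)" and ?c0 = "\<lambda>v. snd (c 0 v)" and ?p0 = "j 0 \<one>\<^bsub>A\<^esub>"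
  have P: "is_complex A P" and Pproj: "\<And>n. projective_module A (obj P n)"
    and Ptop: "\<And>n. n > 0 \<Longrightarrow> carrier (obj P n) = {\<zero>\<^bsub>obj P n\<^esub>}"
    and \<epsilon>: "quasi_iso A P (concentrated ?B) \<epsilon>"
    using res by (auto simp: projective_resolution_def)
  interpret P: module A "obj P n" for n by (rule complex_module[OF P])
  have R: "module A (regular_module A)" by (rule regular_module_module[OF A])
  have RC: "is_complex A (ring_complex A)"
    unfolding ring_complex_def by (rule concentrated_is_complex[OF R])
  have B: "module A ?B" by (rule ring_quotient_module[OF A x])
  have BC: "is_complex A (concentrated ?B)" by (rule concentrated_is_complex[OF B])
  have q: "?q \<in> mod_hom A (regular_module A) ?B" by (rule ring_quotient_proj_mod_hom[OF A x])
  have \<epsilon>map: "chain_map A P (concentrated ?B) \<epsilon>" by (rule quasi_iso_chain_map[OF \<epsilon>])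
  have \<epsilon>0: "\<epsilon> 0 \<in> mod_hom A (obj P 0) ?B"
    using chain_map_mod_hom[OF \<epsilon>map, of 0] by (simp add: concentrated_def)
  have jmap: "chain_map A (ring_complex A) P j" using j by (simp add: represents_projection_def)
  have R0: "obj (ring_complex A) 0 = regular_module A" by (simp add: ring_complex_def concentrated_def)
  have zeroR: "carrier (obj (ring_complex A) n) = {\<zero>\<^bsub>A\<^esub>}" if "n \<noteq> 0" for n
    using that by (simp add: ring_complex_def)
  have cl: "fst (c n v) \<in> carrier (obj (ring_complex A) (n + 1))" "snd (c n v) \<in> carrier (obj (ring_complex A) n)"
    if "v \<in> carrier (obj P n)" for n v
    using chain_map_closed[OF c that] by (auto simp: cone_of_mult_simps[OF A])
  have c0: "?c0 \<in> mod_hom A (obj P 0) (regular_module A)"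
    using mod_hom_compose[OF chain_map_mod_hom[OF c, of 0, unfolded cone_of_mult_simps(1)[OF A]] mod_hom_snd] R0
    by simp
  have c1: "?c1 \<in> mod_hom A (obj P (-1)) (regular_module A)"
    using mod_hom_compose[OF chain_map_mod_hom[OF c, of "-1", unfolded cone_of_mult_simps(1)[OF A]] mod_hom_fst] R0
    by simp
  have c_diff: "?c0 (diff P (-1) v) = x \<otimes>\<^bsub>A\<^esub> ?c1 v" if "v \<in> carrier (obj P (-1))" for v
    using chain_map_diff[OF c that] cone_of_mult_simps(3)[OF A chain_map_closed[OF c that] x] by simp
  have c1_diff: "?c1 (diff P (-2) v) = \<zero>\<^bsub>A\<^esub>" if "v \<in> carrier (obj P (-2))" for v
    using chain_map_diff[OF c that] cone_of_mult_simps(2)[OF A chain_map_closed[OF c that]] by simp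
  interpret two_term_map A x P ?c1 ?c0
    by unfold_locales (use A x P c0 c1 c_diff c1_diff in auto)
  have cycle0: "v \<in> carrier (cycles P 0)" if "v \<in> carrier (obj P 0)" for v
    using mod_hom_closed[OF complex_diff[OF P] that] Ptop[of "0 + 1"] that by simp
  have p0: "?p0 \<in> carrier (obj P 0)" using chain_map_closed[OF jmap, of "\<one>\<^bsub>A\<^esub>" 0] R0 by simp
  have \<epsilon>p0: "\<epsilon> 0 ?p0 = ?q \<one>\<^bsub>A\<^esub>"
  proof (rule homotopic_to_concentrated[OF RC B, where g = "\<lambda>n a. \<epsilon> n (j n a)" and g' = "\<lambda>n. ?q"])
    show "homotopic A (ring_complex A) (concentrated ?B) (\<lambda>n a. \<epsilon> n (j n a)) (\<lambda>n. ?q)"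
      using j by (simp add: represents_projection_def)
  qed (use mod_hom_closed[OF \<epsilon>0 p0] mod_hom_closed[OF q] R0 in \<open>simp_all add: ring_complex_def\<close>)
  have qc: "?q (?c0 v) = \<epsilon> 0 v" if v: "v \<in> carrier (obj P 0)" for v
    by (rule homotopic_to_concentrated[OF P B, where g = "\<lambda>n v. ?q (snd (c n v))" and g' = \<epsilon>])
      (use Ptop c\<epsilon> v mod_hom_closed[OF \<epsilon>0 v] mod_hom_closed[OF q] mod_hom_closed[OF c0 v] in simp_all)
  have \<epsilon>_inj: "coh_class P 0 v = coh_class P 0 w"
    if "v \<in> carrier (obj P 0)" "w \<in> carrier (obj P 0)" "\<epsilon> 0 v = \<epsilon> 0 w" for v w
    by (rule quasi_iso_inj[OF P BC \<epsilon> cycle0[OF that(1)] cycle0[OF that(2)]]) (simp add: that(3))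
  have \<epsilon>_smult: "\<epsilon> 0 (a \<odot>\<^bsub>obj P 0\<^esub> ?p0) = ?q a" if a: "a \<in> carrier A" for a
    using mod_hom_smult[OF \<epsilon>0 a p0] mod_hom_smult[OF q a, of "\<one>\<^bsub>A\<^esub>"] a by (simp add: \<epsilon>p0)
  have "coh_class P 0 (x \<odot>\<^bsub>obj P 0\<^esub> ?p0) = coh_class P 0 (\<zero>\<^bsub>A\<^esub> \<odot>\<^bsub>obj P 0\<^esub> ?p0)"
  proof (rule \<epsilon>_inj)
    have "?q x = ?q \<zero>\<^bsub>A\<^esub>"
      using x by (subst ring_quotient_proj_eq_iff[OF A x]) (auto intro!: bexI[of _ "\<one>\<^bsub>A\<^esub>"])
    then show "\<epsilon> 0 (x \<odot>\<^bsub>obj P 0\<^esub> ?p0) = \<epsilon> 0 (\<zero>\<^bsub>A\<^esub> \<odot>\<^bsub>obj P 0\<^esub> ?p0)"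
      by (simp only: \<epsilon>_smult x A.zero_closed)
  qed (use x p0 in simp_all)
  then have "coh_class P 0 (x \<odot>\<^bsub>obj P 0\<^esub> ?p0) = \<zero>\<^bsub>cohomology P 0\<^esub>"
    using p0 coh_class_zero[OF P, of 0] by simp
  then obtain p1 where p1: "p1 \<in> carrier (obj P (0 - 1))" "x \<odot>\<^bsub>obj P 0\<^esub> ?p0 = diff P (0 - 1) p1"
    by (subst (asm) coh_class_eq_zero_iff[OF P cycle0[OF P.smult_closed[OF x p0]]])
      (erule bexE, rule that)
  have tw: "twisted_cycle P x p1 ?p0"
    using p1 cycle0[OF p0] by (simp add: twisted_cycle_def)
  have "?q (?c0 ?p0) = ?q \<one>\<^bsub>A\<^esub>" using qc[OF p0] \<epsilon>p0 by simp
  then have unit: "\<exists>t\<in>carrier A. ?c0 ?p0 = x \<otimes>\<^bsub>A\<^esub> t \<oplus>\<^bsub>A\<^esub> \<one>\<^bsub>A\<^esub>"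
    by (subst (asm) ring_quotient_proj_eq_iff[OF A x c_closed(1)[OF p0] A.one_closed])
  have c1p1: "?c1 p1 = ?c0 ?p0"
  proof -
    have cl1: "?c1 p1 \<in> carrier A" "?c0 ?p0 \<in> carrier A" using c_closed p1(1) p0 by simp_all
    have "x \<otimes>\<^bsub>A\<^esub> ?c1 p1 = x \<otimes>\<^bsub>A\<^esub> ?c0 ?p0"
      using c_diff[of p1] p1 mod_hom_smult[OF c0 x p0] by simp
    then have "x \<otimes>\<^bsub>A\<^esub> (?c1 p1 \<ominus>\<^bsub>A\<^esub> ?c0 ?p0) = \<zero>\<^bsub>A\<^esub>"
      using x cl1 by (simp add: a_minus_def A.r_distr A.r_minus A.r_neg)
    then have "?c1 p1 \<ominus>\<^bsub>A\<^esub> ?c0 ?p0 = \<zero>\<^bsub>A\<^esub>"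
      using nzd cl1 by (simp add: nonzerodivisor_on_def)
    then show ?thesis
      using A.minus_equality[of "?c1 p1" "\<ominus>\<^bsub>A\<^esub> ?c0 ?p0"] cl1 by (simp add: a_minus_def A.minus_minus)
  qed
  have "homotopic A P P (comparison_map ?c1 ?c0 P p1 ?p0) (\<lambda>n v. v)"
  proof (rule homotopic_from_projective_complex[OF P Pproj Ptop P _ comparison_map[OF P tw] chain_map_id])
    fix n v assume n: "n < (0::int)" and v: "v \<in> carrier (cycles P n)"
    show "v \<in> diff P (n - 1) ` carrier (obj P (n - 1))"
      using quasi_iso_concentrated_exact[OF P B \<epsilon> _ v] n by auto
  next
    fix v assume v: "v \<in> carrier (obj P 0)"
    show "coh_class P 0 (comparison_map ?c1 ?c0 P p1 ?p0 0 v) = coh_class P 0 v"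
      by (rule \<epsilon>_inj) (use v p0 c_closed(1)[OF v] in \<open>simp_all add: comparison_map_def \<epsilon>_smult qc\<close>)
  qed auto
  then have "two_term_retraction A x P ?c1 ?c0 p1 ?p0"
    by unfold_locales (use tw unit c1p1 in auto)
  then show ?thesis by blast
qed

context retraction_target
begin

text \<open>
  The composite takes the generator to \<open>(1 + x t) b\<close>, and \<open>x t b = d (t a)\<close> is a boundary.
\<close>

lemma les_pi_twisted_class:
  assumes j: "chain_map A (ring_complex A) P j" "j 0 \<one>\<^bsub>A\<^esub> = p\<^sub>0" and ab: "twisted_cycle X x a b"
  shows "les_pi A X j (twisted_class a b) = coh_class X 0 b"
proof -
  note D = twisted_cycleD[OF ab]
  have RC: "is_complex A (ring_complex A)"
    unfolding ring_complex_def by (rule concentrated_is_complex[OF regular_module_module[OF A]])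
  have one: "\<one>\<^bsub>A\<^esub> \<in> carrier (cycles (ring_complex A) 0)" by (simp add: ring_complex_def)
  obtain t where t: "t \<in> carrier A" "c\<^sub>0 p\<^sub>0 = x \<otimes>\<^bsub>A\<^esub> t \<oplus>\<^bsub>A\<^esub> \<one>\<^bsub>A\<^esub>"
    by (rule bexE[OF c0_p0]) (rule that)
  have cm: "chain_map A P X (comparison_map c\<^sub>1 c\<^sub>0 X a b)" by (rule comparison_map[OF X ab])
  have "les_pi A X j (twisted_class a b) =
      eval_one A X 0 (hom_class A (ring_complex A) X (\<lambda>n v. comparison_map c\<^sub>1 c\<^sub>0 X a b n (j n v)))"
    unfolding les_pi_def twisted_class_def by (simp add: precompose_hom_class[OF A RC P X j(1) cm])
  also have "\<dots> = coh_class X 0 (comparison_map c\<^sub>1 c\<^sub>0 X a b 0 (j 0 \<one>\<^bsub>A\<^esub>))"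
    by (rule eval_one_hom_class[OF A RC X chain_map_compose[OF j(1) cm] one])
  also have "\<dots> = coh_class X 0 (c\<^sub>0 p\<^sub>0 \<odot>\<^bsub>obj X 0\<^esub> b)" by (simp add: comparison_map_def j(2))
  also have "\<dots> = coh_class X 0 b"
  proof (subst coh_class_eq_iff[OF X])
    have "diff X 0 (c\<^sub>0 p\<^sub>0 \<odot>\<^bsub>obj X 0\<^esub> b) = \<zero>\<^bsub>obj X 1\<^esub>"
      using mod_hom_smult[OF complex_diff[OF X, of 0] c_closed(1)[OF p_closed(2)] D(2)] D(3)
        c_closed(1)[OF p_closed(2)] by simp
    then show "c\<^sub>0 p\<^sub>0 \<odot>\<^bsub>obj X 0\<^esub> b \<in> carrier (cycles X 0)"
      using D(2) c_closed(1)[OF p_closed(2)] by simp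
    have "c\<^sub>0 p\<^sub>0 \<odot>\<^bsub>obj X 0\<^esub> b = t \<odot>\<^bsub>obj X 0\<^esub> (x \<odot>\<^bsub>obj X 0\<^esub> b) \<oplus>\<^bsub>obj X 0\<^esub> b"
      using D(2) t(1) x by (simp add: t(2) X.smult_l_distr X.smult_assoc1[symmetric] A.m_comm)
    also have "\<dots> = diff X (-1) (t \<odot>\<^bsub>obj X (-1)\<^esub> a) \<oplus>\<^bsub>obj X 0\<^esub> b"
      using mod_hom_smult[OF diff_mod_hom(1) t(1) D(1)] D(4) by simp
    finally show "\<exists>y\<in>carrier (obj X (0 - 1)). c\<^sub>0 p\<^sub>0 \<odot>\<^bsub>obj X 0\<^esub> b = diff X (0 - 1) y \<oplus>\<^bsub>obj X 0\<^esub> b"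
      using t(1) D(1) by (intro bexI[of _ "t \<odot>\<^bsub>obj X (-1)\<^esub> a"]) simp_all
  qed (rule D(3))
  finally show ?thesis .
qed

lemma twisted_cycle_of_cycle:
  "a \<in> carrier (cycles X (-1)) \<Longrightarrow> twisted_cycle X x a \<zero>\<^bsub>obj X 0\<^esub>"
  using complex_diff_zero[OF X, of 0] x by (simp add: twisted_cycle_def)

text \<open>
  The chain map \<open>\<delta>\<close> is homotopic to the component of degree \<open>-1\<close> of the map from \<open>P\<close> to the two-term complex,
  so precomposing the chain map \<open>r \<mapsto> r a\<close> with it yields the comparison map of the pair \<open>(a, 0)\<close>.
\<close>

lemma les_tau_coh_class:
  assumes \<delta>: "chain_map A P (translate (ring_complex A) (-1)) \<delta>"
    and c: "chain_map A P (translate (ring_complex A) (-1)) c" "c\<^sub>1 = c (-1)"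
    and hom: "homotopic A P (translate (ring_complex A) (-1)) c \<delta>"
    and a: "a \<in> carrier (cycles X (-1))"
  shows "les_tau A X P \<delta> (coh_class X (-1) a) = twisted_class a \<zero>\<^bsub>obj X 0\<^esub>"
proof -
  let ?T = "translate (ring_complex A) (-1)"
  note T = shifted_ring_complex[OF A]
  have T_carrier: "carrier (obj ?T n) = (if n = -1 then carrier A else {\<zero>\<^bsub>A\<^esub>})"
    "zero (obj ?T n) = zero A" "add (obj ?T n) = add A" "smult (obj ?T n) = mult A" for n
    unfolding T(2) by (simp_all add: ring_complex_def eq_neg_iff_add_eq_0)
  have one: "\<one>\<^bsub>A\<^esub> \<in> carrier (cycles ?T (-1))" by (simp add: T(3) T_carrier)
  have a': "a \<in> carrier (obj X (-1))" "diff X (-1) a = \<zero>\<^bsub>obj X 0\<^esub>" using a by simp_all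
  define g where "g = (\<lambda>n r. if n = -1 then r \<odot>\<^bsub>obj X (-1)\<^esub> a else \<zero>\<^bsub>obj X n\<^esub>)"
  have g: "chain_map A ?T X g"
    unfolding chain_map_def
  proof (intro allI conjI ballI)
    fix n
    show "g n \<in> mod_hom A (obj ?T n) (obj X n)"
      using a'(1) by (auto simp: g_def mod_hom_def T_carrier X.smult_l_distr X.smult_assoc1)
    show "diff X n (g n v) = g (n + 1) (diff ?T n v)" if "v \<in> carrier (obj ?T n)" for v
      using that a' complex_diff_zero[OF X, of n] mod_hom_smult[OF diff_mod_hom(1) _ a'(1)]
      by (cases "n = -2") (auto simp: g_def T(3) T_carrier split: if_splits)
  qed
  let ?H = "cohomology (hom_complex A ?T X) 0"
  have "eval_one A X (-1) (hom_class A ?T X g) = coh_class X (-1) a"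
    using eval_one_hom_class[OF A T(1) X g one] a'(1) by (simp add: g_def)
  then have im: "coh_class X (-1) a \<in> eval_one A X (-1) ` carrier ?H"
    using hom_class_closed[OF A T(1) X g] by (metis imageI)
  \<comment> \<open>The preimage that \<open>inv_into\<close> picks is some chain map \<open>k\<close>; its value \<open>a2\<close> at 1 is cohomologous to \<open>a\<close>.\<close>
  obtain k where k: "chain_map A ?T X k"
    and k_eq: "inv_into (carrier ?H) (eval_one A X (-1)) (coh_class X (-1) a) = hom_class A ?T X k"
    by (rule hom_classE[OF A T(1) X inv_into_into[OF im]]) (rule that)
  define a2 where "a2 = k (-1) \<one>\<^bsub>A\<^esub>"
  have a2: "a2 \<in> carrier (cycles X (-1))" unfolding a2_def by (rule chain_map_cycle[OF T(1) X k one])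
  then have a2': "a2 \<in> carrier (obj X (-1))" by simp
  have coh: "coh_class X (-1) a2 = coh_class X (-1) a"
    using f_inv_into_f[OF im] eval_one_hom_class[OF A T(1) X k one] by (simp add: k_eq a2_def)
  have "les_tau A X P \<delta> (coh_class X (-1) a) = hom_class A P X (\<lambda>n v. k n (\<delta> n v))"
    unfolding les_tau_def by (simp add: k_eq precompose_hom_class[OF A P T(1) X \<delta> k])
  also have "\<dots> = hom_class A P X (\<lambda>n v. k n (c n v))"
    unfolding hom_class_eq_iff[OF A P X chain_map_compose[OF c(1) k] chain_map_compose[OF \<delta> k], symmetric]
    by (rule sym, subst hom_class_eq_iff[OF A P X chain_map_compose[OF c(1) k] chain_map_compose[OF \<delta> k]])
      (rule homotopic_compose_left[OF P T(1) X c(1) \<delta> k hom])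
  also have "\<dots> = twisted_class a2 \<zero>\<^bsub>obj X 0\<^esub>"
    unfolding twisted_class_def
  proof (rule hom_class_cong)
    fix n v assume v: "v \<in> carrier (obj P n)"
    have cv: "c n v \<in> carrier (obj ?T n)" by (rule chain_map_closed[OF c(1) v])
    show "k n (c n v) = comparison_map c\<^sub>1 c\<^sub>0 X a2 \<zero>\<^bsub>obj X 0\<^esub> n v"
    proof (cases "n = -1")
      case True
      then have "c (-1) v \<in> carrier A" using cv by (simp add: T_carrier)
      then show ?thesis
        using True mod_hom_smult[OF chain_map_mod_hom[OF k, of "-1"], of "c (-1) v" "\<one>\<^bsub>A\<^esub>"]
        by (simp add: comparison_map_def c(2) a2_def T_carrier)
    next
      case False
      then have "k n (c n v) = \<zero>\<^bsub>obj X n\<^esub>"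
        using cv chain_map_zero[OF T(1) X k, of n] by (simp add: T_carrier)
      then show ?thesis using False v c_closed by (auto simp: comparison_map_def)
    qed
  qed
  also have "\<dots> = twisted_class a \<zero>\<^bsub>obj X 0\<^esub>"
  proof -
    obtain y where y: "y \<in> carrier (obj X (-1 - 1))" "a2 = diff X (-1 - 1) y \<oplus>\<^bsub>obj X (-1)\<^esub> a"
      using coh unfolding coh_class_eq_iff[OF X a2 a] by (rule bexE) (rule that)
    have dy: "diff X (-2) y \<in> carrier (cycles X (-1))"
      using mod_hom_closed[OF complex_diff'[OF X] y(1)] complex_diff_diff'[OF X y(1)] by simp
    then have "twisted_class a2 \<zero>\<^bsub>obj X 0\<^esub> =
        twisted_class (diff X (-2) y) \<zero>\<^bsub>obj X 0\<^esub> \<oplus>\<^bsub>W\<^esub> twisted_class a \<zero>\<^bsub>obj X 0\<^esub>"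
      using twisted_class_add[OF twisted_cycle_of_cycle[OF dy] twisted_cycle_of_cycle[OF a]] y(2) by simp
    also have "twisted_class (diff X (-2) y) \<zero>\<^bsub>obj X 0\<^esub> = \<zero>\<^bsub>W\<^esub>"
      unfolding twisted_class_eq_zero_iff[OF twisted_cycle_of_cycle[OF dy]]
      using y(1) x dy complex_diff_zero[OF X, of "-1"]
      by (intro bexI[of _ y] bexI[of _ "\<zero>\<^bsub>obj X (-1)\<^esub>"]) simp_all
    finally show ?thesis
      using abelian_monoid.l_zero[of W] twisted_class_closed[OF twisted_cycle_of_cycle[OF a]] W_module
      by (simp add: module_def abelian_group_def)
  qed
  finally show ?thesis .
qed

text \<open>
  All five claims reduce to the vanishing criterion for \<open>twisted_class\<close>. For instance, if \<open>b = d z\<close>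
  then \<open>(a, b)\<close> and \<open>(a - x z, 0)\<close> have the same class, so the kernel of \<open>\<pi>\<close> is the image of \<open>\<tau>\<close>.
\<close>

lemma exact_sequence:
  assumes \<tau>: "\<And>a. a \<in> carrier (cycles X (-1)) \<Longrightarrow> \<tau> (coh_class X (-1) a) = twisted_class a \<zero>\<^bsub>obj X 0\<^esub>"
    and \<pi>: "\<And>a b. twisted_cycle X x a b \<Longrightarrow> \<pi> (twisted_class a b) = coh_class X 0 b"
    and xV: "\<And>v. v \<in> carrier (cohomology X 0) \<Longrightarrow> x \<odot>\<^bsub>cohomology X 0\<^esub> v = \<zero>\<^bsub>cohomology X 0\<^esub>"
  shows "\<tau> \<in> mod_hom A (cohomology X (-1)) W" "\<pi> \<in> mod_hom A W (cohomology X 0)"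
    and "{u \<in> carrier (cohomology X (-1)). \<tau> u = \<zero>\<^bsub>W\<^esub>} = multiples (cohomology X (-1)) x"
    and "\<tau> ` carrier (cohomology X (-1)) = {w \<in> carrier W. \<pi> w = \<zero>\<^bsub>cohomology X 0\<^esub>}"
    and "\<pi> ` carrier W = carrier (cohomology X 0)"
proof -
  let ?U = "cohomology X (-1)" and ?V = "cohomology X 0"
  note tc = twisted_cycle_of_cycle
  interpret Z1: module A "cycles X (-1)" by (rule cycles_module[OF X])
  interpret Z0: module A "cycles X 0" by (rule cycles_module[OF X])
  have tc_add: "twisted_cycle X x (a \<oplus>\<^bsub>obj X (-1)\<^esub> a') (b \<oplus>\<^bsub>obj X 0\<^esub> b')"
    if "twisted_cycle X x a b" "twisted_cycle X x a' b'" for a b a' b'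
    using that Z0.a_closed[of b b'] x
    by (auto simp: twisted_cycle_def mod_hom_add[OF diff_mod_hom(1)] X.smult_r_distr)
  have tc_smult: "twisted_cycle X x (r \<odot>\<^bsub>obj X (-1)\<^esub> a) (r \<odot>\<^bsub>obj X 0\<^esub> b)"
    if "twisted_cycle X x a b" "r \<in> carrier A" for a b r
    using that Z0.smult_closed[of r b] x
    by (auto simp: twisted_cycle_def mod_hom_smult[OF diff_mod_hom(1)] X.smult_assoc1[symmetric] A.m_comm)
  have U: "\<exists>a\<in>carrier (cycles X (-1)). u = coh_class X (-1) a" if "u \<in> carrier ?U" for u
    using that unfolding carrier_cohomology[OF X] by blast
  have V: "\<exists>b\<in>carrier (cycles X 0). v = coh_class X 0 b" if "v \<in> carrier ?V" for v
    using that unfolding carrier_cohomology[OF X] by blast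
  have W: "\<exists>a b. twisted_cycle X x a b \<and> w = twisted_class a b" if "w \<in> carrier W" for w
    by (rule twisted_classE[OF that]) blast
  have lift: "\<exists>a. twisted_cycle X x a b" if b: "b \<in> carrier (cycles X 0)" for b
  proof -
    have "coh_class X 0 (x \<odot>\<^bsub>obj X 0\<^esub> b) = \<zero>\<^bsub>?V\<^esub>"
      using xV[OF coh_class_closed[OF X b]] coh_class_smult[OF X x b] by simp
    moreover have "x \<odot>\<^bsub>obj X 0\<^esub> b \<in> carrier (cycles X 0)" using Z0.smult_closed[OF x b] by simp
    ultimately obtain y where "y \<in> carrier (obj X (0 - 1))" "x \<odot>\<^bsub>obj X 0\<^esub> b = diff X (0 - 1) y"
      using coh_class_eq_zero_iff[OF X] by blast
    then show ?thesis using b by (intro exI[of _ y]) (simp add: twisted_cycle_def)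
  qed
  show "\<tau> \<in> mod_hom A ?U W"
  proof (rule mod_homI)
    show "\<tau> u \<in> carrier W" if "u \<in> carrier ?U" for u
      using U[OF that] \<tau> twisted_class_closed[OF tc] by auto
    show "\<tau> (u \<oplus>\<^bsub>?U\<^esub> u') = \<tau> u \<oplus>\<^bsub>W\<^esub> \<tau> u'" if u: "u \<in> carrier ?U" "u' \<in> carrier ?U" for u u'
    proof -
      obtain a a' where a: "a \<in> carrier (cycles X (-1))" "u = coh_class X (-1) a"
        "a' \<in> carrier (cycles X (-1))" "u' = coh_class X (-1) a'" using U u by meson
      have "u \<oplus>\<^bsub>?U\<^esub> u' = coh_class X (-1) (a \<oplus>\<^bsub>obj X (-1)\<^esub> a')"
        by (simp only: a(2,4) coh_class_add[OF X a(1,3)])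
      moreover have "a \<oplus>\<^bsub>obj X (-1)\<^esub> a' \<in> carrier (cycles X (-1))" using Z1.a_closed[OF a(1,3)] by simp
      ultimately show ?thesis
        using twisted_class_add[OF tc[OF a(1)] tc[OF a(3)]] by (simp add: \<tau> a del: cycles_simps)
    qed
    show "\<tau> (r \<odot>\<^bsub>?U\<^esub> u) = r \<odot>\<^bsub>W\<^esub> \<tau> u" if r: "r \<in> carrier A" and u: "u \<in> carrier ?U" for r u
    proof -
      obtain a where a: "a \<in> carrier (cycles X (-1))" "u = coh_class X (-1) a" using U u by meson
      have "r \<odot>\<^bsub>?U\<^esub> u = coh_class X (-1) (r \<odot>\<^bsub>obj X (-1)\<^esub> a)"
        by (simp only: a(2) coh_class_smult[OF X r a(1)])
      moreover have "r \<odot>\<^bsub>obj X (-1)\<^esub> a \<in> carrier (cycles X (-1))" using Z1.smult_closed[OF r a(1)] by simp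
      ultimately show ?thesis
        using twisted_class_smult[OF tc[OF a(1)] r] r by (simp add: \<tau> a del: cycles_simps)
    qed
  qed
  show "\<pi> \<in> mod_hom A W ?V"
  proof (rule mod_homI)
    show "\<pi> w \<in> carrier ?V" if "w \<in> carrier W" for w
      using W[OF that] \<pi> coh_class_closed[OF X] twisted_cycleD(3) by auto
    show "\<pi> (w \<oplus>\<^bsub>W\<^esub> w') = \<pi> w \<oplus>\<^bsub>?V\<^esub> \<pi> w'" if w: "w \<in> carrier W" "w' \<in> carrier W" for w w'
    proof -
      obtain a b a' b' where ab: "twisted_cycle X x a b" "w = twisted_class a b"
        "twisted_cycle X x a' b'" "w' = twisted_class a' b'" using W w by meson
      show ?thesis
        unfolding ab(2,4) twisted_class_add[OF ab(1,3), symmetric] \<pi>[OF ab(1)] \<pi>[OF ab(3)]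
          \<pi>[OF tc_add[OF ab(1,3)]]
        by (rule coh_class_add[OF X twisted_cycleD(3)[OF ab(1)] twisted_cycleD(3)[OF ab(3)]])
    qed
    show "\<pi> (r \<odot>\<^bsub>W\<^esub> w) = r \<odot>\<^bsub>?V\<^esub> \<pi> w" if r: "r \<in> carrier A" and w: "w \<in> carrier W" for r w
    proof -
      obtain a b where ab: "twisted_cycle X x a b" "w = twisted_class a b" using W w by meson
      show ?thesis
        unfolding ab(2) twisted_class_smult[OF ab(1) r, symmetric] \<pi>[OF ab(1)] \<pi>[OF tc_smult[OF ab(1) r]]
        by (rule coh_class_smult[OF X r twisted_cycleD(3)[OF ab(1)]])
    qed
  qed
  show "\<pi> ` carrier W = carrier ?V"
  proof
    show "\<pi> ` carrier W \<subseteq> carrier ?V"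
      using mod_hom_closed[OF \<open>\<pi> \<in> mod_hom A W ?V\<close>] by auto
    show "carrier ?V \<subseteq> \<pi> ` carrier W"
    proof
      fix v assume "v \<in> carrier ?V"
      then obtain b where b: "b \<in> carrier (cycles X 0)" "v = coh_class X 0 b" using V by meson
      obtain a where ab: "twisted_cycle X x a b" using lift[OF b(1)] by (rule exE)
      show "v \<in> \<pi> ` carrier W"
        by (rule image_eqI[OF _ twisted_class_closed[OF ab]]) (simp only: b(2) \<pi>[OF ab])
    qed
  qed
  show "{u \<in> carrier ?U. \<tau> u = \<zero>\<^bsub>W\<^esub>} = multiples ?U x"
  proof (intro equalityI subsetI)
    fix u assume "u \<in> {u \<in> carrier ?U. \<tau> u = \<zero>\<^bsub>W\<^esub>}"
    then have u: "u \<in> carrier ?U" "\<tau> u = \<zero>\<^bsub>W\<^esub>" by simp_all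
    obtain a where a: "a \<in> carrier (cycles X (-1))" "u = coh_class X (-1) a" using U u(1) by meson
    have "twisted_class a \<zero>\<^bsub>obj X 0\<^esub> = \<zero>\<^bsub>W\<^esub>" using u(2) by (simp only: a(2) \<tau>[OF a(1)])
    then obtain y z where y: "y \<in> carrier (obj X (-2))" and z: "z \<in> carrier (obj X (-1))"
      and eq: "a = diff X (-2) y \<oplus>\<^bsub>obj X (-1)\<^esub> x \<odot>\<^bsub>obj X (-1)\<^esub> z" "\<zero>\<^bsub>obj X 0\<^esub> = diff X (-1) z"
      unfolding twisted_class_eq_zero_iff[OF tc[OF a(1)]] by (elim bexE conjE) (rule that)
    have z': "z \<in> carrier (cycles X (-1))" using z eq(2) by simp
    have xz: "x \<odot>\<^bsub>obj X (-1)\<^esub> z \<in> carrier (cycles X (-1))" using Z1.smult_closed[OF x z'] by simp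
    have "coh_class X (-1) a = coh_class X (-1) (x \<odot>\<^bsub>obj X (-1)\<^esub> z)"
      unfolding coh_class_eq_iff[OF X a(1) xz] using y eq(1) by (intro bexI[of _ y]) simp_all
    then have "u = x \<odot>\<^bsub>?U\<^esub> coh_class X (-1) z" using a(2) coh_class_smult[OF X x z'] by simp
    then show "u \<in> multiples ?U x" unfolding multiples_def using coh_class_closed[OF X z'] by (rule image_eqI)
  next
    fix u assume "u \<in> multiples ?U x"
    then obtain u' where u': "u' \<in> carrier ?U" "u = x \<odot>\<^bsub>?U\<^esub> u'" by (auto simp: multiples_def)
    obtain z where z: "z \<in> carrier (cycles X (-1))" "u' = coh_class X (-1) z" using U u'(1) by meson
    have xz: "x \<odot>\<^bsub>obj X (-1)\<^esub> z \<in> carrier (cycles X (-1))" using Z1.smult_closed[OF x z(1)] by simp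
    have u: "u = coh_class X (-1) (x \<odot>\<^bsub>obj X (-1)\<^esub> z)"
      using u'(2) z(2) coh_class_smult[OF X x z(1)] by simp
    have "twisted_class (x \<odot>\<^bsub>obj X (-1)\<^esub> z) \<zero>\<^bsub>obj X 0\<^esub> = \<zero>\<^bsub>W\<^esub>"
      unfolding twisted_class_eq_zero_iff[OF tc[OF xz]]
      using z(1) x complex_diff_zero[OF X, of "-2"]
      by (intro bexI[of _ "\<zero>\<^bsub>obj X (-2)\<^esub>"] bexI[of _ z]) simp_all
    then show "u \<in> {u \<in> carrier ?U. \<tau> u = \<zero>\<^bsub>W\<^esub>}"
      using coh_class_closed[OF X xz] by (simp only: u \<tau>[OF xz] mem_Collect_eq simp_thms)
  qed
  show "\<tau> ` carrier ?U = {w \<in> carrier W. \<pi> w = \<zero>\<^bsub>?V\<^esub>}"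
  proof (intro equalityI subsetI)
    fix w assume "w \<in> \<tau> ` carrier ?U"
    then obtain u where u: "u \<in> carrier ?U" "w = \<tau> u" by auto
    obtain a where a: "a \<in> carrier (cycles X (-1))" "u = coh_class X (-1) a" using U u(1) by meson
    have w: "w = twisted_class a \<zero>\<^bsub>obj X 0\<^esub>" by (simp only: u(2) a(2) \<tau>[OF a(1)])
    show "w \<in> {w \<in> carrier W. \<pi> w = \<zero>\<^bsub>?V\<^esub>}"
      using twisted_class_closed[OF tc[OF a(1)]] \<pi>[OF tc[OF a(1)]] coh_class_zero[OF X, of 0] by (simp add: w)
  next
    fix w assume "w \<in> {w \<in> carrier W. \<pi> w = \<zero>\<^bsub>?V\<^esub>}"
    then have w: "w \<in> carrier W" "\<pi> w = \<zero>\<^bsub>?V\<^esub>" by simp_all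
    obtain a b where ab: "twisted_cycle X x a b" "w = twisted_class a b" using W w(1) by meson
    note D = twisted_cycleD[OF ab(1)]
    have "coh_class X 0 b = \<zero>\<^bsub>?V\<^esub>" using w(2) by (simp only: ab(2) \<pi>[OF ab(1)])
    then obtain z where z0: "z \<in> carrier (obj X (0 - 1))" "b = diff X (0 - 1) z"
      unfolding coh_class_eq_zero_iff[OF X D(3)] by (rule bexE) (rule that)
    then have z: "z \<in> carrier (obj X (-1))" "b = diff X (-1) z" by simp_all
    define a' where "a' = a \<ominus>\<^bsub>obj X (-1)\<^esub> x \<odot>\<^bsub>obj X (-1)\<^esub> z"
    have a'cl: "a' \<in> carrier (obj X (-1))" using D(1) z(1) x by (simp add: a'_def)
    have a_eq: "a = a' \<oplus>\<^bsub>obj X (-1)\<^esub> x \<odot>\<^bsub>obj X (-1)\<^esub> z"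
      using module_minus_eq_iff[OF X.module_axioms D(1) X.smult_closed[OF x z(1)] a'cl] a'_def by simp
    have "diff X (-1) a' = \<zero>\<^bsub>obj X 0\<^esub>"
      using D z x mod_hom_smult[OF diff_mod_hom(1) x z(1)]
      by (simp add: a'_def mod_hom_minus[OF X.module_axioms X.module_axioms diff_mod_hom(1)]
          module_minus_self[OF X.module_axioms])
    then have a': "a' \<in> carrier (cycles X (-1))" using a'cl by simp
    have bz: "twisted_cycle X x (x \<odot>\<^bsub>obj X (-1)\<^esub> z) b"
      using z x D(3) mod_hom_smult[OF diff_mod_hom(1) x z(1)] by (simp add: twisted_cycle_def)
    have "twisted_class (x \<odot>\<^bsub>obj X (-1)\<^esub> z) b = \<zero>\<^bsub>W\<^esub>"
      unfolding twisted_class_eq_zero_iff[OF bz]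
      using z x complex_diff_zero[OF X, of "-2"]
      by (intro bexI[of _ "\<zero>\<^bsub>obj X (-2)\<^esub>"] bexI[of _ z]) simp_all
    then have "w = twisted_class a' \<zero>\<^bsub>obj X 0\<^esub> \<oplus>\<^bsub>W\<^esub> \<zero>\<^bsub>W\<^esub>"
      using twisted_class_add[OF tc[OF a'] bz] a_eq ab(2) D(2) by simp
    also have "\<dots> = \<tau> (coh_class X (-1) a')"
      unfolding \<tau>[OF a'] using twisted_class_closed[OF tc[OF a']] W_module
      by (intro abelian_monoid.r_zero) (simp_all add: module_def abelian_group_def)
    finally show "w \<in> \<tau> ` carrier ?U" using coh_class_closed[OF X a'] by (rule image_eqI)
  qed
qed

end

section \<open>The cone of a morphism from a projective module\<close>

lemma mapping_cone_simps:
  "obj (mapping_cone C D g) n = direct_sum (obj C (n + 1)) (obj D n)"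
  "diff (mapping_cone C D g) n p = (\<ominus>\<^bsub>obj C (n + 1 + 1)\<^esub> diff C (n + 1) (fst p),
     g (n + 1) (fst p) \<oplus>\<^bsub>obj D (n + 1)\<^esub> diff D n (snd p))"
  by (simp_all add: mapping_cone_def)

lemma mapping_cone_is_complex:
  assumes C: "is_complex A C" and D: "is_complex A D" and g: "chain_map A C D g"
  shows "is_complex A (mapping_cone C D g)"
  unfolding is_complex_def
proof (intro allI conjI ballI)
  let ?K = "mapping_cone C D g"
  interpret C: module A "obj C n" for n by (rule complex_module[OF C])
  interpret D: module A "obj D n" for n by (rule complex_module[OF D])
  fix n
  show "module A (obj ?K n)"
    unfolding mapping_cone_simps by (rule direct_sum_module[OF C.module_axioms D.module_axioms])
  have 1: "(\<lambda>p. \<ominus>\<^bsub>obj C (n + 1 + 1)\<^esub> diff C (n + 1) (fst p)) \<in> mod_hom A (obj ?K n) (obj C (n + 1 + 1))"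
    unfolding mapping_cone_simps
    by (rule mod_hom_neg_fun[OF C.module_axioms mod_hom_compose[OF mod_hom_fst complex_diff[OF C]]])
  have 2: "(\<lambda>p. g (n + 1) (fst p) \<oplus>\<^bsub>obj D (n + 1)\<^esub> diff D n (snd p)) \<in> mod_hom A (obj ?K n) (obj D (n + 1))"
    unfolding mapping_cone_simps
    by (rule mod_hom_add_fun[OF D.module_axioms mod_hom_compose[OF mod_hom_fst chain_map_mod_hom[OF g]]
        mod_hom_compose[OF mod_hom_snd complex_diff[OF D]]])
  show "diff ?K n \<in> mod_hom A (obj ?K n) (obj ?K (n + 1))"
    using mod_hom_pair[OF 1 2] by (simp add: mapping_cone_simps[abs_def])
  fix p assume "p \<in> carrier (obj ?K n)"
  then have p: "fst p \<in> carrier (obj C (n + 1))" "snd p \<in> carrier (obj D n)"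
    by (auto simp: mapping_cone_simps)
  note cl = mod_hom_closed[OF complex_diff[OF C] p(1)] mod_hom_closed[OF complex_diff[OF D] p(2)]
    chain_map_closed[OF g p(1)]
  note cl' = mod_hom_closed[OF complex_diff[OF D] cl(3)]
  show "diff ?K (n + 1) (diff ?K n p) = \<zero>\<^bsub>obj ?K (n + 1 + 1)\<^esub>"
    unfolding mapping_cone_simps direct_sum_simps fst_conv snd_conv
      mod_hom_neg[OF C.module_axioms C.module_axioms complex_diff[OF C] cl(1)]
      mod_hom_neg[OF C.module_axioms D.module_axioms chain_map_mod_hom[OF g] cl(1)]
      mod_hom_add[OF complex_diff[OF D] cl(3,2)] complex_diff_diff[OF C p(1)] complex_diff_diff[OF D p(2)]
      chain_map_diff[OF g p(1), symmetric] module_neg_zero[OF C.module_axioms]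
    using cl' by (simp add: D.l_neg)
qed

text \<open>
  The pullback of \<open>\<phi>\<close> along the differential: elements of \<open>F\<close> together with a reason why their image
  in \<open>H\<^sup>0(X)\<close> vanishes.
\<close>

definition null_lifts :: "('a, 'm) module \<Rightarrow> ('a, 'm) cplx \<Rightarrow> ('m \<Rightarrow> 'm) \<Rightarrow> ('a, 'm \<times> 'm) module" where
  "null_lifts F X \<phi> = kernel_module (direct_sum F (obj X (-1))) (obj X 0)
     (\<lambda>q. \<phi> (fst q) \<ominus>\<^bsub>obj X 0\<^esub> diff X (-1) (snd q))"

lemma null_lifts_simps:
  assumes F: "module A F" and X: "is_complex A X" and \<phi>: "\<phi> \<in> mod_hom A F (cycles X 0)"
  shows "module A (null_lifts F X \<phi>)"
    and "carrier (null_lifts F X \<phi>) =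
      {(z, w). z \<in> carrier F \<and> w \<in> carrier (obj X (-1)) \<and> \<phi> z = diff X (-1) w}"
    and "zero (null_lifts F X \<phi>) = (\<zero>\<^bsub>F\<^esub>, \<zero>\<^bsub>obj X (-1)\<^esub>)"
    and "q \<oplus>\<^bsub>null_lifts F X \<phi>\<^esub> q' = (fst q \<oplus>\<^bsub>F\<^esub> fst q', snd q \<oplus>\<^bsub>obj X (-1)\<^esub> snd q')"
    and "a \<odot>\<^bsub>null_lifts F X \<phi>\<^esub> q = (a \<odot>\<^bsub>F\<^esub> fst q, a \<odot>\<^bsub>obj X (-1)\<^esub> snd q)"
proof -
  interpret X: module A "obj X n" for n by (rule complex_module[OF X])
  have d: "diff X (-1) \<in> mod_hom A (obj X (-1)) (obj X 0)" using complex_diff'[OF X, of 0] by simp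
  have \<phi>': "\<phi> \<in> mod_hom A F (obj X 0)" using \<phi> by (auto simp: mod_hom_def)
  show "module A (null_lifts F X \<phi>)"
    unfolding null_lifts_def
    by (rule kernel_module_module[OF direct_sum_module[OF F X.module_axioms] X.module_axioms
        mod_hom_minus_fun[OF X.module_axioms mod_hom_compose[OF mod_hom_fst \<phi>'] mod_hom_compose[OF mod_hom_snd d]]])
  show "carrier (null_lifts F X \<phi>) =
      {(z, w). z \<in> carrier F \<and> w \<in> carrier (obj X (-1)) \<and> \<phi> z = diff X (-1) w}"
    using mod_hom_closed[OF \<phi>'] mod_hom_closed[OF d]
    by (auto simp: null_lifts_def module_minus_eq_iff[OF X.module_axioms])
qed (simp_all add: null_lifts_def)

text \<open>
  If \<open>Z\<close> were \<open>F\<close> itself, \<open>null_lifts\<close> would consist of the cycles of degree \<open>-1\<close> of the cone, up to the sign of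
  the second component. In general a cycle \<open>(\<zeta>, a)\<close> is moved to the form \<open>(t z, -w)\<close>, with \<open>z = s \<zeta>\<close>, by
  a boundary, because \<open>\<zeta>\<close> and \<open>t z\<close> have the same class in \<open>H\<^sup>0(Z)\<close>. For the kernel, a boundary of this form comes from
  an element of \<open>Z\<^sup>-\<^sup>1\<close> that is a cycle, hence a boundary as \<open>H\<^sup>-\<^sup>1(Z) = 0\<close>.
\<close>

lemma cone_cohomology_presentation:
  assumes F: "projective_module A F" and X: "is_complex A X" and r: "(Z, s, g) \<in> roofs A (concentrated F) X"
  obtains \<phi> p where "\<phi> \<in> mod_hom A F (cycles X 0)"
    and "\<And>z. z \<in> carrier F \<Longrightarrow> coh_class X 0 (\<phi> z) = roof_H0 F X (Z, s, g) z"
    and "module A (cohomology (mapping_cone Z X g) (-1))"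
    and "p \<in> mod_hom A (null_lifts F X \<phi>) (cohomology (mapping_cone Z X g) (-1))"
    and "p ` carrier (null_lifts F X \<phi>) = carrier (cohomology (mapping_cone Z X g) (-1))"
    and "\<And>z w. (z, w) \<in> carrier (null_lifts F X \<phi>) \<Longrightarrow>
      p (z, w) = \<zero>\<^bsub>cohomology (mapping_cone Z X g) (-1)\<^esub> \<longleftrightarrow>
      z = \<zero>\<^bsub>F\<^esub> \<and> (\<exists>y\<in>carrier (obj X (-2)). w = diff X (-2) y)"
proof -
  have FM: "module A F" using F by (simp add: projective_module_def)
  have CF: "is_complex A (concentrated F)" by (rule concentrated_is_complex[OF FM])
  have Z: "is_complex A Z" and s: "quasi_iso A Z (concentrated F) s" and g: "chain_map A Z X g"
    using r by (auto simp: roofs_def)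
  note sm = quasi_iso_chain_map[OF s]
  interpret F: module A F by (rule FM)
  interpret Z: module A "obj Z n" for n by (rule complex_module[OF Z])
  interpret X: module A "obj X n" for n by (rule complex_module[OF X])
  let ?C = "mapping_cone Z X g"
  have C: "is_complex A ?C" by (rule mapping_cone_is_complex[OF Z X g])
  note dX = complex_diff'[OF X, of 0, simplified] complex_diff'[OF X, of "-1", simplified]
  note dZ = complex_diff'[OF Z, of 0, simplified] complex_diff'[OF Z, of "-1", simplified]
  note gm = chain_map_mod_hom[OF g]
  obtain t where t: "t \<in> mod_hom A F (cycles Z 0)" "\<forall>z\<in>carrier F. s 0 (t z) = z"
    by (rule bexE[OF roof_section[OF F r]]) (rule that)
  have t': "t \<in> mod_hom A F (obj Z 0)" using t(1) by (auto simp: mod_hom_def)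
  have tz: "t z \<in> carrier (obj Z 0)" "diff Z 0 (t z) = \<zero>\<^bsub>obj Z 1\<^esub>" if "z \<in> carrier F" for z
    using mod_hom_closed[OF t(1) that] by simp_all
  have t0: "t \<zero>\<^bsub>F\<^esub> = \<zero>\<^bsub>obj Z 0\<^esub>" by (rule mod_hom_zero[OF FM Z.module_axioms t'])
  have g0: "g 0 \<in> mod_hom A (cycles Z 0) (cycles X 0)"
    using gm[of 0] chain_map_cycle[OF Z X g, of _ 0] by (auto simp: mod_hom_def)
  define \<phi> where "\<phi> = (\<lambda>z. g 0 (t z))"
  have \<phi>: "\<phi> \<in> mod_hom A F (cycles X 0)" unfolding \<phi>_def by (rule mod_hom_compose[OF t(1) g0])
  note N = null_lifts_simps[OF FM X \<phi>]
  have \<phi>H0: "coh_class X 0 (\<phi> z) = roof_H0 F X (Z, s, g) z" if "z \<in> carrier F" for z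
    unfolding \<phi>_def by (rule roof_H0_section[OF F X r t that, symmetric])
  define e where "e = (\<lambda>q. (t (fst q), \<ominus>\<^bsub>obj X (-1)\<^esub> snd q))"
  have Ccyc: "q \<in> carrier (cycles ?C (-1)) \<longleftrightarrow> fst q \<in> carrier (cycles Z 0) \<and> snd q \<in> carrier (obj X (-1)) \<and>
      g 0 (fst q) \<oplus>\<^bsub>obj X 0\<^esub> diff X (-1) (snd q) = \<zero>\<^bsub>obj X 0\<^esub>" for q
  proof -
    have "\<ominus>\<^bsub>obj Z 1\<^esub> w = \<zero>\<^bsub>obj Z 1\<^esub> \<longleftrightarrow> w = \<zero>\<^bsub>obj Z 1\<^esub>" if "w \<in> carrier (obj Z 1)" for w
      using that Z.minus_minus module_neg_zero[OF Z.module_axioms] by metis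
    then show ?thesis
      using mod_hom_closed[OF complex_diff[OF Z], of _ 0]
      by (cases q) (auto simp: mapping_cone_simps)
  qed
  have e: "e \<in> mod_hom A (null_lifts F X \<phi>) (cycles ?C (-1))"
  proof (rule mod_homI)
    fix q assume q: "q \<in> carrier (null_lifts F X \<phi>)"
    then have q': "fst q \<in> carrier F" "snd q \<in> carrier (obj X (-1))" "g 0 (t (fst q)) = diff X (-1) (snd q)"
      unfolding N(2) by (auto simp: \<phi>_def)
    show "e q \<in> carrier (cycles ?C (-1))"
      unfolding Ccyc using q' tz[OF q'(1)] mod_hom_closed[OF dX(1) q'(2)]
      by (simp add: e_def mod_hom_neg[OF X.module_axioms X.module_axioms dX(1)] X.r_neg)
    show "e (a \<odot>\<^bsub>null_lifts F X \<phi>\<^esub> q) = a \<odot>\<^bsub>cycles ?C (-1)\<^esub> e q" if "a \<in> carrier A" for a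
      using that q' by (simp add: e_def N mapping_cone_simps mod_hom_smult[OF t'] X.smult_r_minus)
    fix q2 assume "q2 \<in> carrier (null_lifts F X \<phi>)"
    then have q2: "fst q2 \<in> carrier F" "snd q2 \<in> carrier (obj X (-1))" unfolding N(2) by auto
    show "e (q \<oplus>\<^bsub>null_lifts F X \<phi>\<^esub> q2) = e q \<oplus>\<^bsub>cycles ?C (-1)\<^esub> e q2"
      using q' q2 by (simp add: e_def N mapping_cone_simps mod_hom_add[OF t'] X.minus_add X.a_comm)
  qed
  define p where "p = (\<lambda>q. coh_class ?C (-1) (e q))"
  have p: "p \<in> mod_hom A (null_lifts F X \<phi>) (cohomology ?C (-1))"
    unfolding p_def by (rule mod_hom_compose[OF e coh_class_mod_hom[OF C]])
  have surj: "p ` carrier (null_lifts F X \<phi>) = carrier (cohomology ?C (-1))"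
  proof
    show "p ` carrier (null_lifts F X \<phi>) \<subseteq> carrier (cohomology ?C (-1))" using mod_hom_closed[OF p] by auto
    show "carrier (cohomology ?C (-1)) \<subseteq> p ` carrier (null_lifts F X \<phi>)"
    proof
      fix u assume "u \<in> carrier (cohomology ?C (-1))"
      then obtain q where q: "q \<in> carrier (cycles ?C (-1))" "u = coh_class ?C (-1) q"
        by (rule cohomologyE[OF C])
      define \<zeta> where "\<zeta> = fst q"
      define a where "a = snd q"
      have \<zeta>: "\<zeta> \<in> carrier (cycles Z 0)" and a: "a \<in> carrier (obj X (-1))"
        and \<zeta>a: "g 0 \<zeta> \<oplus>\<^bsub>obj X 0\<^esub> diff X (-1) a = \<zero>\<^bsub>obj X 0\<^esub>"
        using q(1) unfolding Ccyc by (simp_all add: \<zeta>_def a_def)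
      have \<zeta>': "\<zeta> \<in> carrier (obj Z 0)" using \<zeta> by simp
      define z where "z = s 0 \<zeta>"
      have z: "z \<in> carrier F" using chain_map_closed[OF sm \<zeta>'] by (simp add: z_def)
      have "coh_class Z 0 \<zeta> = coh_class Z 0 (t z)"
        by (rule quasi_iso_inj[OF Z CF s \<zeta> mod_hom_closed[OF t(1) z]]) (use t(2) z in \<open>simp add: z_def\<close>)
      then obtain \<eta> where \<eta>0: "\<eta> \<in> carrier (obj Z (0 - 1))" "\<zeta> = diff Z (0 - 1) \<eta> \<oplus>\<^bsub>obj Z 0\<^esub> t z"
        unfolding coh_class_eq_iff[OF Z \<zeta> mod_hom_closed[OF t(1) z]] by (rule bexE) (rule that)
      then have \<eta>: "\<eta> \<in> carrier (obj Z (-1))" "\<zeta> = diff Z (-1) \<eta> \<oplus>\<^bsub>obj Z 0\<^esub> t z" by simp_all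
      note d\<eta> = mod_hom_closed[OF dZ(1) \<eta>(1)] and g\<eta> = chain_map_closed[OF g \<eta>(1)]
      have gd: "diff X (-1) (g (-1) \<eta>) = g 0 (diff Z (-1) \<eta>)" using chain_map_diff[OF g \<eta>(1)] by simp
      define w where "w = \<ominus>\<^bsub>obj X (-1)\<^esub> (a \<oplus>\<^bsub>obj X (-1)\<^esub> g (-1) \<eta>)"
      have w: "w \<in> carrier (obj X (-1))" using a g\<eta> by (simp add: w_def)
      have cl: "g 0 (t z) \<in> carrier (obj X 0)" "g 0 (diff Z (-1) \<eta>) \<in> carrier (obj X 0)"
        "diff X (-1) a \<in> carrier (obj X 0)"
        using chain_map_closed[OF g tz(1)[OF z]] chain_map_closed[OF g d\<eta>] mod_hom_closed[OF dX(1) a] by simp_all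
      have "g 0 (t z) \<oplus>\<^bsub>obj X 0\<^esub> (diff X (-1) a \<oplus>\<^bsub>obj X 0\<^esub> g 0 (diff Z (-1) \<eta>)) = \<zero>\<^bsub>obj X 0\<^esub>"
        using \<zeta>a cl unfolding \<eta>(2) mod_hom_add[OF gm d\<eta> tz(1)[OF z]] by (simp add: X.a_ac)
      then have "\<ominus>\<^bsub>obj X 0\<^esub> (diff X (-1) a \<oplus>\<^bsub>obj X 0\<^esub> g 0 (diff Z (-1) \<eta>)) = g 0 (t z)"
        by (rule X.minus_equality) (use cl in simp_all)
      then have "g 0 (t z) = \<ominus>\<^bsub>obj X 0\<^esub> (diff X (-1) a \<oplus>\<^bsub>obj X 0\<^esub> g 0 (diff Z (-1) \<eta>))"
        by (rule sym)
      also have "\<dots> = diff X (-1) w"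
        unfolding w_def using a g\<eta>
        by (simp add: mod_hom_neg[OF X.module_axioms X.module_axioms dX(1)] mod_hom_add[OF dX(1)] gd)
      finally have zw: "(z, w) \<in> carrier (null_lifts F X \<phi>)" using z w unfolding N(2) by (simp add: \<phi>_def)
      have "q = diff ?C (-1 - 1) (\<ominus>\<^bsub>obj Z (-1)\<^esub> \<eta>, \<zero>\<^bsub>obj X (-2)\<^esub>) \<oplus>\<^bsub>obj ?C (-1)\<^esub> e (z, w)"
      proof (rule prod_eqI)
        show "fst q = fst (diff ?C (-1 - 1) (\<ominus>\<^bsub>obj Z (-1)\<^esub> \<eta>, \<zero>\<^bsub>obj X (-2)\<^esub>) \<oplus>\<^bsub>obj ?C (-1)\<^esub> e (z, w))"
          using \<eta> d\<eta> by (simp add: \<zeta>_def[symmetric] mapping_cone_simps e_def Z.minus_minus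
              mod_hom_neg[OF Z.module_axioms Z.module_axioms dZ(1)])
        show "snd q = snd (diff ?C (-1 - 1) (\<ominus>\<^bsub>obj Z (-1)\<^esub> \<eta>, \<zero>\<^bsub>obj X (-2)\<^esub>) \<oplus>\<^bsub>obj ?C (-1)\<^esub> e (z, w))"
          using \<eta>(1) a g\<eta> complex_diff_zero[OF X, of "-2"]
          by (simp add: a_def[symmetric] mapping_cone_simps e_def w_def X.minus_minus X.minus_add X.a_ac X.r_neg1 X.r_neg2
              mod_hom_neg[OF Z.module_axioms X.module_axioms gm] X.r_neg X.l_neg)
      qed
      moreover have "(\<ominus>\<^bsub>obj Z (-1)\<^esub> \<eta>, \<zero>\<^bsub>obj X (-2)\<^esub>) \<in> carrier (obj ?C (-1 - 1))"
        using \<eta>(1) by (simp add: mapping_cone_simps)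
      ultimately have "coh_class ?C (-1) q = p (z, w)"
        unfolding p_def coh_class_eq_iff[OF C q(1) mod_hom_closed[OF e zw]] by (rule rev_bexI[rotated])
      then show "u \<in> p ` carrier (null_lifts F X \<phi>)" unfolding q(2) using zw by (rule image_eqI)
    qed
  qed
  have ker: "p (z, w) = \<zero>\<^bsub>cohomology ?C (-1)\<^esub> \<longleftrightarrow>
      z = \<zero>\<^bsub>F\<^esub> \<and> (\<exists>y\<in>carrier (obj X (-2)). w = diff X (-2) y)"
    if zw: "(z, w) \<in> carrier (null_lifts F X \<phi>)" for z w
  proof -
    have z: "z \<in> carrier F" and w: "w \<in> carrier (obj X (-1))" using zw unfolding N(2) by simp_all
    have "p (z, w) = \<zero>\<^bsub>cohomology ?C (-1)\<^esub> \<longleftrightarrow>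
      (\<exists>y\<in>carrier (obj ?C (-1 - 1)). e (z, w) = diff ?C (-1 - 1) y)"
      unfolding p_def by (rule coh_class_eq_zero_iff[OF C mod_hom_closed[OF e zw]])
    also have "\<dots> \<longleftrightarrow> (\<exists>\<eta>\<in>carrier (obj Z (-1)). \<exists>y\<in>carrier (obj X (-2)).
        t z = \<ominus>\<^bsub>obj Z 0\<^esub> diff Z (-1) \<eta> \<and> \<ominus>\<^bsub>obj X (-1)\<^esub> w = g (-1) \<eta> \<oplus>\<^bsub>obj X (-1)\<^esub> diff X (-2) y)"
      by (simp add: mapping_cone_simps e_def)
    also have "\<dots> \<longleftrightarrow> z = \<zero>\<^bsub>F\<^esub> \<and> (\<exists>y\<in>carrier (obj X (-2)). w = diff X (-2) y)"
    proof
      assume "\<exists>\<eta>\<in>carrier (obj Z (-1)). \<exists>y\<in>carrier (obj X (-2)).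
        t z = \<ominus>\<^bsub>obj Z 0\<^esub> diff Z (-1) \<eta> \<and> \<ominus>\<^bsub>obj X (-1)\<^esub> w = g (-1) \<eta> \<oplus>\<^bsub>obj X (-1)\<^esub> diff X (-2) y"
      then obtain \<eta> y where \<eta>: "\<eta> \<in> carrier (obj Z (-1))" and y: "y \<in> carrier (obj X (-2))"
        and eq: "t z = \<ominus>\<^bsub>obj Z 0\<^esub> diff Z (-1) \<eta>" "\<ominus>\<^bsub>obj X (-1)\<^esub> w = g (-1) \<eta> \<oplus>\<^bsub>obj X (-1)\<^esub> diff X (-2) y"
        by (elim bexE conjE) (rule that)
      note d\<eta> = mod_hom_closed[OF dZ(1) \<eta>]
      have s0: "s 0 \<in> mod_hom A (obj Z 0) F"
        using chain_map_mod_hom[OF sm, of 0] by (simp add: concentrated_def)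
      have "s 0 (diff Z (-1) \<eta>) = \<zero>\<^bsub>F\<^esub>" using chain_map_diff[OF sm \<eta>] by simp
      then have "z = \<zero>\<^bsub>F\<^esub>"
        using t(2) z eq(1) mod_hom_neg[OF Z.module_axioms FM s0 d\<eta>] module_neg_zero[OF FM] by force
      moreover have "\<exists>y\<in>carrier (obj X (-2)). w = diff X (-2) y"
      proof -
        have "\<ominus>\<^bsub>obj Z 0\<^esub> diff Z (-1) \<eta> = \<zero>\<^bsub>obj Z 0\<^esub>" using eq(1) t0 \<open>z = \<zero>\<^bsub>F\<^esub>\<close> by simp
        then have "diff Z (-1) \<eta> = \<zero>\<^bsub>obj Z 0\<^esub>"
          using Z.minus_minus[OF d\<eta>] module_neg_zero[OF Z.module_axioms] by metis
        then have "\<eta> \<in> carrier (cycles Z (-1))" using \<eta> by simp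
        then have "\<exists>\<theta>\<in>carrier (obj Z (-1 - 1)). \<eta> = diff Z (-1 - 1) \<theta>"
          by (intro quasi_iso_concentrated_exact[OF Z FM s]) simp
        then obtain \<theta> where \<theta>0: "\<theta> \<in> carrier (obj Z (-1 - 1))" "\<eta> = diff Z (-1 - 1) \<theta>"
          by (rule bexE) (rule that)
        then have \<theta>: "\<theta> \<in> carrier (obj Z (-2))" "\<eta> = diff Z (-2) \<theta>" by simp_all
        have g\<eta>: "g (-1) \<eta> = diff X (-2) (g (-2) \<theta>)" using chain_map_diff[OF g \<theta>(1)] \<theta>(2) by simp
        note g\<theta> = chain_map_closed[OF g \<theta>(1)]
        have "w = \<ominus>\<^bsub>obj X (-1)\<^esub> (\<ominus>\<^bsub>obj X (-1)\<^esub> w)" using w by (simp add: X.minus_minus)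
        also have "\<dots> = diff X (-2) (\<ominus>\<^bsub>obj X (-2)\<^esub> (g (-2) \<theta> \<oplus>\<^bsub>obj X (-2)\<^esub> y))"
          unfolding eq(2) g\<eta> using g\<theta> y
          by (simp add: mod_hom_neg[OF X.module_axioms X.module_axioms dX(2)] mod_hom_add[OF dX(2)])
        finally show ?thesis
          using g\<theta> y by (intro bexI[of _ "\<ominus>\<^bsub>obj X (-2)\<^esub> (g (-2) \<theta> \<oplus>\<^bsub>obj X (-2)\<^esub> y)"]) simp_all
      qed
      ultimately show "z = \<zero>\<^bsub>F\<^esub> \<and> (\<exists>y\<in>carrier (obj X (-2)). w = diff X (-2) y)" by simp
    next
      assume "z = \<zero>\<^bsub>F\<^esub> \<and> (\<exists>y\<in>carrier (obj X (-2)). w = diff X (-2) y)"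
      then obtain y where y: "z = \<zero>\<^bsub>F\<^esub>" "y \<in> carrier (obj X (-2))" "w = diff X (-2) y" by auto
      show "\<exists>\<eta>\<in>carrier (obj Z (-1)). \<exists>y\<in>carrier (obj X (-2)).
        t z = \<ominus>\<^bsub>obj Z 0\<^esub> diff Z (-1) \<eta> \<and> \<ominus>\<^bsub>obj X (-1)\<^esub> w = g (-1) \<eta> \<oplus>\<^bsub>obj X (-1)\<^esub> diff X (-2) y"
        using y t0 complex_diff_zero[OF Z, of "-1"] chain_map_zero[OF Z X g, of "-1"]
          mod_hom_closed[OF dX(2) y(2)]
        by (intro bexI[of _ "\<zero>\<^bsub>obj Z (-1)\<^esub>"] bexI[of _ "\<ominus>\<^bsub>obj X (-2)\<^esub> y"])
          (simp_all add: module_neg_zero[OF Z.module_axioms] mod_hom_neg[OF X.module_axioms X.module_axioms dX(2)])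
    qed
    finally show ?thesis .
  qed
  show thesis by (rule that[OF \<phi> \<phi>H0 cohomology_module[OF C] p surj ker])
qed

text \<open>
  The maps are induced by \<open>a \<mapsto> (0, a)\<close> and \<open>(z, w) \<mapsto> z\<close> on \<open>null_lifts\<close>. The pair \<open>(0, a)\<close> belongs to \<open>null_lifts\<close>
  if and only if \<open>a\<close> is a cycle, and \<open>p\<close> kills it if and only if \<open>a\<close> is a boundary.
\<close>

lemma cone_short_exact:
  fixes X :: "('a, 'm) cplx"
  assumes F: "module A F" and X: "is_complex A X" and \<phi>: "\<phi> \<in> mod_hom A F (cycles X 0)"
    and \<alpha>: "\<alpha> \<in> mod_hom A F (cohomology X 0)" "\<And>z. z \<in> carrier F \<Longrightarrow> coh_class X 0 (\<phi> z) = \<alpha> z"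
    and M: "module A M" and p: "p \<in> mod_hom A (null_lifts F X \<phi>) M" "p ` carrier (null_lifts F X \<phi>) = carrier M"
    and ker: "\<And>z w. (z, w) \<in> carrier (null_lifts F X \<phi>) \<Longrightarrow> p (z, w) = \<zero>\<^bsub>M\<^esub> \<longleftrightarrow>
      z = \<zero>\<^bsub>F\<^esub> \<and> (\<exists>y\<in>carrier (obj X (-2)). w = diff X (-2) y)"
  shows "\<exists>\<iota> \<rho>. short_exact A (cohomology X (-1)) M (kernel_module F (cohomology X 0) \<alpha>) \<iota> \<rho>"
proof -
  let ?U = "cohomology X (-1)" and ?K = "kernel_module F (cohomology X 0) \<alpha>" and ?N = "null_lifts F X \<phi>"
  interpret F: module A F by (rule F)
  interpret X: module A "obj X m" for m by (rule complex_module[OF X])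
  note N = null_lifts_simps[OF F X \<phi>]
  have U: "module A ?U" by (rule cohomology_module[OF X])
  have K: "module A ?K" by (rule kernel_module_module[OF F cohomology_module[OF X] \<alpha>(1)])
  have \<phi>0: "\<phi> \<zero>\<^bsub>F\<^esub> = \<zero>\<^bsub>obj X 0\<^esub>" using mod_hom_zero[OF F cycles_module[OF X] \<phi>] by simp
  have fst_ker: "fst \<in> mod_hom A ?N ?K"
  proof (rule mod_homI)
    fix q assume "q \<in> carrier ?N"
    then have q: "fst q \<in> carrier F" "snd q \<in> carrier (obj X (-1))" "\<phi> (fst q) = diff X (-1) (snd q)"
      unfolding N(2) by auto
    have "coh_class X 0 (\<phi> (fst q)) = \<zero>\<^bsub>cohomology X 0\<^esub>"
      using q(2,3) by (subst coh_class_eq_zero_iff[OF X mod_hom_closed[OF \<phi> q(1)]]) (auto intro!: bexI[of _ "snd q"])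
    then show "fst q \<in> carrier ?K" using q(1) \<alpha>(2) by simp
  qed (simp_all add: N)
  obtain \<rho> where \<rho>: "\<rho> \<in> mod_hom A M ?K" "\<forall>q\<in>carrier ?N. \<rho> (p q) = fst q"
  proof (rule bexE[OF mod_hom_factor[OF N(1) M K p fst_ker]])
    show "fst q = \<zero>\<^bsub>?K\<^esub>" if "q \<in> carrier ?N" "p q = \<zero>\<^bsub>M\<^esub>" for q
      using that ker[of "fst q" "snd q"] by simp
  qed (rule that)
  define e where "e = (\<lambda>a :: 'm. (\<zero>\<^bsub>F\<^esub>, a))"
  have e: "e \<in> mod_hom A (cycles X (-1)) ?N"
    by (rule mod_homI) (auto simp: e_def N(3-5), simp add: N(2) \<phi>0)
  have kere: "p (e a) = \<zero>\<^bsub>M\<^esub> \<longleftrightarrow> coh_class X (-1) a = \<zero>\<^bsub>?U\<^esub>" if a: "a \<in> carrier (cycles X (-1))" for a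
    using ker[of "\<zero>\<^bsub>F\<^esub>" a] mod_hom_closed[OF e a] coh_class_eq_zero_iff[OF X a] by (simp add: e_def)
  obtain \<iota> where \<iota>: "\<iota> \<in> mod_hom A ?U M" "\<forall>a\<in>carrier (cycles X (-1)). \<iota> (coh_class X (-1) a) = p (e a)"
  proof (rule bexE[OF mod_hom_factor[OF cycles_module[OF X] U M coh_class_mod_hom[OF X]
          carrier_cohomology[OF X, symmetric] mod_hom_compose[OF e p(1)]]])
    show "p (e a) = \<zero>\<^bsub>M\<^esub>" if "a \<in> carrier (cycles X (-1))" "coh_class X (-1) a = \<zero>\<^bsub>?U\<^esub>" for a
      using that kere by blast
  qed (rule that)
  have inj: "inj_on \<iota> (carrier ?U)"
  proof (rule mod_hom_inj_on[OF U M \<iota>(1)])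
    fix u assume u: "u \<in> carrier ?U" "\<iota> u = \<zero>\<^bsub>M\<^esub>"
    obtain a where a: "a \<in> carrier (cycles X (-1))" "u = coh_class X (-1) a"
      by (rule cohomologyE[OF X u(1)]) (rule that)
    then show "u = \<zero>\<^bsub>?U\<^esub>" using u(2) \<iota>(2) kere[OF a(1)] by metis
  qed
  have im: "\<iota> ` carrier ?U = {m \<in> carrier M. \<rho> m = \<zero>\<^bsub>?K\<^esub>}"
  proof (intro equalityI subsetI)
    fix m assume "m \<in> \<iota> ` carrier ?U"
    then obtain u where u: "u \<in> carrier ?U" "m = \<iota> u" by auto
    obtain a where a: "a \<in> carrier (cycles X (-1))" "u = coh_class X (-1) a"
      by (rule cohomologyE[OF X u(1)]) (rule that)
    have m: "m = p (e a)" using \<iota>(2) a u(2) by blast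
    note ea = mod_hom_closed[OF e a(1)]
    have "\<rho> m = \<zero>\<^bsub>F\<^esub>" using \<rho>(2) ea m by (simp add: e_def)
    then show "m \<in> {m \<in> carrier M. \<rho> m = \<zero>\<^bsub>?K\<^esub>}" using m mod_hom_closed[OF p(1) ea] by simp
  next
    fix m assume "m \<in> {m \<in> carrier M. \<rho> m = \<zero>\<^bsub>?K\<^esub>}"
    then have m: "m \<in> carrier M" "\<rho> m = \<zero>\<^bsub>F\<^esub>" by simp_all
    obtain q where q: "q \<in> carrier ?N" "m = p q" using m(1) p(2) by blast
    have "fst q = \<zero>\<^bsub>F\<^esub>" using \<rho>(2) q m(2) by simp
    then have q': "q = e (snd q)" by (simp add: e_def prod_eq_iff)
    have "\<phi> (fst q) = diff X (-1) (snd q)" "snd q \<in> carrier (obj X (-1))" using q(1) unfolding N(2) by auto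
    then have c: "snd q \<in> carrier (cycles X (-1))" using \<phi>0 \<open>fst q = \<zero>\<^bsub>F\<^esub>\<close> by simp
    have "m = \<iota> (coh_class X (-1) (snd q))" using \<iota>(2) c q(2) q' by metis
    then show "m \<in> \<iota> ` carrier ?U" using coh_class_closed[OF X c] by (rule image_eqI)
  qed
  have surj: "\<rho> ` carrier M = carrier ?K"
  proof (intro equalityI subsetI)
    show "z \<in> carrier ?K" if "z \<in> \<rho> ` carrier M" for z using that mod_hom_closed[OF \<rho>(1)] by blast
    fix z assume "z \<in> carrier ?K"
    then have z: "z \<in> carrier F" "\<alpha> z = \<zero>\<^bsub>cohomology X 0\<^esub>" by simp_all
    then have "coh_class X 0 (\<phi> z) = \<zero>\<^bsub>cohomology X 0\<^esub>" using \<alpha>(2) by simp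
    then obtain w where "w \<in> carrier (obj X (0 - 1))" "\<phi> z = diff X (0 - 1) w"
      unfolding coh_class_eq_zero_iff[OF X mod_hom_closed[OF \<phi> z(1)]] by (rule bexE) (rule that)
    then have zw: "(z, w) \<in> carrier ?N" unfolding N(2) using z(1) by simp
    then have "z = \<rho> (p (z, w))" using \<rho>(2) by simp
    then show "z \<in> \<rho> ` carrier M" using mod_hom_closed[OF p(1) zw] by (rule image_eqI)
  qed
  show ?thesis
    using \<iota>(1) \<rho>(1) inj im surj unfolding short_exact_def by blast
qed

section \<open>Comparison of the cone with the derived Hom module\<close>

context retraction_target
begin

text \<open>
  Since \<open>x V = 0\<close>, the map \<open>x \<phi>\<close> takes values in the boundaries and lifts along the differential.
\<close>

lemma twisted_lift:
  assumes F: "projective_module A F" and \<phi>: "\<phi> \<in> mod_hom A F (cycles X 0)"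
    and xV: "\<And>v. v \<in> carrier (cohomology X 0) \<Longrightarrow> x \<odot>\<^bsub>cohomology X 0\<^esub> v = \<zero>\<^bsub>cohomology X 0\<^esub>"
  obtains \<kappa> where "\<kappa> \<in> mod_hom A F (obj X (-1))"
    and "\<And>z. z \<in> carrier F \<Longrightarrow> twisted_cycle X x (\<kappa> z) (\<phi> z)"
    and "(\<lambda>z. twisted_class (\<kappa> z) (\<phi> z)) \<in> mod_hom A F W"
proof -
  interpret Z0: module A "cycles X 0" by (rule cycles_module[OF X])
  have \<phi>': "\<phi> \<in> mod_hom A F (obj X 0)" using \<phi> by (auto simp: mod_hom_def)
  have "x \<odot>\<^bsub>obj X 0\<^esub> \<phi> z \<in> diff X (-1) ` carrier (obj X (-1))" if z: "z \<in> carrier F" for z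
  proof -
    note \<phi>z = mod_hom_closed[OF \<phi> z]
    have "coh_class X 0 (x \<odot>\<^bsub>obj X 0\<^esub> \<phi> z) = \<zero>\<^bsub>cohomology X 0\<^esub>"
      using xV[OF coh_class_closed[OF X \<phi>z]] coh_class_smult[OF X x \<phi>z] by simp
    moreover have "x \<odot>\<^bsub>obj X 0\<^esub> \<phi> z \<in> carrier (cycles X 0)" using Z0.smult_closed[OF x \<phi>z] by simp
    ultimately show ?thesis using coh_class_eq_zero_iff[OF X, of _ 0] by auto
  qed
  then have "\<exists>\<kappa>\<in>mod_hom A F (obj X (-1)). \<forall>z\<in>carrier F. diff X (-1) (\<kappa> z) = x \<odot>\<^bsub>obj X 0\<^esub> \<phi> z"
    by (rule projective_lift_image[OF F X.module_axioms X.module_axioms diff_mod_hom(1)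
        mod_hom_smult_fun[OF X.module_axioms x \<phi>']])
  then obtain \<kappa> where \<kappa>: "\<kappa> \<in> mod_hom A F (obj X (-1))"
    "\<forall>z\<in>carrier F. diff X (-1) (\<kappa> z) = x \<odot>\<^bsub>obj X 0\<^esub> \<phi> z"
    by (rule bexE) (rule that)
  have tc: "twisted_cycle X x (\<kappa> z) (\<phi> z)" if "z \<in> carrier F" for z
    unfolding twisted_cycle_def using \<kappa>(2) mod_hom_closed[OF \<kappa>(1) that] mod_hom_closed[OF \<phi> that] that by blast
  have "(\<lambda>z. twisted_class (\<kappa> z) (\<phi> z)) \<in> mod_hom A F W"
    by (rule mod_homI)
      (simp_all add: twisted_class_closed tc mod_hom_add[OF \<kappa>(1)] mod_hom_add[OF \<phi>'] twisted_class_add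
        mod_hom_smult[OF \<kappa>(1)] mod_hom_smult[OF \<phi>'] twisted_class_smult)
  with \<kappa>(1) tc show thesis by (rule that)
qed

text \<open>
  By the vanishing criterion, \<open>\<Phi>([a], z) = 0\<close> means \<open>a + \<kappa> z = d y + x w\<close> and \<open>\<phi> z = d w\<close> for some \<open>y\<close> and
  \<open>w\<close>; so \<open>(z, w)\<close> lies in \<open>null_lifts\<close> and \<open>[a] = [x w - \<kappa> z]\<close>. The image of \<open>(0, w)\<close> is \<open>(x [w], 0)\<close>, which
  vanishes only if \<open>[w] = 0\<close>.
\<close>

lemma kernel_presentation:
  assumes F: "module A F" and \<phi>: "\<phi> \<in> mod_hom A F (cycles X 0)"
    and \<kappa>: "\<kappa> \<in> mod_hom A F (obj X (-1))" "\<And>z. z \<in> carrier F \<Longrightarrow> twisted_cycle X x (\<kappa> z) (\<phi> z)"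
    and nzd: "nonzerodivisor_on (cohomology X (-1)) x"
    and \<tau>: "\<And>a. a \<in> carrier (cycles X (-1)) \<Longrightarrow> \<tau> (coh_class X (-1) a) = twisted_class a \<zero>\<^bsub>obj X 0\<^esub>"
    and \<Phi>: "\<And>u z. u \<in> carrier (cohomology X (-1)) \<Longrightarrow> z \<in> carrier F \<Longrightarrow>
      \<Phi> (u, z) = \<tau> u \<oplus>\<^bsub>W\<^esub> twisted_class (\<kappa> z) (\<phi> z)"
  defines "K \<equiv> kernel_module (direct_sum (cohomology X (-1)) F) W \<Phi>"
  obtains k where "k \<in> mod_hom A (null_lifts F X \<phi>) K" "k ` carrier (null_lifts F X \<phi>) = carrier K"
    and "\<And>z w. (z, w) \<in> carrier (null_lifts F X \<phi>) \<Longrightarrow> k (z, w) = \<zero>\<^bsub>K\<^esub> \<longleftrightarrow>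
      z = \<zero>\<^bsub>F\<^esub> \<and> (\<exists>y\<in>carrier (obj X (-2)). w = diff X (-2) y)"
proof -
  let ?U = "cohomology X (-1)" and ?N = "null_lifts F X \<phi>"
  interpret F: module A F by (rule F)
  interpret U: module A ?U by (rule cohomology_module[OF X])
  note N = null_lifts_simps[OF F X \<phi>]
  have \<phi>': "\<phi> \<in> mod_hom A F (obj X 0)" using \<phi> by (auto simp: mod_hom_def)
  have \<phi>0: "\<phi> \<zero>\<^bsub>F\<^esub> = \<zero>\<^bsub>obj X 0\<^esub>" by (rule mod_hom_zero[OF F X.module_axioms \<phi>'])
  have \<kappa>0: "\<kappa> \<zero>\<^bsub>F\<^esub> = \<zero>\<^bsub>obj X (-1)\<^esub>" by (rule mod_hom_zero[OF F X.module_axioms \<kappa>(1)])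
  have \<Phi>_zero: "\<Phi> (coh_class X (-1) a, z) = \<zero>\<^bsub>W\<^esub> \<longleftrightarrow>
      (\<exists>y\<in>carrier (obj X (-2)). \<exists>w\<in>carrier (obj X (-1)).
        a \<oplus>\<^bsub>obj X (-1)\<^esub> \<kappa> z = diff X (-2) y \<oplus>\<^bsub>obj X (-1)\<^esub> x \<odot>\<^bsub>obj X (-1)\<^esub> w \<and> \<phi> z = diff X (-1) w)"
    if a: "a \<in> carrier (cycles X (-1))" and z: "z \<in> carrier F" for a z
  proof -
    note tc = twisted_cycle_of_cycle[OF a] \<kappa>(2)[OF z]
    have "\<Phi> (coh_class X (-1) a, z) = twisted_class (a \<oplus>\<^bsub>obj X (-1)\<^esub> \<kappa> z) (\<phi> z)"
      using twisted_class_add[OF tc] mod_hom_closed[OF \<phi>' z]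
      by (simp add: \<Phi>[OF coh_class_closed[OF X a] z] \<tau>[OF a])
    moreover have "twisted_cycle X x (a \<oplus>\<^bsub>obj X (-1)\<^esub> \<kappa> z) (\<phi> z)"
      using tc x mod_hom_closed[OF \<phi>' z]
      by (auto simp: twisted_cycle_def mod_hom_add[OF diff_mod_hom(1)])
    ultimately show ?thesis using twisted_class_eq_zero_iff by simp
  qed
  define c where "c = (\<lambda>q. x \<odot>\<^bsub>obj X (-1)\<^esub> snd q \<ominus>\<^bsub>obj X (-1)\<^esub> \<kappa> (fst q))"
  have "c \<in> mod_hom A (direct_sum F (obj X (-1))) (obj X (-1))"
    unfolding c_def by (rule mod_hom_minus_fun[OF X.module_axioms
        mod_hom_smult_fun[OF X.module_axioms x mod_hom_snd] mod_hom_compose[OF mod_hom_fst \<kappa>(1)]])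
  then have c': "c \<in> mod_hom A ?N (obj X (-1))" by (auto simp: mod_hom_def null_lifts_def)
  have c: "c \<in> mod_hom A ?N (cycles X (-1))"
  proof -
    have "diff X (-1) (c q) = \<zero>\<^bsub>obj X 0\<^esub>" if "q \<in> carrier ?N" for q
    proof -
      have q: "fst q \<in> carrier F" "snd q \<in> carrier (obj X (-1))" "\<phi> (fst q) = diff X (-1) (snd q)"
        using that unfolding N(2) by auto
      have "diff X (-1) (\<kappa> (fst q)) = x \<odot>\<^bsub>obj X 0\<^esub> \<phi> (fst q)"
        by (rule twisted_cycleD(4)[OF \<kappa>(2)[OF q(1)]])
      then show ?thesis
        using q x mod_hom_closed[OF \<kappa>(1) q(1)] mod_hom_closed[OF diff_mod_hom(1) q(2)]
        by (simp add: c_def mod_hom_minus[OF X.module_axioms X.module_axioms diff_mod_hom(1)]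
            mod_hom_smult[OF diff_mod_hom(1)] module_minus_self[OF X.module_axioms])
    qed
    then show ?thesis using c' by (auto simp: mod_hom_def)
  qed
  define k where "k = (\<lambda>q. (coh_class X (-1) (c q), fst q))"
  have fstN: "fst \<in> mod_hom A ?N F" unfolding null_lifts_def by (auto simp: mod_hom_def)
  have "k \<in> mod_hom A ?N (direct_sum ?U F)"
    unfolding k_def by (rule mod_hom_pair[OF mod_hom_compose[OF c coh_class_mod_hom[OF X]] fstN])
  moreover have "\<Phi> (k q) = \<zero>\<^bsub>W\<^esub>" if qN: "q \<in> carrier ?N" for q
  proof -
    have q: "fst q \<in> carrier F" "snd q \<in> carrier (obj X (-1))" "\<phi> (fst q) = diff X (-1) (snd q)"
      using qN unfolding N(2) by auto
    have "c q \<oplus>\<^bsub>obj X (-1)\<^esub> \<kappa> (fst q) = x \<odot>\<^bsub>obj X (-1)\<^esub> snd q"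
      using x q(2) mod_hom_closed[OF \<kappa>(1) q(1)] mod_hom_closed[OF c' qN]
      by (subst eq_commute, subst module_minus_eq_iff[OF X.module_axioms, symmetric]) (auto simp: c_def)
    then show ?thesis
      unfolding k_def \<Phi>_zero[OF mod_hom_closed[OF c qN] q(1)]
      using q x complex_diff_zero[OF X, of "-2"]
      by (intro bexI[of _ "\<zero>\<^bsub>obj X (-2)\<^esub>"] bexI[of _ "snd q"]) simp_all
  qed
  ultimately have kK: "k \<in> mod_hom A ?N K" by (auto simp: mod_hom_def K_def)
  have surj: "k ` carrier ?N = carrier K"
  proof (intro equalityI subsetI)
    show "l \<in> carrier K" if "l \<in> k ` carrier ?N" for l using that mod_hom_closed[OF kK] by blast
    fix l assume "l \<in> carrier K"
    then obtain u z where l: "l = (u, z)" "u \<in> carrier ?U" "z \<in> carrier F" "\<Phi> (u, z) = \<zero>\<^bsub>W\<^esub>"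
      by (auto simp: K_def)
    obtain a where a: "a \<in> carrier (cycles X (-1))" "u = coh_class X (-1) a"
      by (rule cohomologyE[OF X l(2)]) (rule that)
    obtain y w where y: "y \<in> carrier (obj X (-2))" and w: "w \<in> carrier (obj X (-1))"
      and eq: "a \<oplus>\<^bsub>obj X (-1)\<^esub> \<kappa> z = diff X (-2) y \<oplus>\<^bsub>obj X (-1)\<^esub> x \<odot>\<^bsub>obj X (-1)\<^esub> w" "\<phi> z = diff X (-1) w"
      using l(4) unfolding a(2) \<Phi>_zero[OF a(1) l(3)] by (elim bexE conjE) (rule that)
    have zw: "(z, w) \<in> carrier ?N" unfolding N(2) using l(3) w eq(2) by simp
    have cl: "a \<in> carrier (obj X (-1))" "\<kappa> z \<in> carrier (obj X (-1))" "diff X (-2) y \<in> carrier (obj X (-1))"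
      "x \<odot>\<^bsub>obj X (-1)\<^esub> w \<in> carrier (obj X (-1))"
      using a(1) mod_hom_closed[OF \<kappa>(1) l(3)] mod_hom_closed[OF diff_mod_hom(2) y] x w by simp_all
    have "a = (a \<oplus>\<^bsub>obj X (-1)\<^esub> \<kappa> z) \<ominus>\<^bsub>obj X (-1)\<^esub> \<kappa> z"
      using cl by (simp add: a_minus_def X.a_assoc X.r_neg)
    also have "\<dots> = diff X (-2) y \<oplus>\<^bsub>obj X (-1)\<^esub> c (z, w)"
      unfolding eq(1) using cl by (simp add: c_def a_minus_def X.a_assoc)
    finally have "coh_class X (-1) a = coh_class X (-1) (c (z, w))"
      unfolding coh_class_eq_iff[OF X a(1) mod_hom_closed[OF c zw]] using y by (intro bexI[of _ y]) simp_all
    then have "l = k (z, w)" by (simp add: l(1) a(2) k_def)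
    then show "l \<in> k ` carrier ?N" using zw by (rule image_eqI)
  qed
  have ker: "k (z, w) = \<zero>\<^bsub>K\<^esub> \<longleftrightarrow> z = \<zero>\<^bsub>F\<^esub> \<and> (\<exists>y\<in>carrier (obj X (-2)). w = diff X (-2) y)"
    if zw: "(z, w) \<in> carrier ?N" for z w
  proof -
    have w: "w \<in> carrier (obj X (-1))" "\<phi> z = diff X (-1) w" using zw unfolding N(2) by simp_all
    have "k (z, w) = \<zero>\<^bsub>K\<^esub> \<longleftrightarrow> z = \<zero>\<^bsub>F\<^esub> \<and> coh_class X (-1) (c (z, w)) = \<zero>\<^bsub>?U\<^esub>"
      by (auto simp: K_def k_def)
    also have "\<dots> \<longleftrightarrow> z = \<zero>\<^bsub>F\<^esub> \<and> coh_class X (-1) w = \<zero>\<^bsub>?U\<^esub>"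
    proof (rule conj_cong[OF refl])
      assume z: "z = \<zero>\<^bsub>F\<^esub>"
      have wc: "w \<in> carrier (cycles X (-1))" using w \<phi>0 z by simp
      have "coh_class X (-1) (c (z, w)) = x \<odot>\<^bsub>?U\<^esub> coh_class X (-1) w"
        using x w(1) z by (simp add: c_def \<kappa>0 a_minus_def module_neg_zero[OF X.module_axioms]
            coh_class_smult[OF X x wc])
      then show "coh_class X (-1) (c (z, w)) = \<zero>\<^bsub>?U\<^esub> \<longleftrightarrow> coh_class X (-1) w = \<zero>\<^bsub>?U\<^esub>"
        using nzd coh_class_closed[OF X wc] x by (auto simp: nonzerodivisor_on_def)
    qed
    also have "\<dots> \<longleftrightarrow> z = \<zero>\<^bsub>F\<^esub> \<and> (\<exists>y\<in>carrier (obj X (-2)). w = diff X (-2) y)"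
    proof (rule conj_cong[OF refl])
      assume "z = \<zero>\<^bsub>F\<^esub>"
      then have wc: "w \<in> carrier (cycles X (-1))" using w \<phi>0 by simp
      show "coh_class X (-1) w = \<zero>\<^bsub>?U\<^esub> \<longleftrightarrow> (\<exists>y\<in>carrier (obj X (-2)). w = diff X (-2) y)"
        using coh_class_eq_zero_iff[OF X wc] by simp
    qed
    finally show ?thesis .
  qed
  show thesis by (rule that[OF kK surj ker])
qed

end

theorem lemma2p2:
  fixes A :: "('a, 'r) ring_scheme"
    and X :: "('a, 'm) cplx"
    and U V :: "('a, 'm set) module"
    and F :: "('a, 'm) module"
    and \<alpha> :: "'m \<Rightarrow> 'm set"
    and x :: 'a
    and P :: "('a, 'p) cplx"
    and \<epsilon> :: "int \<Rightarrow> 'p \<Rightarrow> 'a set"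
    and j :: "int \<Rightarrow> 'a \<Rightarrow> 'p"
    and \<delta> :: "int \<Rightarrow> 'p \<Rightarrow> 'a"
    and W :: "('a, (int \<Rightarrow> 'p \<Rightarrow> 'm) set) module"
    and \<tau> :: "'m set \<Rightarrow> (int \<Rightarrow> 'p \<Rightarrow> 'm) set"
    and \<pi> :: "(int \<Rightarrow> 'p \<Rightarrow> 'm) set \<Rightarrow> 'm set"
    and xU :: "'m set set"
    and \<tau>bar :: "'m set set \<Rightarrow> (int \<Rightarrow> 'p \<Rightarrow> 'm) set"
    and f :: "('a, 'm) roof set"
  assumes "cring A"
    and "is_complex A X"
    and "U = cohomology X (-1)"
    and "V = cohomology X 0"
    and "\<And>i. i \<notin> {-1, 0} \<Longrightarrow> carrier (cohomology X i) = {\<zero>\<^bsub>cohomology X i\<^esub>}"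
    and "finitely_generated A U"
    and "finitely_generated A V"
    and "projective_module A F"
    and "\<alpha> \<in> mod_hom A F V"
    and "\<alpha> ` carrier F = carrier V"
    and "x \<in> carrier A"
    and "nonzerodivisor_on (regular_module A) x"
    and "nonzerodivisor_on U x"
    and "\<And>v. v \<in> carrier V \<Longrightarrow> x \<odot>\<^bsub>V\<^esub> v = \<zero>\<^bsub>V\<^esub>"
    \<comment> \<open>\<open>W = H\<^sup>0(RHom(B, X))\<close>, \<open>B = A/xA\<close>, by means of any projective resolution \<open>P\<close> of \<open>B\<close>\<close>
    and "projective_resolution A P (ring_quotient A x) \<epsilon>"
    and "W = cohomology (hom_complex A P X) 0"
    \<comment> \<open>the canonical maps\<close>
    and "represents_projection A x P \<epsilon> j"
    and "represents_connecting A x P \<epsilon> \<delta>"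
    and "\<tau> = les_tau A X P \<delta>"
    and "\<pi> = les_pi A X j"
    and "xU = multiples U x"
    and "\<tau>bar = (\<lambda>S. the_elem (\<tau> ` S))"
    \<comment> \<open>\<open>f\<close> corresponds to \<open>\<alpha>\<close> under the isomorphism asserted first below\<close>
    and "f = inv_into (carrier (derived_hom A (concentrated F) X)) (derived_H0 F X)
               (restrict \<alpha> (carrier F))"
  shows
    "derived_H0 F X \<in> mod_iso A (derived_hom A (concentrated F) X) (hom_module A F V) \<and>
     (short_exact A (quotient_module U xU) W V \<tau>bar \<pi> \<and>
      (\<forall>u\<in>carrier U. \<tau>bar (xU +>\<^bsub>U\<^esub> u) = \<tau> u)) \<and>
     (\<forall>C\<in>derived_cones X f.
        let Mf = cohomology C (-1) in
          (\<exists>\<alpha>t\<in>mod_hom A F W.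
             (\<forall>z\<in>carrier F. \<pi> (\<alpha>t z) = \<alpha> z) \<and>
             (let \<Phi> = (\<lambda>(u, z). \<tau>bar (xU +>\<^bsub>U\<^esub> u) \<oplus>\<^bsub>W\<^esub> \<alpha>t z) in
                \<Phi> ` carrier (direct_sum U F) = carrier W \<and>
                mod_isomorphic A Mf (kernel_module (direct_sum U F) W \<Phi>))) \<and>
          (\<exists>\<iota> \<rho>. short_exact A U Mf (kernel_module F V \<alpha>) \<iota> \<rho>))"
proof -
  note A = assms(1) and X = assms(2) and U = assms(3) and V = assms(4) and F = assms(8)
    and \<alpha> = assms(9) and \<alpha>_surj = assms(10) and x = assms(11) and xV = assms(14) and res = assms(15)
    and W = assms(16) and j = assms(17) and xU = assms(21) and \<tau>bar = assms(22) and f = assms(23)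
  have FM: "module A F" using F by (simp add: projective_module_def)
  have UM: "module A U" and VM: "module A V" unfolding U V by (rule cohomology_module[OF X])+
  obtain c where \<delta>: "chain_map A P (translate (ring_complex A) (-1)) \<delta>"
    and c: "chain_map A P (cone_of_mult A x) c"
    and c\<epsilon>: "homotopic A P (concentrated (ring_quotient A x)) (\<lambda>n v. ring_quotient_proj A x (snd (c n v))) \<epsilon>"
    and c\<delta>: "homotopic A P (translate (ring_complex A) (-1)) (\<lambda>n v. fst (c n v)) \<delta>"
    using assms(18) unfolding represents_connecting_def represents_roof_def by (elim conjE exE) (rule that)
  obtain p1 where "two_term_retraction A x P (\<lambda>v. fst (c (-1) v)) (\<lambda>v. snd (c 0 v)) p1 (j 0 \<one>\<^bsub>A\<^esub>)"
    by (rule exE[OF resolution_retraction[OF A x assms(12) res j c c\<epsilon>]]) (rule that)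
  then interpret R: retraction_target A x P "\<lambda>v. fst (c (-1) v)" "\<lambda>v. snd (c 0 v)" p1 "j 0 \<one>\<^bsub>A\<^esub>" X
    by (rule retraction_target.intro) (unfold_locales, rule X)
  have jmap: "chain_map A (ring_complex A) P j" using j by (simp add: represents_projection_def)
  have \<tau>: "\<tau> (coh_class X (-1) a) = R.twisted_class a \<zero>\<^bsub>obj X 0\<^esub>" if "a \<in> carrier (cycles X (-1))" for a
    unfolding assms(19) by (rule R.les_tau_coh_class[OF \<delta> fst_cone_chain_map[OF A c] refl c\<delta> that])
  have \<pi>: "\<pi> (R.twisted_class a b) = coh_class X 0 b" if "twisted_cycle X x a b" for a b
    unfolding assms(20) by (rule R.les_pi_twisted_class[OF jmap refl that])
  have xV': "x \<odot>\<^bsub>cohomology X 0\<^esub> v = \<zero>\<^bsub>cohomology X 0\<^esub>" if "v \<in> carrier (cohomology X 0)" for v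
    using xV that unfolding V by simp
  have exact: "\<tau> \<in> mod_hom A U W" "\<pi> \<in> mod_hom A W V" "{u \<in> carrier U. \<tau> u = \<zero>\<^bsub>W\<^esub>} = xU"
    "\<tau> ` carrier U = {w \<in> carrier W. \<pi> w = \<zero>\<^bsub>V\<^esub>}" "\<pi> ` carrier W = carrier V"
    unfolding xU U V W by (rule R.exact_sequence[of \<tau> \<pi>]; erule \<tau> \<pi> xV')+
  have WM: "module A W" unfolding W by (rule R.W_module)
  have "submodule xU A U" unfolding xU by (rule multiples_submodule[OF UM x])
  note ses = short_exact_of_exact[OF UM WM exact(1,2) this exact(3,4,5), folded \<tau>bar]
  have \<tau>bar_eq: "\<tau>bar (xU +>\<^bsub>U\<^esub> u) = \<tau> u" if "u \<in> carrier U" for u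
    using ses(2)[OF that] by (simp add: \<tau>bar)
  have part2: "let Mf = cohomology C (-1) in
          (\<exists>\<alpha>t\<in>mod_hom A F W.
             (\<forall>z\<in>carrier F. \<pi> (\<alpha>t z) = \<alpha> z) \<and>
             (let \<Phi> = (\<lambda>(u, z). \<tau>bar (xU +>\<^bsub>U\<^esub> u) \<oplus>\<^bsub>W\<^esub> \<alpha>t z) in
                \<Phi> ` carrier (direct_sum U F) = carrier W \<and>
                mod_isomorphic A Mf (kernel_module (direct_sum U F) W \<Phi>))) \<and>
          (\<exists>\<iota> \<rho>. short_exact A U Mf (kernel_module F V \<alpha>) \<iota> \<rho>)" if C: "C \<in> derived_cones X f" for C
  proof -
    obtain Z s g where C_eq: "C = mapping_cone Z X g" and Zf: "(Z, s, g) \<in> f"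
      using C by (auto simp: derived_cones_def)
    have \<alpha>_hom: "restrict \<alpha> (carrier F) \<in> carrier (hom_module A F (cohomology X 0))"
      using mod_hom_restrict[OF FM \<alpha>] by (simp add: V)
    note r = roof_of_derived_hom[OF F X \<alpha>_hom Zf[unfolded f]]
    obtain \<phi> p where \<phi>: "\<phi> \<in> mod_hom A F (cycles X 0)"
      and \<phi>H0: "\<And>z. z \<in> carrier F \<Longrightarrow> coh_class X 0 (\<phi> z) = roof_H0 F X (Z, s, g) z"
      and M: "module A (cohomology C (-1))"
      and p: "p \<in> mod_hom A (null_lifts F X \<phi>) (cohomology C (-1))"
        "p ` carrier (null_lifts F X \<phi>) = carrier (cohomology C (-1))"
      and pker: "\<And>z w. (z, w) \<in> carrier (null_lifts F X \<phi>) \<Longrightarrow> p (z, w) = \<zero>\<^bsub>cohomology C (-1)\<^esub> \<longleftrightarrow>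
        z = \<zero>\<^bsub>F\<^esub> \<and> (\<exists>y\<in>carrier (obj X (-2)). w = diff X (-2) y)"
      by (rule cone_cohomology_presentation[OF F X r(1), folded C_eq]) (rule that)
    have \<phi>\<alpha>: "coh_class X 0 (\<phi> z) = \<alpha> z" if "z \<in> carrier F" for z
      using \<phi>H0[OF that] that by (simp add: r(2))
    obtain \<kappa> where \<kappa>: "\<kappa> \<in> mod_hom A F (obj X (-1))"
      and tc: "\<And>z. z \<in> carrier F \<Longrightarrow> twisted_cycle X x (\<kappa> z) (\<phi> z)"
      and lift: "(\<lambda>z. R.twisted_class (\<kappa> z) (\<phi> z)) \<in> mod_hom A F R.W"
      by (rule R.twisted_lift[OF F \<phi>]) (erule xV', rule that)
    define \<alpha>t where "\<alpha>t = (\<lambda>z. R.twisted_class (\<kappa> z) (\<phi> z))"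
    have \<alpha>t: "\<alpha>t \<in> mod_hom A F W" unfolding \<alpha>t_def W by (rule lift)
    have \<pi>\<alpha>t: "\<pi> (\<alpha>t z) = \<alpha> z" if "z \<in> carrier F" for z
      by (simp add: \<alpha>t_def \<pi>[OF tc[OF that]] \<phi>\<alpha>[OF that])
    define \<Phi> where "\<Phi> = (\<lambda>(u, z). \<tau>bar (xU +>\<^bsub>U\<^esub> u) \<oplus>\<^bsub>W\<^esub> \<alpha>t z)"
    have \<Phi>: "\<Phi> (u, z) = \<tau> u \<oplus>\<^bsub>W\<^esub> \<alpha>t z" if "u \<in> carrier U" for u z
      using that by (simp add: \<Phi>_def \<tau>bar_eq)
    have "\<Phi> ` carrier (direct_sum U F) = (\<lambda>(u, z). \<tau> u \<oplus>\<^bsub>W\<^esub> \<alpha>t z) ` (carrier U \<times> carrier F)"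
      by (rule image_cong) (auto simp: \<Phi>)
    also have "\<dots> = carrier W"
    proof (rule extension_cover[OF UM WM VM exact(1,2,4) \<alpha>t])
      fix v assume "v \<in> carrier V"
      then obtain z where "z \<in> carrier F" "v = \<alpha> z" using \<alpha>_surj by blast
      then show "\<exists>z\<in>carrier F. \<pi> (\<alpha>t z) = v" using \<pi>\<alpha>t by (intro bexI[of _ z]) simp_all
    qed
    finally have \<Phi>_surj: "\<Phi> ` carrier (direct_sum U F) = carrier W" .
    have \<Phi>_hom: "\<Phi> \<in> mod_hom A (direct_sum U F) W"
      by (rule mod_hom_cong[OF direct_sum_module[OF UM FM] mod_hom_add_fun[OF WM
            mod_hom_compose[OF mod_hom_fst exact(1)] mod_hom_compose[OF mod_hom_snd \<alpha>t]]])
        (auto simp: \<Phi>)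
    let ?K = "kernel_module (direct_sum U F) W \<Phi>"
    have K: "module A ?K" by (rule kernel_module_module[OF direct_sum_module[OF UM FM] WM \<Phi>_hom])
    obtain k where k: "k \<in> mod_hom A (null_lifts F X \<phi>) ?K" "k ` carrier (null_lifts F X \<phi>) = carrier ?K"
      and kker: "\<And>z w. (z, w) \<in> carrier (null_lifts F X \<phi>) \<Longrightarrow> k (z, w) = \<zero>\<^bsub>?K\<^esub> \<longleftrightarrow>
        z = \<zero>\<^bsub>F\<^esub> \<and> (\<exists>y\<in>carrier (obj X (-2)). w = diff X (-2) y)"
    proof (rule R.kernel_presentation[of F \<phi> \<kappa> \<tau> \<Phi>, folded U W])
      show "module A F" "\<phi> \<in> mod_hom A F (cycles X 0)" "\<kappa> \<in> mod_hom A F (obj X (-1))"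
        "nonzerodivisor_on U x" by fact+
      show "twisted_cycle X x (\<kappa> z) (\<phi> z)" if "z \<in> carrier F" for z by (rule tc[OF that])
      show "\<tau> (coh_class X (-1) a) = R.twisted_class a \<zero>\<^bsub>obj X 0\<^esub>" if "a \<in> carrier (cycles X (-1))" for a
        by (rule \<tau>[OF that])
      show "\<Phi> (u, z) = \<tau> u \<oplus>\<^bsub>W\<^esub> R.twisted_class (\<kappa> z) (\<phi> z)" if "u \<in> carrier U" for u z
        using \<Phi>[OF that] by (simp add: \<alpha>t_def)
    qed (rule that)
    have "mod_isomorphic A (cohomology C (-1)) ?K"
    proof (rule mod_isomorphic_of_equal_kernels[OF null_lifts_simps(1)[OF FM X \<phi>] M K p k])
      fix q assume "q \<in> carrier (null_lifts F X \<phi>)"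
      then show "p q = \<zero>\<^bsub>cohomology C (-1)\<^esub> \<longleftrightarrow> k q = \<zero>\<^bsub>?K\<^esub>"
        using pker[of "fst q" "snd q"] kker[of "fst q" "snd q"] by simp
    qed
    moreover have "\<exists>\<iota> \<rho>. short_exact A U (cohomology C (-1)) (kernel_module F V \<alpha>) \<iota> \<rho>"
      unfolding U V by (rule cone_short_exact[OF FM X \<phi> \<alpha>[unfolded V] \<phi>\<alpha> M p pker])
    ultimately show ?thesis
      unfolding Let_def using \<alpha>t \<pi>\<alpha>t \<Phi>_surj unfolding \<Phi>_def by blast
  qed
  show ?thesis
    using derived_H0_iso[OF F X] ses(1) \<tau>bar_eq part2 unfolding V by blast
qed

end
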